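(* The $\epsilon$-regularity property fails for $4$-dimensional critical metrics and for $n$-dimensional Einstein metrics with $n\ge5$. Precisely: (i) There do not exist constants $\epsilon>0$ and $C>0$ such that for every complete $4$-dimensional Riemannian manifold $(M,g)$ with $g$ a critical metric, every $p\in M$ and every $0<r\le1$, the bound $\int_{B_r(p)}|\mathrm{Rm}|^2\le\epsilon$ implies $\sup_{B_{r/2}(p)}|\mathrm{Rm}|\le Cr^{-2}$. (ii) For every $n\ge5$, there do not exist constants $\epsilon>0$ and $C>0$ such that for every complete $n$-dimensional Einstein manifold $(M,g)$ with $\mathrm{Ric}=\lambda g$, $|\lambda|\le n-1$, every $p\in M$ and every $0<r\le1$, the bound $\int_{B_r(p)}|\mathrm{Rm}|^{n/2}\le\epsilon$ implies $\sup_{B_{r/2}(p)}|\mathrm{Rm}|\le Cr^{-2}$.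
   Context: A Riemannian metric is called critical if its Ricci tensor satisfies $\Delta\mathrm{Ric}=\mathrm{Rm}*\mathrm{Ric}$, where $\Delta$ is the rough Laplacian and $\mathrm{Rm}*\mathrm{Ric}$ denotes a linear combination, with fixed universal constant coefficients, of metric contractions of $\mathrm{Rm}\otimes\mathrm{Ric}$. Examples of critical metrics are K\"ahler metrics with constant scalar curvature, metrics with harmonic curvature, Bach-flat metrics with constant scalar curvature, and self-dual or anti-self-dual metrics with constant scalar curvature. $\mathrm{Rm}$ is the Riemann curvature tensor and $B_r(p)$ the geodesic ball. *)

theory Defs
  imports "HOL-Analysis.Analysis" "HOL-Combinatorics.Permutations"
begin

section \<open>Smooth functions on open subsets of Euclidean space\<close>

definition partial_deriv ::
    "'n::finite \<Rightarrow> (real^'n \<Rightarrow> 'b::real_normed_vector) \<Rightarrow> real^'n \<Rightarrow> 'b" where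
  "partial_deriv i f x = frechet_derivative f (at x) (axis i 1)"

text \<open>For open \<open>S\<close> this is smoothness of class C-infinity: every iterated partial derivative is
  totally differentiable, in particular continuous, on \<open>S\<close>.\<close>

definition smooth_on_open :: "(real^'n::finite) set \<Rightarrow> (real^'n \<Rightarrow> 'b::real_normed_vector) \<Rightarrow> bool" where
  "smooth_on_open S f \<longleftrightarrow> open S \<and> (\<forall>is. \<forall>x\<in>S. foldr partial_deriv is f differentiable (at x))"


section \<open>Riemannian manifolds\<close>

text \<open>A chart is a pair \<open>(U, \<phi>)\<close>; only the values of \<open>\<phi>\<close> on \<open>U\<close> matter.\<close>

type_synonym ('a, 'n) chart = "'a set \<times> ('a \<Rightarrow> real^'n)"

text \<open>\<open>rm_metric M c x $ i $ j\<close> is the component \<open>g\<^sub>i\<^sub>j\<close> of the metric in the chart \<open>c\<close> at the point with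
  coordinates \<open>x\<close>; it is meaningful only for \<open>c\<close> in the atlas and \<open>x\<close> in the coordinate image of \<open>c\<close>.
  The underlying set of the manifold is the underlying set of the topology \<open>rm_top M\<close>, which is
  unrelated to any topology carried by the type \<open>'a\<close>.\<close>

record ('a, 'n) riem =
  rm_top :: "'a topology"
  rm_atlas :: "('a, 'n) chart set"
  rm_metric :: "('a, 'n) chart \<Rightarrow> real^'n \<Rightarrow> real^'n^'n"

definition points :: "('a, 'n::finite) riem \<Rightarrow> 'a set" where
  "points M = topspace (rm_top M)"

definition coord_image :: "('a, 'n::finite) chart \<Rightarrow> (real^'n) set" where
  "coord_image c = snd c ` fst c"

definition chart_inv :: "('a, 'n::finite) chart \<Rightarrow> real^'n \<Rightarrow> 'a" where
  "chart_inv c = inv_into (fst c) (snd c)"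

definition transition :: "('a, 'n::finite) chart \<Rightarrow> ('a, 'n) chart \<Rightarrow> real^'n \<Rightarrow> real^'n" where
  "transition c d = snd d \<circ> chart_inv c"

definition is_chart :: "'a topology \<Rightarrow> ('a, 'n::finite) chart \<Rightarrow> bool" where
  "is_chart X c \<longleftrightarrow> openin X (fst c) \<and> open (coord_image c) \<and>
     homeomorphic_map (subtopology X (fst c)) (top_of_set (coord_image c)) (snd c)"

definition smooth_manifold :: "('a, 'n::finite) riem \<Rightarrow> bool" where
  "smooth_manifold M \<longleftrightarrow>
     Hausdorff_space (rm_top M) \<and> second_countable (rm_top M) \<and>
     (\<forall>c\<in>rm_atlas M. is_chart (rm_top M) c) \<and>
     (\<Union>c\<in>rm_atlas M. fst c) = points M \<and>
     (\<forall>c\<in>rm_atlas M. \<forall>d\<in>rm_atlas M. smooth_on_open (snd c ` (fst c \<inter> fst d)) (transition c d))"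

definition riemannian_manifold :: "('a, 'n::finite) riem \<Rightarrow> bool" where
  "riemannian_manifold M \<longleftrightarrow>
     smooth_manifold M \<and> connected_space (rm_top M) \<and>
     (\<forall>c\<in>rm_atlas M. smooth_on_open (coord_image c) (rm_metric M c) \<and>
        (\<forall>x\<in>coord_image c. transpose (rm_metric M c x) = rm_metric M c x \<and>
           (\<forall>v. v \<noteq> 0 \<longrightarrow> v \<bullet> (rm_metric M c x *v v) > 0))) \<and>
     (\<forall>c\<in>rm_atlas M. \<forall>d\<in>rm_atlas M. \<forall>x\<in>snd c ` (fst c \<inter> fst d). \<forall>i j.
        rm_metric M c x $ i $ j =
          (\<Sum>k\<in>UNIV. \<Sum>l\<in>UNIV. partial_deriv i (transition c d) x $ k
             * partial_deriv j (transition c d) x $ l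
             * rm_metric M d (transition c d x) $ k $ l))"


section \<open>Geodesic distance and completeness\<close>

definition arc_length :: "(real^'n::finite \<Rightarrow> real^'n^'n) \<Rightarrow> (real \<Rightarrow> real^'n) \<Rightarrow> real" where
  "arc_length G \<gamma> = integral {0..1} (\<lambda>t.
     sqrt (vector_derivative \<gamma> (at t) \<bullet> (G (\<gamma> t) *v vector_derivative \<gamma> (at t))))"

text \<open>\<open>curve_of_length M p q L\<close>: there is a piecewise continuously differentiable curve of length \<open>L\<close>
  from \<open>p\<close> to \<open>q\<close>. By compactness such a curve is a finite concatenation of continuously
  differentiable arcs, each lying in the domain of one chart.\<close>

inductive curve_of_length :: "('a, 'n::finite) riem \<Rightarrow> 'a \<Rightarrow> 'a \<Rightarrow> real \<Rightarrow> bool"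
  for M :: "('a, 'n) riem" where
  trivial: "p \<in> points M \<Longrightarrow> curve_of_length M p p 0"
| append: "\<lbrakk>curve_of_length M p (chart_inv c (\<gamma> 0)) L; c \<in> rm_atlas M;
            \<gamma> C1_differentiable_on {0..1}; \<gamma> ` {0..1} \<subseteq> coord_image c\<rbrakk>
           \<Longrightarrow> curve_of_length M p (chart_inv c (\<gamma> 1)) (L + arc_length (rm_metric M c) \<gamma>)"

definition geo_dist :: "('a, 'n::finite) riem \<Rightarrow> 'a \<Rightarrow> 'a \<Rightarrow> real" where
  "geo_dist M p q = Inf {L. curve_of_length M p q L}"

definition geo_ball :: "('a, 'n::finite) riem \<Rightarrow> 'a \<Rightarrow> real \<Rightarrow> 'a set" where
  "geo_ball M = Metric_space.mball (points M) (geo_dist M)"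

definition complete_riemannian :: "('a, 'n::finite) riem \<Rightarrow> bool" where
  "complete_riemannian M \<longleftrightarrow>
     riemannian_manifold M \<and> Metric_space.mcomplete (points M) (geo_dist M)"


section \<open>Riemannian volume\<close>

definition is_volume_measure :: "('a, 'n::finite) riem \<Rightarrow> 'a measure \<Rightarrow> bool" where
  "is_volume_measure M \<mu> \<longleftrightarrow>
     space \<mu> = points M \<and> sets \<mu> = sigma_sets (points M) {U. openin (rm_top M) U} \<and>
     (\<forall>c\<in>rm_atlas M. \<forall>A\<in>sets \<mu>. A \<subseteq> fst c \<longrightarrow>
        emeasure \<mu> A = (\<integral>\<^sup>+x\<in>snd c ` A. ennreal (sqrt (det (rm_metric M c x))) \<partial>lborel))"

text \<open>On a Riemannian manifold the measure exists and is unique, as countably many charts cover it.\<close>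

definition riem_volume :: "('a, 'n::finite) riem \<Rightarrow> 'a measure" where
  "riem_volume M = (THE \<mu>. is_volume_measure M \<mu>)"


section \<open>Curvature in local coordinates\<close>

text \<open>Below \<open>G\<close> is the matrix of a metric as a function of the coordinates. A covariant tensor field
  of rank \<open>k\<close> is given by its components, indexed by lists of length \<open>k\<close>.\<close>

type_synonym 'n metric_field = "real^'n \<Rightarrow> real^'n^'n"
type_synonym 'n tensor_field = "'n list \<Rightarrow> real^'n \<Rightarrow> real"

definition ginv :: "'n::finite metric_field \<Rightarrow> 'n \<Rightarrow> 'n \<Rightarrow> real^'n \<Rightarrow> real" where
  "ginv G i j x = matrix_inv (G x) $ i $ j"

text \<open>\<open>christoffel G k i j\<close> has the upper index \<open>k\<close>.\<close>

definition christoffel :: "'n::finite metric_field \<Rightarrow> 'n \<Rightarrow> 'n \<Rightarrow> 'n \<Rightarrow> real^'n \<Rightarrow> real" where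
  "christoffel G k i j x = (1/2) * (\<Sum>l\<in>UNIV. ginv G k l x *
     (partial_deriv i (\<lambda>y. G y $ j $ l) x + partial_deriv j (\<lambda>y. G y $ i $ l) x
      - partial_deriv l (\<lambda>y. G y $ i $ j) x))"

text \<open>\<open>riem_up G i j k l\<close> is the \<open>l\<close>-th component of \<open>R(\<partial>\<^sub>i, \<partial>\<^sub>j)\<partial>\<^sub>k\<close>, where
  \<open>R(X,Y)Z = \<nabla>\<^sub>X\<nabla>\<^sub>YZ - \<nabla>\<^sub>Y\<nabla>\<^sub>XZ - \<nabla>\<^bsub>[X,Y]\<^esub>Z\<close>. The Ricci tensor is the trace over \<open>i = l\<close>, so that round spheres
  have positive Ricci curvature.\<close>

definition riem_up :: "'n::finite metric_field \<Rightarrow> 'n \<Rightarrow> 'n \<Rightarrow> 'n \<Rightarrow> 'n \<Rightarrow> real^'n \<Rightarrow> real" where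
  "riem_up G i j k l x =
     partial_deriv i (christoffel G l j k) x - partial_deriv j (christoffel G l i k) x
     + (\<Sum>m\<in>UNIV. christoffel G m j k x * christoffel G l i m x
                - christoffel G m i k x * christoffel G l j m x)"

definition Rm :: "'n::finite metric_field \<Rightarrow> 'n tensor_field" where
  "Rm G is x = (\<Sum>m\<in>UNIV. G x $ (is!3) $ m * riem_up G (is!0) (is!1) (is!2) m x)"

definition Ric :: "'n::finite metric_field \<Rightarrow> 'n tensor_field" where
  "Ric G is x = (\<Sum>i\<in>UNIV. riem_up G i (is!0) (is!1) i x)"

definition Rm_norm_coord :: "'n::finite metric_field \<Rightarrow> real^'n \<Rightarrow> real" where
  "Rm_norm_coord G x = sqrt (\<Sum>i\<in>UNIV. \<Sum>j\<in>UNIV. \<Sum>k\<in>UNIV. \<Sum>l\<in>UNIV.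
     \<Sum>a\<in>UNIV. \<Sum>b\<in>UNIV. \<Sum>c\<in>UNIV. \<Sum>d\<in>UNIV.
       ginv G i a x * ginv G j b x * ginv G k c x * ginv G l d x
       * Rm G [i,j,k,l] x * Rm G [a,b,c,d] x)"

text \<open>Covariant derivative; the index of differentiation comes first.\<close>

definition cov_deriv :: "'n::finite metric_field \<Rightarrow> 'n tensor_field \<Rightarrow> 'n tensor_field" where
  "cov_deriv G T is x = (case is of [] \<Rightarrow> 0 | a # js \<Rightarrow>
     partial_deriv a (T js) x
     - (\<Sum>s<length js. \<Sum>m\<in>UNIV. christoffel G m a (js!s) x * T (js[s := m]) x))"

definition rough_laplacian :: "'n::finite metric_field \<Rightarrow> 'n tensor_field \<Rightarrow> 'n tensor_field" where
  "rough_laplacian G T is x =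
     (\<Sum>a\<in>UNIV. \<Sum>b\<in>UNIV. ginv G a b x * cov_deriv G (cov_deriv G T) (a # b # is) x)"

definition Rm_tensor_Ric :: "'n::finite metric_field \<Rightarrow> 'n tensor_field" where
  "Rm_tensor_Ric G is x = Rm G (take 4 is) x * Ric G (drop 4 is) x"

text \<open>A pattern for contracting the six slots of \<open>Rm \<otimes> Ric\<close> is a permutation \<open>\<sigma>\<close>: slot \<open>s\<close> receives
  the index at position \<open>\<sigma> s\<close> of a list \<open>[i,j,k,l,p,q]\<close>, in which \<open>k,l\<close> and \<open>p,q\<close> are contracted
  with the inverse metric and \<open>i,j\<close> either stay free (\<open>contr2\<close>) or are contracted as well
  (\<open>contr0\<close>).\<close>

definition place :: "(nat \<Rightarrow> nat) \<Rightarrow> 'n list \<Rightarrow> 'n list" where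
  "place \<sigma> w = map (\<lambda>s. w ! \<sigma> s) [0..<6]"

definition contr2 ::
    "'n::finite metric_field \<Rightarrow> (nat \<Rightarrow> nat) \<Rightarrow> 'n \<Rightarrow> 'n \<Rightarrow> real^'n \<Rightarrow> real" where
  "contr2 G \<sigma> i j x = (\<Sum>k\<in>UNIV. \<Sum>l\<in>UNIV. \<Sum>p\<in>UNIV. \<Sum>q\<in>UNIV.
     ginv G k l x * ginv G p q x * Rm_tensor_Ric G (place \<sigma> [i,j,k,l,p,q]) x)"

definition contr0 :: "'n::finite metric_field \<Rightarrow> (nat \<Rightarrow> nat) \<Rightarrow> real^'n \<Rightarrow> real" where
  "contr0 G \<sigma> x = (\<Sum>i\<in>UNIV. \<Sum>j\<in>UNIV. ginv G i j x * contr2 G \<sigma> i j x)"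

text \<open>The expression \<open>Rm * Ric\<close> with coefficient system \<open>(\<alpha>, \<beta>)\<close>: the general linear combination of the
  2-tensors obtained from \<open>Rm \<otimes> Ric\<close> and the metric by contraction. The terms with
  \<open>\<beta>\<close>, multiples of \<open>g\<close> such as \<open>\<bar>Ric\<bar>\<^sup>2 g\<close>, occur in the equation of Bach-flat metrics of
  constant scalar curvature.\<close>

definition Rm_star_Ric :: "((nat \<Rightarrow> nat) \<Rightarrow> real) \<Rightarrow> ((nat \<Rightarrow> nat) \<Rightarrow> real) \<Rightarrow>
    'n::finite metric_field \<Rightarrow> 'n \<Rightarrow> 'n \<Rightarrow> real^'n \<Rightarrow> real" where
  "Rm_star_Ric \<alpha> \<beta> G i j x =
     (\<Sum>\<sigma> | \<sigma> permutes {..<6}. \<alpha> \<sigma> * contr2 G \<sigma> i j x)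
     + G x $ i $ j * (\<Sum>\<sigma> | \<sigma> permutes {..<6}. \<beta> \<sigma> * contr0 G \<sigma> x)"


section \<open>Critical and Einstein metrics\<close>

text \<open>The coefficients are universal: they are parameters of the notion and do not depend on the
  metric.\<close>

definition critical_metric :: "((nat \<Rightarrow> nat) \<Rightarrow> real) \<Rightarrow> ((nat \<Rightarrow> nat) \<Rightarrow> real) \<Rightarrow>
    ('a, 'n::finite) riem \<Rightarrow> bool" where
  "critical_metric \<alpha> \<beta> M \<longleftrightarrow> (\<forall>c\<in>rm_atlas M. \<forall>x\<in>coord_image c. \<forall>i j.
     rough_laplacian (rm_metric M c) (Ric (rm_metric M c)) [i,j] x
       = Rm_star_Ric \<alpha> \<beta> (rm_metric M c) i j x)"

definition einstein_metric :: "real \<Rightarrow> ('a, 'n::finite) riem \<Rightarrow> bool" where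
  "einstein_metric lam M \<longleftrightarrow> (\<forall>c\<in>rm_atlas M. \<forall>x\<in>coord_image c. \<forall>i j.
     Ric (rm_metric M c) [i,j] x = lam * rm_metric M c x $ i $ j)"

text \<open>By the transformation law of the metric the value does not depend on the chart chosen.\<close>

definition Rm_norm :: "('a, 'n::finite) riem \<Rightarrow> 'a \<Rightarrow> real" where
  "Rm_norm M p = (let c = (SOME c. c \<in> rm_atlas M \<and> p \<in> fst c)
     in Rm_norm_coord (rm_metric M c) (snd c p))"

text \<open>A connected second-countable manifold has at most continuum many points, so up to isometry it
  lives on a subset of any type of that cardinality. Quantifying over all Riemannian manifolds with
  points in \<open>pt\<close> is therefore quantifying over all Riemannian manifolds.\<close>

type_synonym pt = "nat \<Rightarrow> real"

end

theory Submission
  imports Defs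
begin

text \<open>Both parts fail because of collapsing. Take a complete metric on Euclidean space that is
  invariant under translation along one coordinate and has curvature larger than \<open>C\<close> at the origin,
  and divide by the translations by multiples of \<open>\<delta>\<close>. As \<open>\<delta>\<close> tends to 0 the curvature stays the same,
  while the volume of the unit ball, and with it the curvature integral, is \<open>O(\<delta>)\<close>. For part (i) we use
  the product of hyperbolic 3-space of large negative curvature with the line; its Ricci tensor is parallel,
  so that it is critical with all coefficients zero. For part (ii) we use the product of a Taub-NUT space
  of small scale with a flat factor, which is Ricci-flat.\<close>

section \<open>Calculus of iterated partial derivatives\<close>

text \<open>Dimension four forces the two different examples. The collapsing direction is a flat
  factor, and a Ricci-flat 3-manifold is flat, so a curved product with a circle cannot be
  Ricci-flat in dimension four; a hyperbolic factor still has parallel Ricci tensor. From dimension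
  five on there is room for a curved Ricci-flat 4-manifold beside the circle. The estimate is
  contradicted at the single scale r = 1 and at the centre of the ball. The obstacle is to get
  completeness, and control of the unit ball that is uniform in \<delta>, without studying
  geodesics. Both come from one lower bound: the metric is at least 1/(1 + \<kappa>^2 |x'|^2) times
  the Euclidean one, where x' is the part of x transverse to the circle. Then ln(1 + \<kappa>^2
  |x'|^2) is Lipschitz with constant 2\<kappa> for the geodesic distance, so a ball has x' bounded
  in terms of \<kappa> and the radius only. Both metrics are written in global coordinates with
  rational entries, so that smoothness and curvature become algebra.\<close>

abbreviation smooth :: "(real^'n::finite \<Rightarrow> 'b::real_normed_vector) \<Rightarrow> bool" where
  "smooth f \<equiv> smooth_on_open UNIV f"

lemma partial_deriv_eqI:
  "(f has_derivative D) (at x) \<Longrightarrow> partial_deriv i f x = D (axis i 1)"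
  by (simp add: partial_deriv_def frechet_derivative_at[symmetric])

text \<open>\<open>frechet_derivative\<close> is a choice from the set of derivatives at the point.
  Functions that agree near the point have the same set, so the choices coincide whether or not a
  derivative exists.\<close>

lemma foldr_partial_deriv_cong:
  assumes "open S" "\<And>x. x \<in> S \<Longrightarrow> f x = g x" "x \<in> S"
  shows "foldr partial_deriv is f x = foldr partial_deriv is g x"
  using assms(3)
proof (induction "is" arbitrary: x)
  case Nil
  then show ?case using assms(2) by simp
next
  case (Cons i "is")
  let ?f = "foldr partial_deriv is f" and ?g = "foldr partial_deriv is g"
  have "(?f has_derivative D) (at x) \<longleftrightarrow> (?g has_derivative D) (at x)" for D
    using has_derivative_transform_within_open[OF _ assms(1) Cons.prems] Cons.IH by metis
  then have "frechet_derivative ?f (at x) = frechet_derivative ?g (at x)"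
    by (simp add: frechet_derivative_def)
  then show ?case by (simp add: partial_deriv_def[of i])
qed

lemma smooth_on_open_local:
  assumes "open S"
    and "\<And>x. x \<in> S \<Longrightarrow> \<exists>T g. open T \<and> x \<in> T \<and> smooth g \<and> (\<forall>y\<in>T. f y = g y)"
  shows "smooth_on_open S f"
  unfolding smooth_on_open_def
proof (intro conjI allI ballI assms(1))
  fix "is" x assume "x \<in> S"
  then obtain T g where *: "open T" "x \<in> T" "smooth g" "\<forall>y\<in>T. f y = g y"
    using assms(2) by blast
  then have "foldr partial_deriv is g differentiable (at x)"
    by (simp add: smooth_on_open_def)
  then obtain D where "(foldr partial_deriv is g has_derivative D) (at x)"
    by (auto simp: differentiable_def)
  then have "(foldr partial_deriv is f has_derivative D) (at x)"
    by (rule has_derivative_transform_within_open[OF _ *(1,2)])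
       (use foldr_partial_deriv_cong[OF *(1), of f g] *(4) in auto)
  then show "foldr partial_deriv is f differentiable (at x)"
    by (auto simp: differentiable_def)
qed

lemma smooth_differentiable: "smooth f \<Longrightarrow> f differentiable (at x)"
  unfolding smooth_on_open_def by (drule conjunct2, drule spec[of _ "[]"]) simp

lemma smooth_continuous: "smooth f \<Longrightarrow> continuous_on S f"
  by (meson smooth_differentiable continuous_at_imp_continuous_on differentiable_imp_continuous_within)

lemma smooth_partial_deriv: "smooth f \<Longrightarrow> smooth (partial_deriv i f)"
  unfolding smooth_on_open_def
proof (intro conjI allI ballI open_UNIV)
  fix "is" and x :: "real^'a"
  assume "open UNIV \<and> (\<forall>is. \<forall>x\<in>UNIV. foldr partial_deriv is f differentiable at x)"
  then have "foldr partial_deriv (is @ [i]) f differentiable at x" by blast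
  then show "foldr partial_deriv is (partial_deriv i f) differentiable at x" by simp
qed

text \<open>Smoothness is the largest property that implies differentiability and passes to partial
  derivatives. An invariant \<open>P\<close> replaces the computation of iterated partial
  derivatives.\<close>

lemma smooth_coinduct:
  assumes "P f"
    and step: "\<And>f. P f \<Longrightarrow> (\<forall>x. f differentiable (at x)) \<and> (\<forall>i. P (partial_deriv i f))"
  shows "smooth f"
proof -
  have "P (foldr partial_deriv is f)" for "is"
    by (induction "is") (use assms in auto)
  then show ?thesis using step by (auto simp: smooth_on_open_def)
qed

lemma smooth_const [simp]: "smooth (\<lambda>x. c)"
proof (rule smooth_coinduct[where P = "\<lambda>f. \<exists>c. f = (\<lambda>x. c)"])
  show "(\<forall>x. f differentiable (at x)) \<and> (\<forall>i. \<exists>c. partial_deriv i f = (\<lambda>x. c))"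
    if "\<exists>c. f = (\<lambda>x. c)" for f :: "real^'n \<Rightarrow> 'b"
    using that by (auto intro!: exI[of _ 0] partial_deriv_eqI ext derivative_eq_intros)
qed auto

lemma smooth_add_vec: "smooth (\<lambda>x::real^'n::finite. x + a)"
\<comment> \<open>The disjunct \<open>smooth f\<close> absorbs the partial derivatives, which are
  constant and no longer of the form \<open>x + a\<close>.\<close>
proof (rule smooth_coinduct[where P = "\<lambda>f. f = (\<lambda>x. x + a) \<or> smooth f"])
  fix f :: "real^'n \<Rightarrow> real^'n"
  assume "f = (\<lambda>x. x + a) \<or> smooth f"
  moreover have "partial_deriv i (\<lambda>x::real^'n. x + a) = (\<lambda>x. axis i 1)" for i
    by (rule ext, rule partial_deriv_eqI) (auto intro!: derivative_eq_intros)
  ultimately show "(\<forall>x. f differentiable (at x)) \<and>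
      (\<forall>i. partial_deriv i f = (\<lambda>x. x + a) \<or> smooth (partial_deriv i f))"
    by (auto simp: smooth_differentiable smooth_partial_deriv)
qed auto

lemma has_derivative_nth [derivative_intros]:
  "(f has_derivative D) F \<Longrightarrow> ((\<lambda>x. f x $ i) has_derivative (\<lambda>v. D v $ i)) F"
  by (rule bounded_linear.has_derivative[OF bounded_linear_vec_nth])

lemma partial_deriv_nth:
  "f differentiable (at x) \<Longrightarrow> partial_deriv i (\<lambda>y. f y $ k) x = partial_deriv i f x $ k"
proof -
  assume "f differentiable (at x)"
  then obtain D where "(f has_derivative D) (at x)" by (auto simp: differentiable_def)
  from partial_deriv_eqI[OF this] partial_deriv_eqI[OF has_derivative_nth[OF this]]
  show ?thesis by simp
qed

lemma smooth_nth_proj [simp]: "smooth (\<lambda>x::real^'n::finite. x $ k)"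
proof (rule smooth_coinduct[where P = "\<lambda>f. f = (\<lambda>x. x $ k) \<or> smooth f"])
  fix f :: "real^'n \<Rightarrow> real"
  assume "f = (\<lambda>x. x $ k) \<or> smooth f"
  moreover have "partial_deriv i (\<lambda>x::real^'n. x $ k) = (\<lambda>x. axis i 1 $ k)" for i
    by (rule ext, rule partial_deriv_eqI) (auto intro!: derivative_eq_intros)
  moreover have "(\<lambda>x::real^'n. x $ k) differentiable (at x)" for x
    by (auto simp: differentiable_def intro!: derivative_eq_intros exI)
  ultimately show "(\<forall>x. f differentiable (at x)) \<and>
      (\<forall>i. partial_deriv i f = (\<lambda>x. x $ k) \<or> smooth (partial_deriv i f))"
    by (auto simp: smooth_differentiable smooth_partial_deriv)
qed auto

lemma partial_deriv_add:
  "f differentiable (at x) \<Longrightarrow> g differentiable (at x) \<Longrightarrow>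
    partial_deriv i (\<lambda>x. f x + g x) x = partial_deriv i f x + partial_deriv i g x"
  unfolding partial_deriv_def frechet_derivative_works
  by (drule (1) has_derivative_add, drule frechet_derivative_at, drule fun_cong, erule sym)

lemma partial_deriv_mult:
  fixes f g :: "real^'n::finite \<Rightarrow> real"
  assumes "f differentiable (at x)" "g differentiable (at x)"
  shows "partial_deriv i (\<lambda>x. f x * g x) x = partial_deriv i f x * g x + f x * partial_deriv i g x"
proof -
  have "((\<lambda>x. f x * g x) has_derivative
      (\<lambda>v. f x * frechet_derivative g (at x) v + frechet_derivative f (at x) v * g x)) (at x)"
    using assms unfolding frechet_derivative_works by (rule has_derivative_mult)
  from partial_deriv_eqI[OF this] show ?thesis by (simp add: partial_deriv_def)
qed

lemma partial_deriv_inverse: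
  fixes f :: "real^'n::finite \<Rightarrow> real"
  assumes "f differentiable (at x)" "f x \<noteq> 0"
  shows "partial_deriv i (\<lambda>x. inverse (f x)) x = - (partial_deriv i f x * (inverse (f x) * inverse (f x)))"
proof -
  have "((\<lambda>x. inverse (f x)) has_derivative
      (\<lambda>v. - (inverse (f x) * frechet_derivative f (at x) v * inverse (f x)))) (at x)"
    using assms unfolding frechet_derivative_works by (intro Deriv.has_derivative_inverse)
  from partial_deriv_eqI[OF this] show ?thesis by (simp add: partial_deriv_def)
qed

text \<open>The algebra generated by the smooth functions is stable under partial derivatives, so that one
  coinduction gives all closure properties.\<close>

inductive smooth_expr :: "(real^'n::finite \<Rightarrow> real) \<Rightarrow> bool" where
  base: "smooth f \<Longrightarrow> smooth_expr f"
| add: "smooth_expr f \<Longrightarrow> smooth_expr g \<Longrightarrow> smooth_expr (\<lambda>x. f x + g x)"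
| mult: "smooth_expr f \<Longrightarrow> smooth_expr g \<Longrightarrow> smooth_expr (\<lambda>x. f x * g x)"
| inv: "smooth_expr f \<Longrightarrow> (\<And>x. f x \<noteq> 0) \<Longrightarrow> smooth_expr (\<lambda>x. inverse (f x))"

lemma smooth_expr_step:
  "smooth_expr f \<Longrightarrow> (\<forall>x. f differentiable (at x)) \<and> (\<forall>i. smooth_expr (partial_deriv i f))"
proof (induction rule: smooth_expr.induct)
  case (base f)
  then show ?case by (auto simp: smooth_differentiable smooth_partial_deriv smooth_expr.base)
next
  case (add f g)
  have "partial_deriv i (\<lambda>x. f x + g x) = (\<lambda>x. partial_deriv i f x + partial_deriv i g x)" for i
    using add by (auto simp: partial_deriv_add)
  then show ?case using add by (auto intro: smooth_expr.intros)
next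
  case (mult f g)
  have "partial_deriv i (\<lambda>x. f x * g x) =
      (\<lambda>x. partial_deriv i f x * g x + f x * partial_deriv i g x)" for i
    using mult by (auto simp: partial_deriv_mult)
  then show ?case using mult by (simp add: smooth_expr.add smooth_expr.mult)
next
  case (inv f)
  \<comment> \<open>The sign is written as a factor -1 because the algebra is generated by sums,
    products and inverses.\<close>
  have eq: "partial_deriv i (\<lambda>x. inverse (f x)) =
      (\<lambda>x. (-1) * (partial_deriv i f x * (inverse (f x) * inverse (f x))))" for i
    using inv by (auto simp: partial_deriv_inverse)
  have "smooth_expr (partial_deriv i (\<lambda>x. inverse (f x)))" for i
    unfolding eq by (intro smooth_expr.mult smooth_expr.inv) (use inv in \<open>auto intro: smooth_expr.base\<close>)
  then show ?case using inv by (auto intro!: differentiable_inverse)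
qed

lemma smooth_expr_smooth: "smooth_expr f \<Longrightarrow> smooth f"
  by (rule smooth_coinduct[where P = smooth_expr, OF _ smooth_expr_step])

lemma smooth_add [intro]:
  "smooth f \<Longrightarrow> smooth g \<Longrightarrow> smooth (\<lambda>x. f x + g x :: real)"
  by (simp add: smooth_expr_smooth smooth_expr.intros)

lemma smooth_mult [intro]:
  "smooth f \<Longrightarrow> smooth g \<Longrightarrow> smooth (\<lambda>x. f x * g x :: real)"
  by (simp add: smooth_expr_smooth smooth_expr.intros)

lemma smooth_inverse [intro]:
  "smooth f \<Longrightarrow> (\<And>x. f x \<noteq> 0) \<Longrightarrow> smooth (\<lambda>x. inverse (f x) :: real)"
  by (simp add: smooth_expr_smooth smooth_expr.intros)

lemma smooth_divide [intro]:
  "smooth f \<Longrightarrow> smooth g \<Longrightarrow> (\<And>x. g x \<noteq> 0) \<Longrightarrow> smooth (\<lambda>x. f x / g x :: real)"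
  by (simp add: divide_inverse smooth_mult smooth_inverse)

lemma smooth_diff [intro]:
  "smooth f \<Longrightarrow> smooth g \<Longrightarrow> smooth (\<lambda>x. f x - g x :: real)"
  using smooth_add[OF _ smooth_mult[OF smooth_const[of "-1"]], of f g] by simp

lemma smooth_power2 [intro]: "smooth f \<Longrightarrow> smooth (\<lambda>x. (f x)\<^sup>2 :: real)"
  by (simp add: power2_eq_square smooth_mult)

lemma smooth_sum [intro]:
  "(\<And>k. k \<in> K \<Longrightarrow> smooth (f k)) \<Longrightarrow> smooth (\<lambda>x. \<Sum>k\<in>K. f k x :: real)"
  by (induction K rule: infinite_finite_induct) auto

lemma differentiable_vecI:
  fixes f :: "'a::real_normed_vector \<Rightarrow> 'b::real_normed_vector^'m::finite"
  assumes "\<And>k. (\<lambda>x. f x $ k) differentiable (at x)"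
  shows "f differentiable (at x)"
proof -
  have "bounded_linear (axis k :: 'b \<Rightarrow> 'b^'m)" for k
  proof (rule bounded_linear_intro[of _ 1])
    show "norm (axis k x :: 'b^'m) \<le> norm x * 1" for x
      using L2_set_le_sum[of UNIV "\<lambda>i. norm ((axis k x :: 'b^'m) $ i)"]
      by (simp add: norm_vec_def axis_def if_distrib[of norm] cong: if_cong)
  qed (auto simp: axis_def vec_eq_iff)
  then have "(\<lambda>x. axis k (f x $ k) :: 'b^'m) differentiable (at x)" for k
    using assms[of k] bounded_linear.has_derivative unfolding differentiable_def by blast
  then have "(\<lambda>x. \<Sum>k\<in>UNIV. axis k (f x $ k)) differentiable (at x)"
    by (intro differentiable_sum) auto
  moreover have "(\<lambda>x. \<Sum>k\<in>UNIV. axis k (f x $ k)) = f"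
    by (auto simp: vec_eq_iff axis_def if_distrib cong: if_cong)
  ultimately show ?thesis by simp
qed

lemma smooth_vecI:
  fixes f :: "real^'n::finite \<Rightarrow> 'b::real_normed_vector^'m::finite"
  assumes "\<And>k. smooth (\<lambda>x. f x $ k)"
  shows "smooth f"
proof (rule smooth_coinduct[where P = "\<lambda>f. \<forall>k. smooth (\<lambda>x. f x $ k)"])
  fix f :: "real^'n \<Rightarrow> 'b^'m"
  assume *: "\<forall>k. smooth (\<lambda>x. f x $ k)"
  then have d: "f differentiable (at x)" for x
    by (intro differentiable_vecI smooth_differentiable) auto
  have "(\<lambda>x. partial_deriv i f x $ k) = partial_deriv i (\<lambda>x. f x $ k)" for i k
    using partial_deriv_nth[OF d] by auto
  then show "(\<forall>x. f differentiable (at x)) \<and> (\<forall>i k. smooth (\<lambda>x. partial_deriv i f x $ k))"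
    using d * by (auto simp: smooth_partial_deriv)
qed (use assms in auto)

lemma smooth_christoffel:
  assumes "\<And>i j. smooth (\<lambda>x. G x $ i $ j)" "\<And>i j. smooth (ginv G i j)"
  shows "smooth (christoffel G k i j)"
  unfolding christoffel_def[abs_def]
  using assms by (intro smooth_mult smooth_sum smooth_diff smooth_add smooth_partial_deriv smooth_const) auto

lemma smooth_riem_up:
  assumes "\<And>i j. smooth (\<lambda>x. G x $ i $ j)" "\<And>i j. smooth (ginv G i j)"
  shows "smooth (riem_up G i j k l)"
  unfolding riem_up_def[abs_def]
  using assms by (intro smooth_mult smooth_sum smooth_diff smooth_add smooth_partial_deriv smooth_christoffel) auto

text \<open>Only continuity is claimed, since the norm is a square root and may fail to be smooth at
  its zeros. It serves to bound the curvature on compact boxes.\<close>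

lemma continuous_Rm_norm_coord:
  assumes G: "\<And>i j. smooth (\<lambda>x. G x $ i $ j)" "\<And>i j. smooth (ginv G i j)"
  shows "continuous_on S (Rm_norm_coord G)"
proof -
  have Rm: "smooth (Rm G is)" for "is"
    unfolding Rm_def[abs_def]
    using G by (intro smooth_mult smooth_sum smooth_riem_up) auto
  show ?thesis
    unfolding Rm_norm_coord_def[abs_def]
    by (intro continuous_intros smooth_continuous smooth_sum smooth_mult G Rm)
qed

section \<open>Circle quotients of metrics on Euclidean space\<close>

text \<open>A real is coded as a set of naturals, and a sequence of such sets as one set of
  pairs.\<close>

lemma pt_lepoll_real: "(UNIV :: pt set) \<lesssim> (UNIV :: real set)"
proof -
  obtain h :: "real \<Rightarrow> nat set" where h: "inj h"
    using nat_sets_eqpoll_reals eqpoll_imp_lepoll eqpoll_sym unfolding lepoll_def by blast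
  define F where "F f = {n. snd (prod_decode n) \<in> h (f (fst (prod_decode n)))}" for f :: pt
  have "inj F"
  proof (rule injI)
    fix f g assume eq: "F f = F g"
    have "j \<in> h (f i) \<longleftrightarrow> j \<in> h (g i)" for i j
      using eq[unfolded F_def set_eq_iff, rule_format, of "prod_encode (i, j)"] by simp
    then show "f = g" using injD[OF h] by blast
  qed
  then have "(UNIV :: pt set) \<lesssim> (UNIV :: nat set set)"
    unfolding lepoll_def by blast
  then show ?thesis
    using nat_sets_eqpoll_reals eqpoll_imp_lepoll lepoll_trans by blast
qed

text \<open>Two injections: a vector is read as a sequence of coordinates, and conversely the real
  line is squeezed by \<open>arctan\<close> into an interval of length \<delta> on the
  \<open>e\<close> axis.\<close>

lemma slab_eqpoll_pt:
  fixes e :: "'n::finite"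
  assumes "0 < \<delta>"
  shows "{x :: real^'n. 0 \<le> x $ e \<and> x $ e < \<delta>} \<approx> (UNIV :: pt set)"
proof (rule lepoll_antisym)
  have "inj (\<lambda>(x::real^'n) k. x $ from_nat k)"
  proof (rule injI)
    fix x y :: "real^'n"
    assume "(\<lambda>k. x $ from_nat k) = (\<lambda>k. y $ from_nat k)"
    then have "x $ from_nat (to_nat i) = y $ from_nat (to_nat i)" for i :: 'n
      by meson
    then show "x = y" by (simp add: vec_eq_iff)
  qed
  then show "{x :: real^'n. 0 \<le> x $ e \<and> x $ e < \<delta>} \<lesssim> (UNIV :: pt set)"
    unfolding lepoll_def by (meson inj_on_subset subset_UNIV)
next
  let ?g = "\<lambda>r. axis e (\<delta> * (arctan r + pi/2) / pi) :: real^'n"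
  have "inj ?g"
    using assms by (auto intro!: injI simp: axis_eq_axis arctan_eq_iff)
      (use arctan_lbound in \<open>smt (verit)\<close>)
  moreover have "0 \<le> ?g r $ e \<and> ?g r $ e < \<delta>" for r
  proof -
    have "0 < (arctan r + pi/2) / pi" "(arctan r + pi/2) / pi < 1"
      using arctan_bounded[of r] by (simp_all add: field_simps)
    with assms have "0 < \<delta> * ((arctan r + pi/2) / pi)" "\<delta> * ((arctan r + pi/2) / pi) < \<delta> * 1"
      by (intro mult_pos_pos mult_strict_left_mono; simp)+
    then show ?thesis by (simp add: axis_def)
  qed
  ultimately have "(UNIV :: real set) \<lesssim> {x :: real^'n. 0 \<le> x $ e \<and> x $ e < \<delta>}"
    unfolding lepoll_def by blast
  then show "(UNIV :: pt set) \<lesssim> {x :: real^'n. 0 \<le> x $ e \<and> x $ e < \<delta>}"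
    using lepoll_trans pt_lepoll_real by blast
qed

lemma matrix_quadratic_form: "v \<bullet> (A *v v) = (\<Sum>i\<in>UNIV. \<Sum>j\<in>UNIV. v $ i * (A $ i $ j * v $ j))"
  for v :: "real^'n::finite"
  by (simp add: inner_vec_def matrix_vector_mult_def sum_distrib_left)

text \<open>The last assumption makes \<open>G\<close> positive definite and bounds the length of a
  curve running out to transverse radius R below by the integral of 1/sqrt(1 + \<kappa>^2 s^2) over
  s up to R, which diverges: this is the source of completeness. The constant \<kappa> is separate
  from \<delta>, so bounds in \<kappa> survive the collapse.\<close>

locale circle_quotient =
  fixes G :: "real^'n::finite \<Rightarrow> real^'n^'n" and e :: 'n and \<delta> \<kappa> :: real
  assumes \<delta>: "0 < \<delta>" and \<kappa>: "0 < \<kappa>"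
    and smooth_G: "smooth G"
    and sym_G: "transpose (G x) = G x"
    and shift_G: "G (x + t *\<^sub>R axis e 1) = G x"
    and G_bound: "(norm v)\<^sup>2 \<le> (1 + \<kappa>\<^sup>2 * (norm (x - (x $ e) *\<^sub>R axis e 1))\<^sup>2) * (v \<bullet> (G x *v v))"
begin

definition sh :: "int \<Rightarrow> real^'n" where
  "sh k = (of_int k * \<delta>) *\<^sub>R axis e 1"

definition slab :: "(real^'n) set" where
  "slab = {x. 0 \<le> x $ e \<and> x $ e < \<delta>}"

definition strip :: "real \<Rightarrow> (real^'n) set" where
  "strip a = {x. a < x $ e \<and> x $ e < a + \<delta>}"

text \<open>The points of the quotient exhaust the type \<open>pt\<close>, because \<open>Metric_space\<close> requires
  non-negativity and symmetry of the distance on the whole type, whereas \<open>geo_dist\<close> is the unspecified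
  value \<open>Inf {}\<close> outside the manifold.\<close>

definition enc :: "real^'n \<Rightarrow> pt" where
  "enc = (SOME f. bij_betw f slab UNIV)"

definition proj :: "real^'n \<Rightarrow> pt" where
  "proj x = enc (x - sh \<lfloor>x $ e / \<delta>\<rfloor>)"

definition chart :: "real \<Rightarrow> (pt, 'n) chart" where
  "chart a = (proj ` strip a, inv_into (strip a) proj)"

text \<open>All offsets in \<open>{0..\<delta>}\<close> are used, so that any two points lie in one
  common chart; Hausdorff separation and the existence of connecting curves then take place in a
  single convex strip. Transition maps are local translations along \<open>e\<close>, which leave
  \<open>G\<close> invariant, so one matrix function serves every chart.\<close>

definition M :: "(pt, 'n) riem" where
  "M = \<lparr>rm_top = topology (\<lambda>U. open (proj -` U)), rm_atlas = chart ` {0..\<delta>}, rm_metric = (\<lambda>_. G)\<rparr>"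

section \<open>Translations along the circle direction and their fundamental domains\<close>

lemma sh_nth: "sh k $ i = (if i = e then of_int k * \<delta> else 0)"
  by (auto simp: sh_def axis_def)

lemma sh_add: "sh (k + l) = sh k + sh l"
  by (simp add: sh_def scaleR_add_left distrib_right)

lemma sh_0 [simp]: "sh 0 = 0"
  by (simp add: sh_def)

lemma sh_minus: "sh (- k) = - sh k"
  by (simp add: sh_def)

lemma sh_diff: "sh (k - l) = sh k - sh l"
  by (simp add: sh_def scaleR_diff_left left_diff_distrib)

lemma G_sh [simp]: "G (x + sh k) = G x"
  by (simp add: sh_def shift_G)

lemma slab_unique:
  assumes "b \<le> x $ e" "x $ e < b + \<delta>" "b \<le> (x + sh k) $ e" "(x + sh k) $ e < b + \<delta>"
  shows "k = 0"
proof -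
  have "\<bar>of_int k * \<delta>\<bar> < 1 * \<delta>" using assms by (auto simp: sh_nth)
  then have "\<bar>real_of_int k\<bar> < 1" using \<delta> by (simp add: abs_mult)
  then show ?thesis by linarith
qed

lemma slab_shift: "b \<le> (x - sh \<lfloor>(x $ e - b) / \<delta>\<rfloor>) $ e" "(x - sh \<lfloor>(x $ e - b) / \<delta>\<rfloor>) $ e < b + \<delta>"
proof -
  have "of_int \<lfloor>(x $ e - b) / \<delta>\<rfloor> * \<delta> \<le> x $ e - b"
    "x $ e - b < (of_int \<lfloor>(x $ e - b) / \<delta>\<rfloor> + 1) * \<delta>"
    using \<delta> by (simp_all add: pos_le_divide_eq[symmetric] pos_divide_less_eq[symmetric])
  then show "b \<le> (x - sh \<lfloor>(x $ e - b) / \<delta>\<rfloor>) $ e" "(x - sh \<lfloor>(x $ e - b) / \<delta>\<rfloor>) $ e < b + \<delta>"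
    by (simp_all add: sh_nth distrib_right)
qed

lemma bij_enc: "bij_betw enc slab UNIV"
  unfolding enc_def
  using slab_eqpoll_pt[OF \<delta>, of e] unfolding eqpoll_def slab_def by (rule someI_ex)

lemma slab_reduce: "x - sh \<lfloor>x $ e / \<delta>\<rfloor> \<in> slab"
  using slab_shift[where b = 0 and x = x] by (simp add: slab_def)

lemma proj_eq_iff: "proj x = proj y \<longleftrightarrow> (\<exists>k. y = x + sh k)"
proof
  assume "proj x = proj y"
  then have "x - sh \<lfloor>x $ e / \<delta>\<rfloor> = y - sh \<lfloor>y $ e / \<delta>\<rfloor>"
    using bij_enc slab_reduce unfolding proj_def bij_betw_def inj_on_def by blast
  then have "y = x + sh (\<lfloor>y $ e / \<delta>\<rfloor> - \<lfloor>x $ e / \<delta>\<rfloor>)"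
    by (simp add: sh_diff algebra_simps)
  then show "\<exists>k. y = x + sh k" ..
next
  assume "\<exists>k. y = x + sh k"
  then obtain k where y: "y = x + sh k" ..
  have "y $ e / \<delta> = x $ e / \<delta> + of_int k"
    using \<delta> by (simp add: y sh_nth field_simps)
  then have "\<lfloor>y $ e / \<delta>\<rfloor> = \<lfloor>x $ e / \<delta>\<rfloor> + k" by simp
  then show "proj x = proj y"
    by (simp add: proj_def y sh_add)
qed

lemma proj_sh [simp]: "proj (x + sh k) = proj x"
  using proj_eq_iff by metis

lemma proj_lift: "\<exists>x. proj x = p \<and> b \<le> x $ e \<and> x $ e < b + \<delta>"
proof -
  obtain x where x: "x \<in> slab" "p = enc x"
    using bij_enc unfolding bij_betw_def by blast
  have "x - sh \<lfloor>x $ e / \<delta>\<rfloor> = x"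
    using x(1) \<delta> by (simp add: slab_def floor_eq_iff sh_def divide_less_eq)
  then have "p = proj x" by (simp add: proj_def x(2))
  then have "proj (x - sh \<lfloor>(x $ e - b) / \<delta>\<rfloor>) = p"
    using proj_sh[of x "- \<lfloor>(x $ e - b) / \<delta>\<rfloor>"] by (simp add: sh_minus)
  then show ?thesis using slab_shift by blast
qed

lemma surj_proj: "range proj = UNIV"
  unfolding surj_def using proj_lift by metis

lemma inj_on_strip: "inj_on proj (strip a)"
proof (rule inj_onI)
  fix x y assume xy: "x \<in> strip a" "y \<in> strip a" "proj x = proj y"
  then obtain k where "y = x + sh k" using proj_eq_iff by blast
  moreover from this have "k = 0" using slab_unique[of a x k] xy by (auto simp: strip_def)
  ultimately show "x = y" by simp
qed

text \<open>An orbit misses the open strip only if it meets the wall at height \<open>a\<close>. Two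
  orbits exclude at most two offsets in \<open>{0..<\<delta>}\<close>.\<close>

lemma common_strip: "\<exists>a\<in>{0..\<delta>}. \<exists>x\<in>strip a. \<exists>y\<in>strip a. proj x = p \<and> proj y = q"
proof -
  obtain x y where x: "proj x = p" "0 \<le> x $ e" "x $ e < \<delta>" and y: "proj y = q" "0 \<le> y $ e" "y $ e < \<delta>"
    using proj_lift[of p 0] proj_lift[of q 0] by auto
  have "infinite ({0..<\<delta>} - {x $ e, y $ e})"
    using \<delta> by simp
  then have "{0..<\<delta>} - {x $ e, y $ e} \<noteq> {}"
    by (rule infinite_imp_nonempty)
  then obtain a where a: "a \<in> {0..<\<delta>}" "a \<noteq> x $ e" "a \<noteq> y $ e"
    by blast
  have "\<exists>x'\<in>strip a. proj x' = proj z" if z: "0 \<le> z $ e" "z $ e < \<delta>" "a \<noteq> z $ e" for z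
  proof -
    obtain x' where x': "proj x' = proj z" "a \<le> x' $ e" "x' $ e < a + \<delta>"
      using proj_lift by blast
    then obtain k where k: "x' = z + sh k" using proj_eq_iff by metis
    have "x' $ e \<noteq> a"
    proof
      assume "x' $ e = a"
      then have "k = 0" using slab_unique[of 0 z k] z a k by auto
      then show False using k z \<open>x' $ e = a\<close> by simp
    qed
    then show ?thesis using x' by (intro bexI[of _ x']) (auto simp: strip_def)
  qed
  from this[of x] this[of y] show ?thesis
    using x y a by (intro bexI[of _ a]) auto
qed

lemma open_strip: "open (strip a)"
  unfolding strip_def Collect_conj_eq
  by (intro open_Int open_Collect_less continuous_intros)

lemma convex_strip: "convex (strip a)"
  unfolding strip_def Collect_conj_eq
  using convex_halfspace_lt[where a = "axis e (1::real)"] convex_halfspace_gt[where a = "axis e (1::real)"]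
  by (intro convex_Int) (simp_all add: inner_axis inner_commute[of "axis e 1"])

section \<open>Quotient topology and smooth structure\<close>

lemma openin_M: "openin (rm_top M) U \<longleftrightarrow> open (proj -` U)"
proof -
  have "istopology (\<lambda>U. open (proj -` U))"
    by (auto simp: istopology_def vimage_Union intro: open_Int open_UN)
  then show ?thesis by (simp add: M_def)
qed

lemma points_M [simp]: "points M = UNIV" "topspace (rm_top M) = UNIV"
  by (auto simp: points_def topspace_def openin_M intro!: exI[of _ UNIV])

lemma atlas_M: "rm_atlas M = chart ` {0..\<delta>}" and metric_M [simp]: "rm_metric M c = G"
  by (simp_all add: M_def)

lemma chart_simps [simp]:
  "fst (chart a) = proj ` strip a"
  "x \<in> strip a \<Longrightarrow> snd (chart a) (proj x) = x"
  using inj_on_strip by (auto simp: chart_def inv_into_f_f)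

lemma snd_chart_image: "V \<subseteq> strip a \<Longrightarrow> snd (chart a) ` proj ` V = V"
  by (force simp: image_image)

lemma coord_image_chart [simp]: "coord_image (chart a) = strip a"
  by (simp add: coord_image_def snd_chart_image)

lemma inj_on_chart: "inj_on (snd (chart a)) (proj ` strip a)"
  by (auto intro: inj_onI)

lemma chart_inv_chart [simp]: "x \<in> strip a \<Longrightarrow> chart_inv (chart a) x = proj x"
  unfolding chart_inv_def using inv_into_f_f[OF inj_on_chart, of "proj x" a] by simp

lemma open_proj: "open V \<Longrightarrow> open (proj -` proj ` V)"
proof -
  assume V: "open V"
  have "proj x = proj y \<longleftrightarrow> (\<exists>k. x = sh k + y)" for x y
    using proj_eq_iff[of y x] by (metis add.commute)
  then have "proj -` proj ` V = (\<Union>k. (\<lambda>x. sh k + x) ` V)"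
    unfolding vimage_def image_def by blast
  then show ?thesis using V by (auto intro: open_translation)
qed

lemma continuous_map_proj: "continuous_map euclidean (rm_top M) proj"
proof -
  have "open {x. proj x \<in> U}" if "open (proj -` U)" for U
    using that by (simp add: vimage_def)
  then show ?thesis by (auto simp: continuous_map_def openin_M)
qed

lemma is_chart_chart: "is_chart (rm_top M) (chart a)"
proof -
  let ?X = "subtopology (rm_top M) (proj ` strip a)"
  have "continuous_map ?X (top_of_set (strip a)) (snd (chart a))"
    unfolding continuous_map_def
  proof (intro conjI allI impI)
    fix U assume "openin (top_of_set (strip a)) U"
    then have U: "open U" "U \<subseteq> strip a"
      using openin_open_eq[OF open_strip] by auto
    have "{x \<in> topspace ?X. snd (chart a) x \<in> U} = proj ` U"
      using U by auto
    moreover have "openin ?X (proj ` U)"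
      unfolding openin_subtopology using U open_proj[of U] openin_M by blast
    ultimately show "openin ?X {x \<in> topspace ?X. snd (chart a) x \<in> U}" by simp
  qed auto
  moreover have "continuous_map (top_of_set (strip a)) ?X proj"
    using continuous_map_proj
    by (auto simp: continuous_map_in_subtopology intro: continuous_map_from_subtopology)
  ultimately have "homeomorphic_maps ?X (top_of_set (strip a)) (snd (chart a)) proj"
    by (auto simp: homeomorphic_maps_def)
  then show ?thesis
    by (auto simp: is_chart_def openin_M open_proj open_strip homeomorphic_maps_map)
qed

lemma Hausdorff_M: "Hausdorff_space (rm_top M)"
  unfolding Hausdorff_space_def
proof (intro allI impI)
  fix p q assume *: "p \<in> topspace (rm_top M) \<and> q \<in> topspace (rm_top M) \<and> p \<noteq> q"
  obtain a x y where a: "x \<in> strip a" "y \<in> strip a" "proj x = p" "proj y = q"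
    using common_strip by blast
  with * have "x \<noteq> y" by auto
  then obtain U V where UV: "open U" "open V" "x \<in> U" "y \<in> V" "U \<inter> V = {}"
    using hausdorff[OF \<open>x \<noteq> y\<close>] by blast
  let ?U = "proj ` (U \<inter> strip a)" and ?V = "proj ` (V \<inter> strip a)"
  have "disjnt ?U ?V"
    using UV(5) inj_on_strip[of a] unfolding disjnt_def inj_on_def by blast
  moreover have "openin (rm_top M) ?U" "openin (rm_top M) ?V"
    using UV open_strip by (auto simp: openin_M intro!: open_proj)
  ultimately show "\<exists>U V. openin (rm_top M) U \<and> openin (rm_top M) V \<and> p \<in> U \<and> q \<in> V \<and> disjnt U V"
    using a UV by blast
qed

lemma second_countable_M: "second_countable (rm_top M)"
proof -
  obtain B :: "(real^'n) set set" where B: "countable B" "topological_basis B"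
    using ex_countable_basis by blast
  show ?thesis
    unfolding second_countable_def
  proof (intro exI conjI allI impI ballI)
    show "countable ((`) proj ` B)" using B by simp
    show "openin (rm_top M) V" if "V \<in> (`) proj ` B" for V
      using that B topological_basis_open by (auto simp: openin_M intro!: open_proj)
    fix U p assume U: "openin (rm_top M) U \<and> p \<in> U"
    obtain x where x: "proj x = p" using surj_proj by (metis surjD)
    then obtain V where "V \<in> B" "x \<in> V" "V \<subseteq> proj -` U"
      using topological_basisE[OF B(2), of "proj -` U" x] U openin_M by auto
    then show "\<exists>V\<in>(`) proj ` B. p \<in> V \<and> V \<subseteq> U" using x by blast
  qed
qed

lemma overlap:
  "snd (chart a) ` (fst (chart a) \<inter> fst (chart b)) = {x \<in> strip a. \<exists>k. x + sh k \<in> strip b}"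
proof -
  have "proj x \<in> proj ` strip b \<longleftrightarrow> (\<exists>k. x + sh k \<in> strip b)" for x
    unfolding image_iff proj_eq_iff[of x] by blast
  then have "fst (chart a) \<inter> fst (chart b) = proj ` {x \<in> strip a. \<exists>k. x + sh k \<in> strip b}"
    unfolding chart_simps(1) by blast
  then show ?thesis by (simp add: snd_chart_image)
qed

lemma transition_eq:
  assumes "x \<in> strip a" "x + sh k \<in> strip b"
  shows "transition (chart a) (chart b) x = x + sh k"
  using assms chart_simps(2)[OF assms(2)] by (simp add: transition_def)

text \<open>The overlap of two strips can have two components on which the transition map translates
  by different multiples of \<delta>, so a formula with one \<open>k\<close> is available only
  locally.\<close>

lemma transition_local:
  assumes "x \<in> strip a" "x + sh k \<in> strip b"
  obtains T where "open T" "x \<in> T" "\<And>y. y \<in> T \<Longrightarrow> transition (chart a) (chart b) y = y + sh k"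
proof
  let ?T = "strip a \<inter> (\<lambda>y. y + sh k) -` strip b"
  show "open ?T" by (intro open_Int open_vimage open_strip continuous_intros)
  show "x \<in> ?T" using assms by simp
  show "transition (chart a) (chart b) y = y + sh k" if "y \<in> ?T" for y
    using that transition_eq by auto
qed

lemma open_overlap: "open {x \<in> strip a. \<exists>k. x + sh k \<in> strip b}"
proof -
  have "{x \<in> strip a. \<exists>k. x + sh k \<in> strip b} = (\<Union>k. strip a \<inter> (\<lambda>y. y + sh k) -` strip b)"
    by auto
  then show ?thesis by (auto intro!: open_Int open_vimage open_strip continuous_intros)
qed

lemma smooth_transition:
  "smooth_on_open (snd (chart a) ` (fst (chart a) \<inter> fst (chart b))) (transition (chart a) (chart b))"
  unfolding overlap
proof (rule smooth_on_open_local[OF open_overlap])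
  fix x assume "x \<in> {x \<in> strip a. \<exists>k. x + sh k \<in> strip b}"
  then obtain k where k: "x \<in> strip a" "x + sh k \<in> strip b" by blast
  from transition_local[OF this] obtain T where
    "open T" "x \<in> T" "\<And>y. y \<in> T \<Longrightarrow> transition (chart a) (chart b) y = y + sh k" by blast
  then show "\<exists>T g. open T \<and> x \<in> T \<and> smooth g \<and> (\<forall>y\<in>T. transition (chart a) (chart b) y = g y)"
    by (intro exI[of _ T] exI[of _ "\<lambda>y. y + sh k"]) (auto simp: smooth_add_vec)
qed

lemma partial_deriv_transition:
  assumes "x \<in> strip a" "x + sh k \<in> strip b"
  shows "partial_deriv i (transition (chart a) (chart b)) x = axis i 1"
proof -
  obtain T where T: "open T" "x \<in> T" "\<And>y. y \<in> T \<Longrightarrow> transition (chart a) (chart b) y = y + sh k"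
    using transition_local[OF assms] by blast
  have "((\<lambda>y. y + sh k) has_derivative (\<lambda>v. v)) (at x)"
    by (auto intro!: derivative_eq_intros)
  then have "(transition (chart a) (chart b) has_derivative (\<lambda>v. v)) (at x)"
    by (rule has_derivative_transform_within_open[OF _ T(1,2)]) (simp add: T(3))
  from partial_deriv_eqI[OF this] show ?thesis .
qed

lemma G_pos:
  assumes "v \<noteq> 0"
  shows "0 < v \<bullet> (G x *v v)"
proof -
  have "0 < (norm v)\<^sup>2" using assms by simp
  then have "0 < (1 + \<kappa>\<^sup>2 * (norm (x - (x $ e) *\<^sub>R axis e 1))\<^sup>2) * (v \<bullet> (G x *v v))"
    using G_bound[of v x] by linarith
  moreover have "0 < 1 + \<kappa>\<^sup>2 * (norm (x - (x $ e) *\<^sub>R axis e 1))\<^sup>2"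
    by (intro add_pos_nonneg) auto
  ultimately show ?thesis by (simp add: zero_less_mult_iff)
qed

lemma riemannian_M: "riemannian_manifold M"
proof -
  have "proj ` strip a \<subseteq> points M" for a by simp
  moreover have "p \<in> (\<Union>c\<in>rm_atlas M. fst c)" for p
    using common_strip[of p p] by (auto simp: atlas_M)
  ultimately have cover: "(\<Union>c\<in>rm_atlas M. fst c) = points M" by auto
  have conn: "connected_space (rm_top M)"
    using connectedin_continuous_map_image[OF continuous_map_proj, of UNIV] surj_proj
    by (simp add: connectedin_def[of "rm_top M" UNIV] connected_UNIV)
  have smG: "smooth_on_open (strip a) G" for a
    using smooth_G open_strip by (simp add: smooth_on_open_def)
  have trans: "G x $ i $ j = (\<Sum>k\<in>UNIV. \<Sum>l\<in>UNIV.
      partial_deriv i (transition (chart a) (chart b)) x $ k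
        * partial_deriv j (transition (chart a) (chart b)) x $ l
        * G (transition (chart a) (chart b) x) $ k $ l)"
    if "x \<in> snd (chart a) ` (fst (chart a) \<inter> fst (chart b))" for a b x i j
  proof -
    from that obtain k where k: "x \<in> strip a" "x + sh k \<in> strip b"
      unfolding overlap by blast
    have "(\<Sum>k\<in>UNIV. \<Sum>l\<in>UNIV. axis i (1::real) $ k * axis j (1::real) $ l * G x $ k $ l) = G x $ i $ j"
      by (simp add: axis_def mult_delta_left mult_delta_right)
    then show ?thesis
      by (simp only: partial_deriv_transition[OF k] transition_eq[OF k] G_sh)
  qed
  show ?thesis
    unfolding riemannian_manifold_def smooth_manifold_def
    unfolding cover metric_M
    using Hausdorff_M second_countable_M conn sym_G G_pos
    by (intro conjI) (auto simp only: atlas_M ball_simps coord_image_chart is_chart_chart smooth_transition smG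
        intro!: trans imageI IntI)
qed


subsection \<open>Lengths of curves\<close>

definition speed :: "real^'n \<Rightarrow> real^'n \<Rightarrow> real" where
  "speed x v = sqrt (v \<bullet> (G x *v v))"

lemma G_nonneg: "0 \<le> v \<bullet> (G x *v v)"
  using G_pos[of v x] by (cases "v = 0") auto

lemma speed_nonneg: "0 \<le> speed x v"
  by (simp add: speed_def G_nonneg)

lemma speed_sq: "(speed x v)\<^sup>2 = v \<bullet> (G x *v v)"
  by (simp add: speed_def G_nonneg)

lemma continuous_on_speed:
  assumes "continuous_on S \<gamma>" "continuous_on S D"
  shows "continuous_on S (\<lambda>t. speed (\<gamma> t) (D t))"
proof -
  have "continuous_on S (\<lambda>t. G (\<gamma> t))"
    using continuous_on_compose2[OF smooth_continuous[OF smooth_G] assms(1)] by blast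
  then show ?thesis
    unfolding speed_def matrix_quadratic_form
    by (intro continuous_intros assms)
qed

text \<open>Replaces \<open>vector_derivative\<close> by a continuous derivative, so that the
  integrand in \<open>arc_length\<close> is known to be integrable.\<close>

lemma C1_arc:
  assumes "\<gamma> C1_differentiable_on {0..1}"
  obtains D where "\<And>t. t \<in> {0..1} \<Longrightarrow> (\<gamma> has_vector_derivative D t) (at t)"
    and "((\<lambda>t. speed (\<gamma> t) (D t)) has_integral arc_length G \<gamma>) {0..1}"
proof -
  from assms obtain D where D: "\<And>t. t \<in> {0..1} \<Longrightarrow> (\<gamma> has_vector_derivative D t) (at t)"
    and "continuous_on {0..1} D"
    unfolding C1_differentiable_on_def by blast
  then have "continuous_on {0..1} (\<lambda>t. speed (\<gamma> t) (D t))"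
    by (intro continuous_on_speed continuous_at_imp_continuous_on[of _ \<gamma>] ballI)
       (auto intro: has_vector_derivative_continuous)
  then have "((\<lambda>t. speed (\<gamma> t) (D t)) has_integral integral {0..1} (\<lambda>t. speed (\<gamma> t) (D t))) {0..1}"
    by (intro integrable_integral integrable_continuous_interval)
  moreover have "integral {0..1} (\<lambda>t. speed (\<gamma> t) (D t)) = arc_length G \<gamma>"
    unfolding arc_length_def speed_def
    by (intro integral_cong) (simp add: vector_derivative_at[OF D])
  ultimately have "((\<lambda>t. speed (\<gamma> t) (D t)) has_integral arc_length G \<gamma>) {0..1}"
    by simp
  from that[OF D this] show ?thesis .
qed

lemma arc_length_nonneg:
  assumes "\<gamma> C1_differentiable_on {0..1}"
  shows "0 \<le> arc_length G \<gamma>"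
  by (rule C1_arc[OF assms], erule has_integral_nonneg) (simp add: speed_nonneg)

lemma curve_length_nonneg: "curve_of_length M p q L \<Longrightarrow> 0 \<le> L"
  by (induction rule: curve_of_length.induct) (auto simp: arc_length_nonneg)

text \<open>Arcs are appended at the end, hence the induction is on the second curve and its premise
  comes first.\<close>

lemma curve_trans:
  "curve_of_length M q r L' \<Longrightarrow> curve_of_length M p q L \<Longrightarrow> curve_of_length M p r (L + L')"
proof (induction rule: curve_of_length.induct)
  case (append q c \<gamma> L')
  then have "curve_of_length M p (chart_inv c (\<gamma> 1)) ((L + L') + arc_length (rm_metric M c) \<gamma>)"
    by (intro curve_of_length.append) auto
  then show ?case by (simp add: add.assoc)
qed simp

lemma curve_single:
  assumes "a \<in> {0..\<delta>}" "\<gamma> C1_differentiable_on {0..1}" "\<gamma> ` {0..1} \<subseteq> strip a"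
  shows "curve_of_length M (proj (\<gamma> 0)) (proj (\<gamma> 1)) (arc_length G \<gamma>)"
proof -
  have "\<gamma> 0 \<in> strip a" "\<gamma> 1 \<in> strip a" using assms(3) by auto
  moreover have "curve_of_length M (proj (\<gamma> 0)) (chart_inv (chart a) (\<gamma> 1)) (0 + arc_length (rm_metric M (chart a)) \<gamma>)"
    using assms calculation curve_of_length.trivial[of "proj (\<gamma> 0)" M]
    by (intro curve_of_length.append) (auto simp: atlas_M)
  ultimately show ?thesis by simp
qed

lemma arc_reverse:
  assumes "\<gamma> C1_differentiable_on {0..1}"
  shows "(\<lambda>t. \<gamma> (1 - t)) C1_differentiable_on {0..1}"
    and "arc_length G (\<lambda>t. \<gamma> (1 - t)) = arc_length G \<gamma>"
proof -
  from assms obtain D where D: "\<And>t. t \<in> {0..1} \<Longrightarrow> (\<gamma> has_vector_derivative D t) (at t)"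
    and cD: "continuous_on {0..1} D"
    unfolding C1_differentiable_on_def by blast
  have rev: "((\<lambda>t. \<gamma> (1 - t)) has_vector_derivative - D (1 - t)) (at t)" if "t \<in> {0..1}" for t
  proof -
    have "((\<lambda>t. 1 - t) has_real_derivative -1) (at t)"
      by (auto intro!: derivative_eq_intros)
    then have "(\<gamma> \<circ> (\<lambda>t. 1 - t) has_vector_derivative -1 *\<^sub>R D (1 - t)) (at t)"
      by (intro vector_diff_chain_at D) (use that in \<open>auto simp: has_real_derivative_iff_has_vector_derivative\<close>)
    then show ?thesis by (simp add: o_def)
  qed
  have "continuous_on {0..1} (\<lambda>t. - D (1 - t))"
    by (intro continuous_intros continuous_on_compose2[OF cD]) auto
  with rev show "(\<lambda>t. \<gamma> (1 - t)) C1_differentiable_on {0..1}"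
    unfolding C1_differentiable_on_def by (intro exI[of _ "\<lambda>t. - D (1 - t)"]) simp
  have neg: "A *v (- v) = - (A *v v)" for v :: "real^'n" and A :: "real^'n^'n"
    by (simp add: matrix_vector_mult_def vec_eq_iff sum_negf)
  let ?s = "\<lambda>t. sqrt (D t \<bullet> (G (\<gamma> t) *v D t))"
  have "arc_length G (\<lambda>t. \<gamma> (1 - t)) = integral {0..1} (\<lambda>t. ?s (1 - t))"
    unfolding arc_length_def
    by (intro integral_cong) (simp add: vector_derivative_at[OF rev] neg)
  also have "\<dots> = integral {0..1} ?s"
  proof -
    obtain D' where D': "\<And>t. t \<in> {0..1} \<Longrightarrow> (\<gamma> has_vector_derivative D' t) (at t)"
      and "((\<lambda>t. speed (\<gamma> t) (D' t)) has_integral arc_length G \<gamma>) {0..1}"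
      using C1_arc[OF assms] by blast
    moreover have "D' t = D t" if "t \<in> {0..1}" for t
      using vector_derivative_unique_at[OF D[OF that] D'[OF that]] by simp
    ultimately have "(?s has_integral arc_length G \<gamma>) {0..1}"
      by (elim has_integral_eq[rotated]) (simp add: speed_def)
    moreover from has_integral_affinity[of ?s "arc_length G \<gamma>" 0 1 "-1" 1] this
    have "((\<lambda>t. ?s (1 - t)) has_integral arc_length G \<gamma>) ((\<lambda>t. 1 - t) ` {0..1})"
      by simp
    moreover have "(\<lambda>t. 1 - t) ` {0..1} = {0..1::real}"
      by (auto intro!: image_eqI[of _ _ "1 - _"])
    ultimately show ?thesis by (simp add: integral_unique)
  qed
  also have "\<dots> = arc_length G \<gamma>"
    unfolding arc_length_def
    by (intro integral_cong) (simp add: vector_derivative_at[OF D])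
  finally show "arc_length G (\<lambda>t. \<gamma> (1 - t)) = arc_length G \<gamma>" .
qed

lemma curve_sym: "curve_of_length M p q L \<Longrightarrow> curve_of_length M q p L"
proof (induction rule: curve_of_length.induct)
  case (trivial p)
  then show ?case by (rule curve_of_length.trivial)
next
  case (append p c \<gamma> L)
  then obtain a where a: "c = chart a" "a \<in> {0..\<delta>}" by (auto simp: atlas_M)
  have s: "\<gamma> ` {0..1} \<subseteq> strip a" using append a by simp
  then have *: "\<gamma> 0 \<in> strip a" "\<gamma> 1 \<in> strip a" by auto
  have "curve_of_length M (proj (\<gamma> (1 - 0))) (proj (\<gamma> (1 - 1))) (arc_length G (\<lambda>t. \<gamma> (1 - t)))"
    by (rule curve_single[OF a(2) arc_reverse(1)]) (use append.hyps(3) s in auto)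
  then have "curve_of_length M (proj (\<gamma> 1)) (proj (\<gamma> 0)) (arc_length G \<gamma>)"
    using arc_reverse(2)[OF append.hyps(3)] by simp
  moreover have "curve_of_length M (proj (\<gamma> 0)) p L"
    using append.IH a * by simp
  ultimately have "curve_of_length M (proj (\<gamma> 1)) p (arc_length G \<gamma> + L)"
    by (rule curve_trans[rotated])
  then show ?case using a * by (simp add: add.commute)
qed

text \<open>Bounds lengths from below without lifting whole curves to Euclidean space: a periodic
  \<open>F\<close> is a function on the quotient, and along each arc in a chart its change is the
  integral of its differential. Periodicity absorbs the jumps between lifts in successive
  charts.\<close>

lemma curve_variation:
  fixes F :: "real^'n \<Rightarrow> real"
  assumes F: "\<And>x. (F has_derivative F' x) (at x)"
    and le: "\<And>x v. \<bar>F' x v\<bar> \<le> K * speed x v"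
    and per: "\<And>x k. F (x + sh k) = F x"
  shows "curve_of_length M p q L \<Longrightarrow> proj x = p \<Longrightarrow> proj y = q \<Longrightarrow> \<bar>F y - F x\<bar> \<le> K * L"
proof (induction arbitrary: y rule: curve_of_length.induct)
  case (trivial p)
  then obtain k where "y = x + sh k" using proj_eq_iff by metis
  then show ?case by (simp add: per)
next
  case (append p c \<gamma> L)
  then obtain a where a: "c = chart a" "a \<in> {0..\<delta>}" by (auto simp: atlas_M)
  have *: "\<gamma> 0 \<in> strip a" "\<gamma> 1 \<in> strip a" using append a by auto
  then have 0: "\<bar>F (\<gamma> 0) - F x\<bar> \<le> K * L" using append a by auto
  from C1_arc[OF append.hyps(3)] obtain D
    where D: "\<And>t. t \<in> {0..1} \<Longrightarrow> (\<gamma> has_vector_derivative D t) (at t)"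
      and int: "((\<lambda>t. speed (\<gamma> t) (D t)) has_integral arc_length G \<gamma>) {0..1}" by blast
  have "((\<lambda>t. F' (\<gamma> t) (D t)) has_integral F (\<gamma> 1) - F (\<gamma> 0)) {0..1}"
  proof (rule fundamental_theorem_of_calculus)
    fix t :: real assume t: "t \<in> {0..1}"
    have "(F \<circ> \<gamma> has_derivative F' (\<gamma> t) \<circ> (\<lambda>h. h *\<^sub>R D t)) (at t)"
      by (rule diff_chain_at[OF D[OF t, unfolded has_vector_derivative_def] F])
    moreover have "F' (\<gamma> t) \<circ> (\<lambda>h. h *\<^sub>R D t) = (\<lambda>h. h *\<^sub>R F' (\<gamma> t) (D t))"
      using has_derivative_linear[OF F] by (auto simp: linear_scale)
    ultimately show "((\<lambda>t. F (\<gamma> t)) has_vector_derivative F' (\<gamma> t) (D t)) (at t within {0..1})"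
      by (simp add: has_vector_derivative_def o_def has_derivative_at_withinI)
  qed simp
  moreover have "((\<lambda>t. K * speed (\<gamma> t) (D t)) has_integral K * arc_length G \<gamma>) {0..1}"
    by (rule has_integral_mult_right[OF int])
  ultimately have "\<bar>F (\<gamma> 1) - F (\<gamma> 0)\<bar> \<le> K * arc_length G \<gamma>"
    using integral_norm_bound_integral[of "\<lambda>t. F' (\<gamma> t) (D t)" "{0..1}" "\<lambda>t. K * speed (\<gamma> t) (D t)"] le
    by (simp only: has_integral_integrable_integral real_norm_def)
  moreover obtain k where "y = \<gamma> 1 + sh k"
    using append.prems a * proj_eq_iff by (metis chart_inv_chart)
  ultimately have "\<bar>F y - F (\<gamma> 0)\<bar> \<le> K * arc_length G \<gamma>" by (simp add: per)
  with 0 have "\<bar>F y - F x\<bar> \<le> K * L + K * arc_length G \<gamma>" by linarith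
  then show ?case by (simp add: distrib_left)
qed

text \<open>Strips are convex, so the straight segment stays in the chart. The second conclusion
  bounds its length by any bound for its speed, which is how distances are estimated from
  above.\<close>

lemma segment_curve:
  assumes "a \<in> {0..\<delta>}" "x \<in> strip a" "y \<in> strip a"
  obtains L where "curve_of_length M (proj x) (proj y) L"
    and "\<And>K. (\<And>z. z \<in> closed_segment x y \<Longrightarrow> speed z (y - x) \<le> K) \<Longrightarrow> L \<le> K"
proof -
  let ?\<gamma> = "\<lambda>t::real. x + t *\<^sub>R (y - x)"
  have D: "(?\<gamma> has_vector_derivative (y - x)) (at t)" for t
    by (auto intro!: derivative_eq_intros)
  then have C1: "?\<gamma> C1_differentiable_on {0..1}"
    unfolding C1_differentiable_on_def by (intro exI[of _ "\<lambda>_. y - x"]) auto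
  have seg: "?\<gamma> t \<in> closed_segment x y" if "t \<in> {0..1}" for t
    using that by (auto simp: closed_segment_def algebra_simps intro!: exI[of _ t])
  then have "?\<gamma> ` {0..1} \<subseteq> strip a"
    using convex_contains_segment[THEN iffD1, OF convex_strip, rule_format, OF assms(2,3)] by blast
  from curve_single[OF assms(1) C1 this]
  have "curve_of_length M (proj x) (proj y) (arc_length G ?\<gamma>)" by simp
  moreover have "arc_length G ?\<gamma> \<le> K" if K: "\<And>z. z \<in> closed_segment x y \<Longrightarrow> speed z (y - x) \<le> K" for K
  proof -
    obtain D' where D': "\<And>t. t \<in> {0..1} \<Longrightarrow> (?\<gamma> has_vector_derivative D' t) (at t)"
      and int: "((\<lambda>t. speed (?\<gamma> t) (D' t)) has_integral arc_length G ?\<gamma>) {0..1}"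
      using C1_arc[OF C1] by blast
    have "D' t = y - x" if "t \<in> {0..1}" for t
      using vector_derivative_unique_at[OF D D'[OF that]] by simp
    then have "speed (?\<gamma> t) (D' t) \<le> K" if "t \<in> {0..1}" for t
      using that K seg by simp
    moreover have "((\<lambda>t. K) has_integral K) {0..1::real}"
      using has_integral_const_real[of K 0 1] by simp
    ultimately show ?thesis using has_integral_le[OF int] by blast
  qed
  ultimately show ?thesis using that by blast
qed

subsection \<open>Geodesic distance\<close>

lemma curve_exists: "\<exists>L. curve_of_length M p q L"
  using common_strip[of p q] segment_curve by metis

lemma geo_dist_le: "curve_of_length M p q L \<Longrightarrow> geo_dist M p q \<le> L"
  unfolding geo_dist_def
  by (rule cInf_lower) (auto intro!: bdd_belowI[of _ 0] curve_length_nonneg)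

lemma geo_dist_ge: "(\<And>L. curve_of_length M p q L \<Longrightarrow> b \<le> L) \<Longrightarrow> b \<le> geo_dist M p q"
  unfolding geo_dist_def using curve_exists by (intro cInf_greatest) auto

lemma geo_dist_approx: "0 < \<eta> \<Longrightarrow> \<exists>L. curve_of_length M p q L \<and> L < geo_dist M p q + \<eta>"
  using geo_dist_ge[of p q "geo_dist M p q + \<eta>"] by force

lemma geo_dist_Lipschitz:
  fixes F :: "real^'n \<Rightarrow> real"
  assumes "\<And>x. (F has_derivative F' x) (at x)"
    and "\<And>x v. \<bar>F' x v\<bar> \<le> K * speed x v"
    and "\<And>x k. F (x + sh k) = F x" and "0 < K"
  shows "\<bar>F y - F x\<bar> \<le> K * geo_dist M (proj x) (proj y)"
proof -
  have "\<bar>F y - F x\<bar> / K \<le> geo_dist M (proj x) (proj y)"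
  proof (rule geo_dist_ge)
    fix L assume "curve_of_length M (proj x) (proj y) L"
    from curve_variation[OF assms(1-3) this] show "\<bar>F y - F x\<bar> / K \<le> L"
      using assms(4) by (simp add: field_simps)
  qed
  then show ?thesis using assms(4) by (simp add: field_simps)
qed

section \<open>Lipschitz functions for the geodesic distance\<close>

definition drp :: "real^'n \<Rightarrow> real^'n" where
  "drp x = x - (x $ e) *\<^sub>R axis e 1"

lemma drp_nth: "drp x $ i = (if i = e then 0 else x $ i)"
  by (auto simp: drp_def axis_def)

lemma drp_sh [simp]: "drp (x + sh k) = drp x"
  by (auto simp: vec_eq_iff drp_nth sh_nth)

lemma bounded_linear_drp: "bounded_linear drp"
  unfolding drp_def
  by (intro bounded_linear_sub bounded_linear_ident bounded_linear_scaleR_const bounded_linear_vec_nth)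

lemma drp_has_derivative [derivative_intros]:
  "(f has_derivative f') F \<Longrightarrow> ((\<lambda>x. drp (f x)) has_derivative (\<lambda>v. drp (f' v))) F"
  by (rule bounded_linear.has_derivative[OF bounded_linear_drp])

lemma norm_drp_le: "norm (drp v) \<le> norm v"
  unfolding norm_vec_def by (intro L2_set_mono) (auto simp: drp_nth)

definition Q :: "real^'n \<Rightarrow> real" where
  "Q x = 1 + \<kappa>\<^sup>2 * (drp x \<bullet> drp x)"

lemma Q_ge_1: "1 \<le> Q x"
  by (simp add: Q_def)

lemma Q_pos [simp]: "0 < Q x"
  using Q_ge_1[of x] by linarith

lemma Q_neq_0 [simp]: "Q x \<noteq> 0"
  using Q_pos[of x] by linarith

lemma abs_Q [simp]: "\<bar>Q x\<bar> = Q x"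
  using Q_pos[of x] by linarith

lemma norm_le_speed: "norm v \<le> sqrt (Q x) * speed x v"
proof -
  have "(norm v)\<^sup>2 \<le> (sqrt (Q x) * speed x v)\<^sup>2"
    using G_bound[of v x] by (simp add: power_mult_distrib speed_sq less_imp_le Q_def drp_def dot_square_norm)
  then show ?thesis
    by (rule power2_le_imp_le) (simp add: speed_nonneg less_imp_le)
qed

lemma norm_drp_le_Q: "\<kappa> * norm (drp x) \<le> sqrt (Q x)"
proof -
  have "(\<kappa> * norm (drp x))\<^sup>2 \<le> Q x"
    by (simp add: Q_def power_mult_distrib dot_square_norm)
  then show ?thesis using real_le_rsqrt by blast
qed

text \<open>Cauchy-Schwarz splits the differential of \<open>Q\<close> into \<kappa> |x'| and the
  Euclidean norm of \<open>v\<close>. Each costs one factor \<open>sqrt (Q x)\<close>, the second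
  through the lower bound on the metric, and together they give \<open>Q x\<close>.\<close>

lemma Q_deriv_bound: "\<bar>2 * \<kappa>\<^sup>2 * (drp x \<bullet> drp v)\<bar> \<le> 2 * \<kappa> * Q x * speed x v"
proof -
  have "\<bar>drp x \<bullet> drp v\<bar> \<le> norm (drp x) * norm v"
    using Cauchy_Schwarz_ineq2[of "drp x" "drp v"] norm_drp_le[of v]
    by (meson mult_left_mono norm_ge_zero order_trans)
  then have "\<kappa> * \<bar>drp x \<bullet> drp v\<bar> \<le> \<kappa> * (norm (drp x) * norm v)"
    using \<kappa> by (intro mult_left_mono) auto
  also have "\<dots> = (\<kappa> * norm (drp x)) * norm v" by simp
  also have "\<dots> \<le> sqrt (Q x) * (sqrt (Q x) * speed x v)"
    using norm_drp_le_Q norm_le_speed by (intro mult_mono) (auto simp: less_imp_le)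
  also have "\<dots> = Q x * speed x v"
    by (simp add: less_imp_le flip: mult.assoc)
  finally have "2 * \<kappa> * (\<kappa> * \<bar>drp x \<bullet> drp v\<bar>) \<le> 2 * \<kappa> * (Q x * speed x v)"
    using \<kappa> by (intro mult_left_mono) auto
  then show ?thesis using \<kappa> by (simp add: abs_mult power2_eq_square mult_ac)
qed

lemma Q_has_derivative: "(Q has_derivative (\<lambda>v. 2 * \<kappa>\<^sup>2 * (drp x \<bullet> drp v))) (at x)"
  unfolding Q_def[abs_def]
  by (auto intro!: derivative_eq_intros simp: inner_commute algebra_simps)

text \<open>Dividing the previous bound by \<open>Q\<close> removes the growth. This confines
  bounded sets of the quotient to bounded transverse coordinates, uniformly in \<delta>.\<close>

lemma ln_Q_Lipschitz: "\<bar>ln (Q y) - ln (Q x)\<bar> \<le> 2 * \<kappa> * geo_dist M (proj x) (proj y)"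
proof (rule geo_dist_Lipschitz)
  show "((\<lambda>x. ln (Q x)) has_derivative (\<lambda>v. 2 * \<kappa>\<^sup>2 * (drp x \<bullet> drp v) / Q x)) (at x)" for x
    using Q_has_derivative[of x] by (auto intro!: derivative_eq_intros simp: divide_inverse mult_ac)
  show "\<bar>2 * \<kappa>\<^sup>2 * (drp x \<bullet> drp v) / Q x\<bar> \<le> 2 * \<kappa> * speed x v" for x v
    using Q_deriv_bound[of x v] by (simp add: abs_mult pos_divide_le_eq mult_ac)
qed (use \<kappa> in \<open>auto simp: Q_def\<close>)

text \<open>Division by \<open>sqrt (Q x)\<close> turns functions of linear growth into Lipschitz functions for the geodesic
  distance. Applied to the coordinates and to the trigonometric functions of the circle coordinate it gives
  enough functions to separate points.\<close>

lemma weighted_Lipschitz: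
  fixes H :: "real^'n \<Rightarrow> real"
  assumes H: "\<And>x. (H has_derivative H' x) (at x)"
    and H': "\<And>x v. \<bar>H' x v\<bar> \<le> k * norm v"
    and B: "\<And>x. \<bar>H x\<bar> \<le> B * sqrt (Q x)"
    and per: "\<And>x k. H (x + sh k) = H x" and "0 < B" "0 \<le> k"
  shows "\<bar>H y / sqrt (Q y) - H x / sqrt (Q x)\<bar> \<le> (k + \<kappa> * B) * geo_dist M (proj x) (proj y)"
proof (rule geo_dist_Lipschitz)
  define W where "W x = 1 / sqrt (Q x)" for x
  define D where "D x v = H' x v * W x - H x * W x * (\<kappa>\<^sup>2 * (drp x \<bullet> drp v) / Q x)" for x v
  show "((\<lambda>x. H x / sqrt (Q x)) has_derivative D x) (at x)" for x
  proof -
    have "((\<lambda>x. sqrt (Q x)) has_derivative (\<lambda>v. \<kappa>\<^sup>2 * (drp x \<bullet> drp v) / sqrt (Q x))) (at x)"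
      by (rule has_derivative_eq_rhs, rule has_derivative_real_sqrt[OF Q_pos[of x] Q_has_derivative])
         (simp add: fun_eq_iff field_simps)
    note has_derivative_divide'[OF H this]
    moreover have "sqrt (Q x) \<noteq> 0" by simp
    ultimately have "((\<lambda>x. H x / sqrt (Q x)) has_derivative (\<lambda>v. (H' x v * sqrt (Q x)
        - H x * (\<kappa>\<^sup>2 * (drp x \<bullet> drp v) / sqrt (Q x))) / (sqrt (Q x) * sqrt (Q x)))) (at x)"
      by blast
    then show ?thesis
    proof (rule has_derivative_eq_rhs, intro ext)
      fix v
      show "(H' x v * sqrt (Q x) - H x * (\<kappa>\<^sup>2 * (drp x \<bullet> drp v) / sqrt (Q x))) / (sqrt (Q x) * sqrt (Q x)) = D x v"
        by (simp add: D_def W_def field_simps)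
    qed
  qed
  show "\<bar>D x v\<bar> \<le> (k + \<kappa> * B) * speed x v" for x v
  proof -
    have W: "0 < W x" "sqrt (Q x) * W x = 1" by (simp_all add: W_def)
    have "\<bar>H' x v * W x\<bar> \<le> k * norm v * W x"
      using H' W by (simp add: abs_mult mult_right_mono)
    also have "\<dots> \<le> k * (sqrt (Q x) * speed x v) * W x"
      using norm_le_speed[of v x] W assms by (intro mult_left_mono mult_right_mono) auto
    also have "\<dots> = k * speed x v * (sqrt (Q x) * W x)" by simp
    also have "\<dots> = k * speed x v" unfolding W(2) by simp
    finally have 1: "\<bar>H' x v * W x\<bar> \<le> k * speed x v" .
    have "\<bar>H x * W x\<bar> \<le> B * sqrt (Q x) * W x"
      using B W by (simp add: abs_mult mult_right_mono)
    then have 2: "\<bar>H x * W x\<bar> \<le> B" using W(2) by (simp only: mult.assoc mult_1_right)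
    have "\<bar>\<kappa>\<^sup>2 * (drp x \<bullet> drp v) / Q x\<bar> \<le> \<kappa> * speed x v"
      using Q_deriv_bound[of x v] by (simp add: abs_mult pos_divide_le_eq mult_ac)
    with 2 have "\<bar>H x * W x * (\<kappa>\<^sup>2 * (drp x \<bullet> drp v) / Q x)\<bar> \<le> B * (\<kappa> * speed x v)"
      unfolding abs_mult[of "H x * W x"] using \<open>0 < B\<close> by (intro mult_mono abs_ge_zero) auto
    with 1 show ?thesis unfolding D_def distrib_right
      by (intro order.trans[OF abs_triangle_ineq4]) (simp add: mult_ac)
  qed
  show "H (x + sh k) / sqrt (Q (x + sh k)) = H x / sqrt (Q x)" for x k
    by (simp add: per Q_def)
qed (use assms \<kappa> in \<open>auto intro: add_nonneg_pos\<close>)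

lemma geo_dist_eq_0_imp:
  assumes "geo_dist M (proj x) (proj y) = 0"
  shows "proj x = proj y"
proof -
  have sep: "H x = H y"
    if "\<And>x. (H has_derivative H' x) (at x)" "\<And>x v. \<bar>H' x v\<bar> \<le> k * norm v"
      "\<And>x. \<bar>H x\<bar> \<le> B * sqrt (Q x)" "\<And>x k. H (x + sh k) = H x" "0 < B" "0 \<le> k"
    and "Q x = Q y" for H H' k B
    using weighted_Lipschitz[where H = H and H' = H' and k = k and B = B and y = y and x = x, OF that(1-6)]
      assms that(7) by simp
  \<comment> \<open>Equality of \<open>Q\<close> comes first: the weights then cancel, and equality
    of the weighted functions gives equality of \<open>H\<close> itself.\<close>
  have Q: "Q x = Q y"
    using ln_Q_Lipschitz[of y x] assms by simp
  have Q1: "1 \<le> sqrt (Q z)" for z using Q_ge_1[of z] by simp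
  have nth: "x $ i = y $ i" if "i \<noteq> e" for i
  proof -
    have "drp x $ i = drp y $ i"
    proof (rule sep[OF _ _ _ _ _ _ Q])
      show "((\<lambda>x. drp x $ i) has_derivative (\<lambda>v. drp v $ i)) (at z)" for z
        by (auto intro!: derivative_eq_intros)
      show "\<bar>drp v $ i\<bar> \<le> 1 * norm v" for v
        using component_le_norm_cart[of "drp v" i] norm_drp_le[of v] by simp
      show "\<bar>drp z $ i\<bar> \<le> (1 / \<kappa>) * sqrt (Q z)" for z
        using component_le_norm_cart[of "drp z" i] norm_drp_le_Q[of z] \<kappa>
        by (simp add: field_simps) (smt (verit) mult_left_mono)
    qed (use \<kappa> in auto)
    then show ?thesis using that by (simp add: drp_nth)
  qed
  \<comment> \<open>This frequency makes sine and cosine periodic under the translations; their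
    joint values determine the circle coordinate modulo \<delta>.\<close>
  let ?\<omega> = "2 * pi / \<delta>"
  have \<omega>: "0 < ?\<omega>" using \<delta> by simp
  have per: "?\<omega> * (z + sh k) $ e = ?\<omega> * z $ e + 2 * pi * of_int k" for z k
    using \<delta> by (simp add: sh_nth field_simps)
  have bd: "\<bar>?\<omega> * v $ e * s\<bar> \<le> ?\<omega> * norm v" if "\<bar>s\<bar> \<le> 1" for v :: "real^'n" and s
  proof -
    have "\<bar>v $ e\<bar> * \<bar>s\<bar> \<le> norm v * 1"
      using that component_le_norm_cart[of v e] by (intro mult_mono) auto
    then have "?\<omega> * (\<bar>v $ e\<bar> * \<bar>s\<bar>) \<le> ?\<omega> * norm v"
      using \<omega> by (intro mult_left_mono) auto
    then show ?thesis using \<omega> \<delta> by (simp add: abs_mult mult_ac)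
  qed
  have "cos (?\<omega> * x $ e) = cos (?\<omega> * y $ e)"
  proof (rule sep[OF _ _ _ _ _ _ Q])
    show "((\<lambda>x. cos (?\<omega> * x $ e)) has_derivative (\<lambda>v. ?\<omega> * v $ e * (- sin (?\<omega> * z $ e)))) (at z)" for z
      using \<delta> by (auto intro!: derivative_eq_intros)
    show "\<bar>?\<omega> * v $ e * (- sin (?\<omega> * z $ e))\<bar> \<le> ?\<omega> * norm v" for v z
      by (rule bd) simp
    show "\<bar>cos (?\<omega> * z $ e)\<bar> \<le> 1 * sqrt (Q z)" for z
      using abs_cos_le_one[of "?\<omega> * z $ e"] Q1[of z] by linarith
    show "cos (?\<omega> * (z + sh k) $ e) = cos (?\<omega> * z $ e)" for z k
      unfolding per by (simp add: cos_add)
  qed (use \<delta> in simp_all)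
  moreover have "sin (?\<omega> * x $ e) = sin (?\<omega> * y $ e)"
  proof (rule sep[OF _ _ _ _ _ _ Q])
    show "((\<lambda>x. sin (?\<omega> * x $ e)) has_derivative (\<lambda>v. ?\<omega> * v $ e * cos (?\<omega> * z $ e))) (at z)" for z
      using \<delta> by (auto intro!: derivative_eq_intros)
    show "\<bar>?\<omega> * v $ e * cos (?\<omega> * z $ e)\<bar> \<le> ?\<omega> * norm v" for v z
      by (rule bd) simp
    show "\<bar>sin (?\<omega> * z $ e)\<bar> \<le> 1 * sqrt (Q z)" for z
      using abs_sin_le_one[of "?\<omega> * z $ e"] Q1[of z] by linarith
    show "sin (?\<omega> * (z + sh k) $ e) = sin (?\<omega> * z $ e)" for z k
      unfolding per by (simp add: sin_add)
  qed (use \<delta> in simp_all)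
  ultimately obtain k where "?\<omega> * y $ e = ?\<omega> * x $ e + 2 * pi * real_of_int k"
    using sin_cos_eq_iff by metis
  then have "pi * (y $ e - x $ e - of_int k * \<delta>) = 0"
    using \<delta> by (simp add: field_simps)
  then have "y $ e = x $ e + of_int k * \<delta>" by simp
  then have "y = x + sh k"
    using nth by (auto simp: vec_eq_iff sh_nth)
  then show ?thesis by simp
qed

lemma geo_dist_refl: "geo_dist M p p = 0"
proof (rule antisym)
  show "geo_dist M p p \<le> 0" by (intro geo_dist_le curve_of_length.trivial) simp
qed (auto intro: geo_dist_ge curve_length_nonneg)

lemma Metric_space_M: "Metric_space UNIV (geo_dist M)"
proof
  fix p q r
  show "0 \<le> geo_dist M p q" by (auto intro: geo_dist_ge curve_length_nonneg)
  show "geo_dist M p q = geo_dist M q p"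
  proof -
    have "curve_of_length M p q L \<longleftrightarrow> curve_of_length M q p L" for L
      using curve_sym by blast
    then show ?thesis by (simp add: geo_dist_def)
  qed
  show "geo_dist M p q = 0 \<longleftrightarrow> p = q"
    using geo_dist_eq_0_imp geo_dist_refl surj_proj by (metis surjD)
  show "geo_dist M p r \<le> geo_dist M p q + geo_dist M q r"
  proof (rule field_le_epsilon)
    fix \<eta> :: real assume "0 < \<eta>"
    then obtain L L' where L: "curve_of_length M p q L" "L < geo_dist M p q + \<eta> / 2"
      "curve_of_length M q r L'" "L' < geo_dist M q r + \<eta> / 2"
      using geo_dist_approx half_gt_zero by meson
    have "geo_dist M p r \<le> L + L'"
      by (rule geo_dist_le[OF curve_trans[OF L(3,1)]])
    then show "geo_dist M p r \<le> geo_dist M p q + geo_dist M q r + \<eta>" using L by linarith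
  qed
qed


subsection \<open>Completeness\<close>

text \<open>Near \<open>l\<close> the metric is bounded by a multiple of the Euclidean one, so
  straight segments shrinking in Euclidean length also shrink in length for \<open>G\<close>.
  \<open>N\<close> is a crude continuous bound for the operator norm.\<close>

lemma geo_dist_tendsto_0:
  assumes a: "a \<in> {0..\<delta>}" and l: "l \<in> strip a" and X: "X \<longlonglongrightarrow> l"
  shows "(\<lambda>n. geo_dist M (proj l) (proj (X n))) \<longlonglongrightarrow> 0"
proof -
  define N where "N z = (\<Sum>i\<in>UNIV. \<Sum>j\<in>UNIV. \<bar>G z $ i $ j\<bar>)" for z
  have "continuous_on (cball l 1) N"
    unfolding N_def by (intro continuous_intros smooth_continuous smooth_G)
  then have "bounded (N ` cball l 1)"
    by (intro compact_imp_bounded compact_continuous_image compact_cball)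
  then obtain C where C: "\<And>z. z \<in> cball l 1 \<Longrightarrow> \<bar>N z\<bar> \<le> C"
    unfolding bounded_iff ball_simps real_norm_def by blast
  have N: "v \<bullet> (G z *v v) \<le> N z * (norm v)\<^sup>2" for z v
  proof -
    have "v $ i * (G z $ i $ j * v $ j) \<le> \<bar>G z $ i $ j\<bar> * (norm v)\<^sup>2" for i j
    proof -
      have "\<bar>v $ i\<bar> * \<bar>v $ j\<bar> \<le> norm v * norm v"
        by (intro mult_mono component_le_norm_cart) auto
      then have "\<bar>G z $ i $ j\<bar> * (\<bar>v $ i\<bar> * \<bar>v $ j\<bar>) \<le> \<bar>G z $ i $ j\<bar> * (norm v)\<^sup>2"
        by (intro mult_left_mono) (auto simp: power2_eq_square)
      moreover have "v $ i * (G z $ i $ j * v $ j) \<le> \<bar>G z $ i $ j\<bar> * (\<bar>v $ i\<bar> * \<bar>v $ j\<bar>)"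
        using abs_ge_self[of "v $ i * (G z $ i $ j * v $ j)"] by (simp add: abs_mult mult_ac)
      ultimately show ?thesis by linarith
    qed
    then show ?thesis
      unfolding matrix_quadratic_form N_def sum_distrib_right by (intro sum_mono)
  qed
  have sp: "speed z v \<le> sqrt C * norm v" if "z \<in> cball l 1" for z v
  proof -
    have "v \<bullet> (G z *v v) \<le> C * (norm v)\<^sup>2"
      using N[of v z] C[OF that] by (meson abs_le_D1 mult_right_mono order_trans zero_le_power2)
    from real_sqrt_le_mono[OF this] show ?thesis
      by (simp add: speed_def real_sqrt_mult)
  qed
  have "\<forall>\<^sub>F n in sequentially. X n \<in> strip a \<inter> ball l 1"
    using X by (rule topological_tendstoD) (use l open_strip in auto)
  then have ev: "\<forall>\<^sub>F n in sequentially. geo_dist M (proj l) (proj (X n)) \<le> sqrt C * norm (X n - l)"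
  proof eventually_elim
    case (elim n)
    then have "closed_segment l (X n) \<subseteq> cball l 1"
      by (intro closed_segment_subset) auto
    then have "speed z (X n - l) \<le> sqrt C * norm (X n - l)" if "z \<in> closed_segment l (X n)" for z
      using that sp by blast
    moreover obtain L where "curve_of_length M (proj l) (proj (X n)) L"
      "\<And>K. (\<And>z. z \<in> closed_segment l (X n) \<Longrightarrow> speed z (X n - l) \<le> K) \<Longrightarrow> L \<le> K"
      using segment_curve[OF a l, of "X n"] elim by blast
    ultimately show ?case using geo_dist_le order_trans by blast
  qed
  have "(\<lambda>n. norm (X n - l)) \<longlonglongrightarrow> 0"
    using X by (simp add: LIM_zero_iff tendsto_norm_zero)
  then have "(\<lambda>n. sqrt C * norm (X n - l)) \<longlonglongrightarrow> 0"
    by (rule tendsto_mult_right_zero)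
  moreover have "\<forall>\<^sub>F n in sequentially. 0 \<le> geo_dist M (proj l) (proj (X n))"
    using Metric_space.nonneg[OF Metric_space_M] by simp
  ultimately show ?thesis using tendsto_sandwich[OF _ ev tendsto_const] by blast
qed

lemma Q_growth: "Q y \<le> Q x * exp (2 * \<kappa> * geo_dist M (proj x) (proj y))"
proof -
  have "ln (Q y) \<le> ln (Q x) + 2 * \<kappa> * geo_dist M (proj x) (proj y)"
    using ln_Q_Lipschitz[of y x] by linarith
  then have "exp (ln (Q y)) \<le> exp (ln (Q x) + 2 * \<kappa> * geo_dist M (proj x) (proj y))"
    by (simp only: exp_le_cancel_iff)
  then show ?thesis by (simp add: exp_add)
qed

lemma norm_drp_le_of_Q: "Q x \<le> B \<Longrightarrow> norm (drp x) \<le> sqrt B / \<kappa>"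
  using order_trans[OF norm_drp_le_Q[of x] real_sqrt_le_mono[of "Q x" B]] \<kappa>
  by (simp add: pos_le_divide_eq mult.commute)

text \<open>Lifts of a Cauchy sequence into a slab are bounded: \<open>Q_growth\<close> controls the
  transverse part, the slab the circle coordinate. A Euclidean limit point of the lifts then
  projects to the limit.\<close>

lemma complete_M: "complete_riemannian M"
proof -
  interpret ms: Metric_space UNIV "geo_dist M" by (rule Metric_space_M)
  have "\<exists>p. limitin ms.mtopology \<sigma> p sequentially" if \<sigma>: "ms.MCauchy \<sigma>" for \<sigma>
  proof -
    \<comment> \<open>The slab starts at \<delta>/2 so that a limit \<open>l\<close> has circle
      coordinate between \<delta>/2 and 3\<delta>/2. The strip centred at \<open>l\<close> then has
      offset \<open>l $ e - \<delta> / 2\<close> in the range of the atlas.\<close>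
    have "\<forall>n. \<exists>x. proj x = \<sigma> n \<and> \<delta> / 2 \<le> x $ e \<and> x $ e < \<delta> / 2 + \<delta>"
      using proj_lift by blast
    then obtain x where x: "\<And>n. proj (x n) = \<sigma> n" "\<And>n. \<delta> / 2 \<le> x n $ e"
      "\<And>n. x n $ e < \<delta> / 2 + \<delta>"
      by metis
    obtain N where N: "\<And>n m. N \<le> n \<Longrightarrow> N \<le> m \<Longrightarrow> geo_dist M (\<sigma> n) (\<sigma> m) < 1"
      using \<sigma> unfolding ms.MCauchy_def by (metis zero_less_one)
    define B where "B = Q (x N) * exp (2 * \<kappa>)"
    have "norm (x (N + n)) \<le> sqrt B / \<kappa> + 2 * \<delta>" for n
    proof -
      have "exp (2 * \<kappa> * geo_dist M (proj (x N)) (proj (x (N + n)))) \<le> exp (2 * \<kappa>)"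
        using N[of N "N + n"] \<kappa> by (simp add: x)
      then have "Q (x N) * exp (2 * \<kappa> * geo_dist M (proj (x N)) (proj (x (N + n)))) \<le> B"
        unfolding B_def by (intro mult_left_mono) (auto intro: less_imp_le)
      then have "norm (drp (x (N + n))) \<le> sqrt B / \<kappa>"
        using Q_growth[of "x (N + n)" "x N"] by (intro norm_drp_le_of_Q) linarith
      moreover have "norm (x (N + n)) \<le> norm (drp (x (N + n))) + norm ((x (N + n) $ e) *\<^sub>R axis e 1 :: real^'n)"
        unfolding drp_def by (metis diff_add_cancel norm_triangle_ineq)
      moreover have "\<bar>x (N + n) $ e\<bar> \<le> 2 * \<delta>"
        using x(2)[of "N + n"] x(3)[of "N + n"] \<delta> by simp
      ultimately show ?thesis by simp
    qed
    then have "bounded (range (\<lambda>n. x (N + n)))" by (auto simp: bounded_iff)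
    then obtain l r where r: "strict_mono r" and lim: "(\<lambda>n. x (N + r n)) \<longlonglongrightarrow> l"
      using bounded_imp_convergent_subsequence[of "\<lambda>n. x (N + n)"] by (auto simp: o_def)
    have "(\<lambda>n. x (N + r n) $ e) \<longlonglongrightarrow> l $ e"
      using lim by (rule tendsto_vec_nth)
    then have le: "\<delta> / 2 \<le> l $ e" "l $ e \<le> \<delta> / 2 + \<delta>"
      using x(2,3) by (blast intro: LIMSEQ_le_const LIMSEQ_le_const2 less_imp_le)+
    then have a: "l $ e - \<delta> / 2 \<in> {0..\<delta>}" "l \<in> strip (l $ e - \<delta> / 2)"
      using \<delta> by (auto simp: strip_def)
    have "(\<lambda>n. geo_dist M (proj l) (\<sigma> (N + r n))) \<longlonglongrightarrow> 0"
      using geo_dist_tendsto_0[OF a lim] by (simp add: x)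
    then have "limitin ms.mtopology (\<sigma> \<circ> (\<lambda>n. N + r n)) (proj l) sequentially"
      unfolding ms.limit_metric_sequentially
      by (auto simp: ms.commute[of _ "proj l"] LIMSEQ_def)
    then show ?thesis
      using ms.MCauchy_convergent_subsequence[OF \<sigma>, of "\<lambda>n. N + r n"] r
      by (auto simp: strict_mono_def)
  qed
  then show ?thesis
    by (simp add: complete_riemannian_def riemannian_M ms.mcomplete_def)
qed

subsection \<open>Volume\<close>

definition w :: "real^'n \<Rightarrow> ennreal" where
  "w x = ennreal (sqrt (det (G x)))"

definition \<Sigma> :: "pt set set" where
  "\<Sigma> = sigma_sets UNIV {U. openin (rm_top M) U}"

text \<open>Push-forward from a single fundamental domain, so that every point of the quotient is
  counted once.\<close>

definition vol :: "pt measure" where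
  "vol = distr (restrict_space (density lborel w) slab) (sigma UNIV {U. openin (rm_top M) U}) proj"

lemma continuous_det_G: "continuous_on S (\<lambda>x. det (G x))"
  unfolding det_def by (intro continuous_intros smooth_continuous smooth_G)

lemma borel_w [measurable]: "w \<in> borel_measurable borel"
  unfolding w_def
  by (intro measurable_compose[OF _ measurable_ennreal] borel_measurable_continuous_onI
      continuous_intros continuous_det_G)

lemma w_sh [simp]: "w (x + sh k) = w x"
  by (simp add: w_def)

lemma measurable_proj: "proj \<in> measurable borel (sigma UNIV {U. openin (rm_top M) U})"
  by (rule measurable_measure_of) (auto simp: openin_M vimage_def[symmetric] borel_open)

lemma vimage_proj_borel: "A \<in> \<Sigma> \<Longrightarrow> proj -` A \<in> sets borel"
  using measurable_sets[OF measurable_proj, of A] by (simp add: \<Sigma>_def sets_measure_of)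

lemma slab_borel: "slab \<in> sets borel"
  unfolding slab_def by measurable

lemma emeasure_vol:
  assumes "A \<in> \<Sigma>"
  shows "emeasure vol A = (\<integral>\<^sup>+x\<in>slab \<inter> proj -` A. w x \<partial>lborel)"
proof -
  let ?R = "restrict_space (density lborel w) slab"
  have "proj \<in> measurable ?R (sigma UNIV {U. openin (rm_top M) U})"
    using measurable_proj by (intro measurable_restrict_space1) (simp add: measurable_def)
  then have "emeasure vol A = emeasure ?R (proj -` A \<inter> space ?R)"
    unfolding vol_def using assms by (intro emeasure_distr) (simp_all add: \<Sigma>_def sets_measure_of)
  also have "\<dots> = emeasure (density lborel w) (proj -` A \<inter> slab)"
    using slab_borel by (subst emeasure_restrict_space) (auto simp: space_restrict_space)
  also have "\<dots> = (\<integral>\<^sup>+x\<in>proj -` A \<inter> slab. w x \<partial>lborel)"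
    using slab_borel vimage_proj_borel[OF assms] by (intro emeasure_density) auto
  finally show ?thesis by (simp add: Int_commute)
qed

lemma nn_integral_shift:
  fixes f :: "real^'n \<Rightarrow> ennreal"
  assumes [measurable]: "f \<in> borel_measurable borel"
  shows "(\<integral>\<^sup>+x. f (x + c) \<partial>lborel) = (\<integral>\<^sup>+x. f x \<partial>lborel)"
proof -
  have "(\<integral>\<^sup>+x. f x \<partial>lborel) = (\<integral>\<^sup>+x. f x \<partial>distr lborel borel ((+) c))"
    by (simp add: lborel_distr_plus)
  also have "\<dots> = (\<integral>\<^sup>+x. f (x + c) \<partial>lborel)"
    by (subst nn_integral_distr) (simp_all add: add.commute)
  finally show ?thesis ..
qed

text \<open>The windows starting at 0 and at \<open>a\<close> share the part from \<open>a\<close>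
  to \<delta>; the leftover pieces differ by one period.\<close>

lemma periodic_nn_integral:
  fixes f :: "real^'n \<Rightarrow> ennreal"
  assumes f: "f \<in> borel_measurable borel" and per: "\<And>x. f (x + sh 1) = f x" and a: "a \<in> {0..\<delta>}"
  shows "(\<integral>\<^sup>+x\<in>{x. a \<le> x $ e \<and> x $ e < a + \<delta>}. f x \<partial>lborel) = (\<integral>\<^sup>+x\<in>slab. f x \<partial>lborel)"
proof -
  note [measurable] = f
  define I where "I b c = (\<lambda>x::real^'n. indicator {x. b \<le> x $ e \<and> x $ e < c} x :: ennreal)" for b c
  have [measurable]: "I b c \<in> borel_measurable borel" for b c
    unfolding I_def by measurable
  have add: "(\<integral>\<^sup>+x. f x * I b d x \<partial>lborel) = (\<integral>\<^sup>+x. f x * I b c x \<partial>lborel) + (\<integral>\<^sup>+x. f x * I c d x \<partial>lborel)"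
    if "b \<le> c" "c \<le> d" for b c d
  proof -
    have "f x * I b d x = f x * I b c x + f x * I c d x" for x
      using that by (auto simp: I_def indicator_def)
    then show ?thesis by (simp add: nn_integral_add)
  qed
  have "f x * I 0 a x = f (x + sh 1) * I \<delta> (a + \<delta>) (x + sh 1)" for x
    by (auto simp: per I_def sh_nth indicator_def)
  then have "(\<integral>\<^sup>+x. f x * I 0 a x \<partial>lborel) = (\<integral>\<^sup>+x. f x * I \<delta> (a + \<delta>) x \<partial>lborel)"
    using nn_integral_shift[of "\<lambda>x. f x * I \<delta> (a + \<delta>) x" "sh 1"] by simp
  then have "(\<integral>\<^sup>+x. f x * I a (a + \<delta>) x \<partial>lborel) = (\<integral>\<^sup>+x. f x * I 0 \<delta> x \<partial>lborel)"
    using add[of 0 a \<delta>] add[of a \<delta> "a + \<delta>"] a by (simp add: add.commute)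
  then show ?thesis by (simp add: I_def slab_def)
qed

lemma is_volume_measure_vol: "is_volume_measure M vol"
  unfolding is_volume_measure_def
proof (intro conjI ballI impI)
  show "space vol = points M" by (simp add: vol_def space_measure_of_conv)
  show sets: "sets vol = sigma_sets (points M) {U. openin (rm_top M) U}"
    by (simp add: vol_def sets_measure_of)
  fix c A assume c: "c \<in> rm_atlas M" and A: "A \<in> sets vol" "A \<subseteq> fst c"
  obtain a where a: "c = chart a" "a \<in> {0..\<delta>}" using c by (auto simp: atlas_M)
  have A': "A \<in> \<Sigma>" using A sets by (simp add: \<Sigma>_def)
  \<comment> \<open>The window is half-open so as to be a fundamental domain, while the strip is
    open. Since \<open>A\<close> lies in the domain of the chart, no point of the extra hyperplane
    projects into \<open>A\<close>, and the two preimages agree exactly.\<close>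
  define S where "S = {x :: real^'n. a \<le> x $ e \<and> x $ e < a + \<delta>}"
  have "x \<in> strip a" if x: "x \<in> S" "proj x \<in> A" for x
  proof -
    obtain y where y: "y \<in> strip a" "proj x = proj y" using x A(2) a by auto
    then obtain k where k: "y = x + sh k" using proj_eq_iff by blast
    have "k = 0" using slab_unique[of a x k] x(1) y(1) k by (auto simp: S_def strip_def)
    then show ?thesis using y k by simp
  qed
  then have "S \<inter> proj -` A = strip a \<inter> proj -` A"
    by (auto simp: S_def strip_def)
  moreover have "proj ` (strip a \<inter> proj -` A) = A"
    using A(2) unfolding a(1) chart_simps(1) by blast
  ultimately have img: "S \<inter> proj -` A = snd c ` A"
    using snd_chart_image[of "strip a \<inter> proj -` A" a] a(1) by simp
  define f where "f x = w x * indicator (proj -` A) x" for x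
  have "f \<in> borel_measurable borel"
    unfolding f_def using vimage_proj_borel[OF A'] by measurable
  from periodic_nn_integral[OF this _ a(2)]
  have "(\<integral>\<^sup>+x\<in>S. f x \<partial>lborel) = (\<integral>\<^sup>+x\<in>slab. f x \<partial>lborel)"
    by (simp add: S_def f_def indicator_def)
  then show "emeasure vol A = (\<integral>\<^sup>+x\<in>snd c ` A. ennreal (sqrt (det (rm_metric M c x))) \<partial>lborel)"
    unfolding emeasure_vol[OF A'] img[symmetric] f_def
    by (simp add: w_def[symmetric] mult.assoc Int_commute[of _ "proj -` A"] indicator_inter_arith)
qed

text \<open>Uniqueness needs a cover by two charts only: points outside the strip of offset 0 lie in
  the strip of offset \<delta>/2, so every measurable set splits into two parts whose measure is
  prescribed.\<close>

lemma riem_volume_M: "riem_volume M = vol"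
  unfolding riem_volume_def
proof (rule the_equality[where P = "is_volume_measure M", OF is_volume_measure_vol])
  fix \<mu> assume \<mu>: "is_volume_measure M \<mu>"
  have s: "sets \<mu> = sets vol"
    using \<mu> is_volume_measure_vol by (simp add: is_volume_measure_def)
  have eq: "emeasure \<mu> A = emeasure vol A" if "A \<in> sets vol" "A \<subseteq> proj ` strip a" "a \<in> {0..\<delta>}" for A a
  proof -
    have "emeasure \<nu> A = (\<integral>\<^sup>+x\<in>snd (chart a) ` A. ennreal (sqrt (det (rm_metric M (chart a) x))) \<partial>lborel)"
      if \<nu>: "is_volume_measure M \<nu>" "A \<in> sets \<nu>" for \<nu>
    proof -
      have "chart a \<in> rm_atlas M" "A \<subseteq> fst (chart a)"
        using \<open>a \<in> {0..\<delta>}\<close> \<open>A \<subseteq> proj ` strip a\<close> by (simp_all add: atlas_M)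
      then show ?thesis using \<nu> unfolding is_volume_measure_def by blast
    qed
    from this[OF \<mu>] this[OF is_volume_measure_vol] show ?thesis using that(1) s by simp
  qed
  show "\<mu> = vol"
  proof (rule measure_eqI[OF s])
    fix A assume "A \<in> sets \<mu>"
    then have A: "A \<in> sets vol" using s by simp
    let ?U = "proj ` strip 0"
    have "openin (rm_top M) ?U" by (simp add: openin_M open_proj open_strip)
    then have U: "?U \<in> sets vol"
      using is_volume_measure_vol by (auto simp: is_volume_measure_def intro: sigma_sets.Basic)
    have "q \<in> proj ` strip (\<delta> / 2)" if "q \<notin> ?U" for q
    proof -
      obtain x where x: "proj x = q" "\<delta> / 2 \<le> x $ e" "x $ e < \<delta> / 2 + \<delta>"
        using proj_lift by blast
      have "x $ e \<noteq> \<delta> / 2"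
        using that x \<delta> by (auto simp: strip_def)
      then show ?thesis using x by (auto simp: strip_def)
    qed
    then have D: "A - ?U \<subseteq> proj ` strip (\<delta> / 2)" by blast
    have split: "emeasure \<nu> A = emeasure \<nu> (A \<inter> ?U) + emeasure \<nu> (A - ?U)"
      if "sets \<nu> = sets vol" for \<nu>
      using A U that by (subst plus_emeasure) (auto simp: Int_Diff_Un)
    show "emeasure \<mu> A = emeasure vol A"
      unfolding split[OF s] split[OF refl]
      using eq[of "A \<inter> ?U" 0] eq[OF _ D] A U \<delta> by auto
  qed
qed

text \<open>The box, and with it \<open>B\<close> and \<open>D\<close>, does not depend on \<open>\<delta>\<close>: as long as \<open>\<delta> \<le> 1\<close> it contains the
  coordinates of the points of the unit ball in every chart.\<close>

lemma ball_integral_bound: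
  fixes F :: "real \<Rightarrow> real"
  assumes \<delta>1: "\<delta> \<le> 1" and R: "R = sqrt (exp (2 * \<kappa>)) / \<kappa>"
    and D: "\<And>x. x \<in> cbox (\<chi> i. - R - 2) (\<chi> i. R + 2) \<Longrightarrow> sqrt (det (G x)) \<le> D"
    and B: "\<And>x. x \<in> cbox (\<chi> i. - R - 2) (\<chi> i. R + 2) \<Longrightarrow> F (Rm_norm_coord G x) \<le> B"
    and "0 \<le> B" "0 \<le> D"
  shows "(\<integral>\<^sup>+q\<in>geo_ball M (proj 0) 1. ennreal (F (Rm_norm M q)) \<partial>riem_volume M)
    \<le> ennreal (B * D * (2 * R + 1) ^ (CARD('n) - 1) * \<delta>)"
proof -
  interpret ms: Metric_space UNIV "geo_dist M" by (rule Metric_space_M)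
  have R0: "0 < R" using \<kappa> by (simp add: R)
  \<comment> \<open>\<open>Q\<close> equals 1 at the base point and \<open>ln Q\<close> has
    Lipschitz constant 2\<kappa>, so \<open>Q\<close> is at most \<open>exp (2 * \<kappa>)\<close>
    on the unit ball. \<open>R\<close> is the resulting bound on transverse coordinates.\<close>
  have R1: "\<bar>x $ i\<bar> \<le> R" if "Q x \<le> exp (2 * \<kappa>)" "i \<noteq> e" for x i
    using component_le_norm_cart[of "drp x" i] norm_drp_le_of_Q[OF that(1)] that(2) by (simp add: R drp_nth)
  \<comment> \<open>An open tube around the ball. It is measurable because it is open, and
    \<open>nn_integral_mono\<close> compares the two integrals without a measurability question for
    the ball. The margin 1/2 turns the weak bound \<open>R\<close> into a strict one.\<close>
  define T where "T = proj ` {x. \<forall>i. i \<noteq> e \<longrightarrow> \<bar>x $ i\<bar> < R + 1/2}"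
  have "open {x :: real^'n. \<forall>i. i \<noteq> e \<longrightarrow> \<bar>x $ i\<bar> < R + 1/2}"
  proof -
    have "{x :: real^'n. \<forall>i. i \<noteq> e \<longrightarrow> \<bar>x $ i\<bar> < R + 1/2} = (\<Inter>i\<in>-{e}. {x. \<bar>x $ i\<bar> < R + 1/2})" by auto
    then show ?thesis by (auto intro!: open_INT open_Collect_less continuous_intros)
  qed
  then have T: "T \<in> \<Sigma>"
    unfolding T_def \<Sigma>_def by (intro sigma_sets.Basic) (simp add: openin_M open_proj)
  have T_lift: "\<bar>x $ i\<bar> < R + 1/2" if prems: "proj x \<in> T" "i \<noteq> e" for x i
  proof -
    obtain y where y: "\<bar>y $ i\<bar> < R + 1/2" "proj y = proj x"
      using prems unfolding T_def by auto
    then obtain k where "x = y + sh k" using proj_eq_iff[of y x] by blast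
    then show ?thesis using prems(2) y(1) by (simp add: sh_nth)
  qed
  have le: "ennreal (F (Rm_norm M q)) * indicator (geo_ball M (proj 0) 1) q \<le> ennreal B * indicator T q" for q
  proof (cases "q \<in> geo_ball M (proj 0) 1")
    case True
    then have d: "geo_dist M (proj 0) q < 1" by (simp add: geo_ball_def)
    have Qx: "Q x \<le> exp (2 * \<kappa>)" if "proj x = q" for x
    proof -
      have "Q x \<le> Q 0 * exp (2 * \<kappa> * geo_dist M (proj 0) q)"
        using Q_growth[of x 0] that by simp
      moreover have "Q 0 = 1" by (simp add: Q_def drp_def)
      moreover have "exp (2 * \<kappa> * geo_dist M (proj 0) q) \<le> exp (2 * \<kappa>)"
        using d \<kappa> by simp
      ultimately show ?thesis by (metis mult_1 order_trans)
    qed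
    have "\<exists>c. c \<in> rm_atlas M \<and> q \<in> fst c"
      using common_strip[of q q] by (auto simp: atlas_M)
    from someI_ex[OF this] obtain a where a: "a \<in> {0..\<delta>}"
      "(SOME c. c \<in> rm_atlas M \<and> q \<in> fst c) = chart a" "q \<in> proj ` strip a"
      by (auto simp: atlas_M)
    then obtain x where x: "x \<in> strip a" "proj x = q" by auto
    \<comment> \<open>The 2 covers the circle coordinate, which in a chart of the atlas lies between
      0 and 2\<delta> with \<delta> at most 1.\<close>
    have "\<bar>x $ i\<bar> \<le> R + 2" for i
      using R1[OF Qx[OF x(2)], of i] x(1) a(1) \<delta>1 R0 by (cases "i = e") (auto simp: strip_def)
    then have "x \<in> cbox (\<chi> i. - R - 2) (\<chi> i. R + 2)"
      by (auto simp: mem_box_cart abs_le_iff) (smt (verit))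
    from B[OF this] have "F (Rm_norm M q) \<le> B"
      unfolding Rm_norm_def Let_def a(2) using x by auto
    moreover have "q \<in> T"
      unfolding T_def using R1[OF Qx[OF x(2)]] x(2)
      by (intro image_eqI[of _ _ x]) force+
    ultimately show ?thesis using True by (simp add: ennreal_leI)
  qed simp
  have box: "w x * indicator (slab \<inter> proj -` T) x
      \<le> ennreal D * indicator (cbox (\<chi> i. if i = e then 0 else - R - 1/2) (\<chi> i. if i = e then \<delta> else R + 1/2)) x" for x
  proof (cases "x \<in> slab \<inter> proj -` T")
    case True
    have i: "\<bar>x $ i\<bar> < R + 1/2" if "i \<noteq> e" for i using T_lift[OF _ that] True by simp
    have e: "0 \<le> x $ e" "x $ e < \<delta>" using True by (auto simp: slab_def)
    have "\<bar>x $ i\<bar> \<le> R + 2" for i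
      using i[of i] e \<delta>1 R0 by (cases "i = e") auto
    then have "x \<in> cbox (\<chi> i. - R - 2) (\<chi> i. R + 2)"
      by (auto simp: mem_box_cart abs_le_iff) (smt (verit))
    from D[OF this] have "w x \<le> ennreal D" unfolding w_def by (rule ennreal_leI)
    moreover have "x \<in> cbox (\<chi> i. if i = e then 0 else - R - 1/2) (\<chi> i. if i = e then \<delta> else R + 1/2)"
      using i e by (auto simp: mem_box_cart abs_less_iff) (smt (verit))+
    ultimately show ?thesis using True by simp
  qed simp
  have "(\<integral>\<^sup>+q\<in>geo_ball M (proj 0) 1. ennreal (F (Rm_norm M q)) \<partial>riem_volume M)
      \<le> (\<integral>\<^sup>+q. ennreal B * indicator T q \<partial>vol)"
    unfolding riem_volume_M by (intro nn_integral_mono le)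
  also have "\<dots> = ennreal B * emeasure vol T"
    using T is_volume_measure_vol
    by (intro nn_integral_cmult_indicator) (simp add: is_volume_measure_def \<Sigma>_def)
  also have "emeasure vol T \<le> (\<integral>\<^sup>+x. ennreal D *
      indicator (cbox (\<chi> i. if i = e then 0 else - R - 1/2) (\<chi> i. if i = e then \<delta> else R + 1/2)) x \<partial>lborel)"
    unfolding emeasure_vol[OF T] by (intro nn_integral_mono box)
  also have "\<dots> = ennreal D * emeasure lborel
      (cbox (\<chi> i. if i = e then 0 else - R - 1/2) (\<chi> i. if i = e then \<delta> else R + 1/2) :: (real^'n) set)"
    by (intro nn_integral_cmult_indicator) simp
  also have "emeasure lborel
      (cbox (\<chi> i. if i = e then 0 else - R - 1/2) (\<chi> i. if i = e then \<delta> else R + 1/2) :: (real^'n) set)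
      = ennreal ((2 * R + 1) ^ (CARD('n) - 1) * \<delta>)"
  proof -
    have "0 \<in> (cbox (\<chi> i. if i = e then 0 else - R - 1/2) (\<chi> i. if i = e then \<delta> else R + 1/2) :: (real^'n) set)"
      using R0 \<delta> by (simp add: mem_box_cart)
    then have "measure lborel (cbox (\<chi> i. if i = e then 0 else - R - 1/2) (\<chi> i. if i = e then \<delta> else R + 1/2) :: (real^'n) set)
        = (\<Prod>i\<in>UNIV. if i = e then \<delta> else 2 * R + 1)"
      by (subst content_cbox_cart) (auto intro!: prod.cong)
    also have "\<dots> = \<delta> * (\<Prod>i\<in>UNIV - {e}. 2 * R + 1)"
      by (subst prod.remove[of UNIV e]) (auto intro!: prod.cong)
    also have "\<dots> = (2 * R + 1) ^ (CARD('n) - 1) * \<delta>"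
      by (simp add: card_Diff_singleton)
    finally have m: "measure lborel (cbox (\<chi> i. if i = e then 0 else - R - 1/2) (\<chi> i. if i = e then \<delta> else R + 1/2) :: (real^'n) set)
        = (2 * R + 1) ^ (CARD('n) - 1) * \<delta>" .
    have "emeasure lborel (cbox a b) \<noteq> top" for a b :: "real^'n"
      using emeasure_lborel_cbox_finite[of a b] by auto
    then show ?thesis unfolding m[symmetric] by (rule emeasure_eq_ennreal_measure)
  qed
  finally show ?thesis
    using assms(5,6) \<delta> R0 by (simp add: ennreal_mult'[symmetric] mult.assoc mult_left_mono)
qed

end

text \<open>Compactness of a box independent of \<delta> bounds volume density and curvature once
  and for all; the integral is then at most \<open>A * \<delta>\<close>. The curvature at
  \<open>p\<close> is stated at an unspecified point of the \<open>e\<close> axis because the chart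
  in \<open>Rm_norm\<close> is a choice, which fixes the lift of the base point only up to
  translation.\<close>

lemma exists_collapsed_quotient:
  fixes G :: "real^'n::finite \<Rightarrow> real^'n^'n" and F :: "real \<Rightarrow> real"
  assumes loc: "\<And>\<delta>. 0 < \<delta> \<Longrightarrow> circle_quotient G e \<delta> \<kappa>"
    and F: "continuous_on UNIV (\<lambda>x. F (Rm_norm_coord G x))"
    and \<epsilon>: "0 < \<epsilon>"
  shows "\<exists>\<delta>>0. \<exists>p. (\<integral>\<^sup>+q\<in>geo_ball (circle_quotient.M G e \<delta>) p 1.
      ennreal (F (Rm_norm (circle_quotient.M G e \<delta>) q)) \<partial>riem_volume (circle_quotient.M G e \<delta>)) \<le> ennreal \<epsilon>
    \<and> (\<exists>t. Rm_norm (circle_quotient.M G e \<delta>) p = Rm_norm_coord G (axis e t))"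
proof -
  define R where "R = sqrt (exp (2 * \<kappa>)) / \<kappa>"
  let ?K = "cbox (\<chi> i. - R - 2) (\<chi> i. R + 2) :: (real^'n) set"
  \<comment> \<open>Instance at \<delta> = 1 for facts on \<open>G\<close> and \<kappa> that are
    needed before \<delta> is chosen.\<close>
  interpret one: circle_quotient G e 1 \<kappa> by (rule loc) simp
  have R: "0 < R" using one.\<kappa> by (simp add: R_def)
  have bdd: "\<exists>B\<ge>0. \<forall>x\<in>?K. f x \<le> B" if "continuous_on ?K f" for f :: "real^'n \<Rightarrow> real"
  proof -
    have "bounded (f ` ?K)"
      by (intro compact_imp_bounded compact_continuous_image that compact_cbox)
    then obtain B where B: "\<forall>x\<in>?K. \<bar>f x\<bar> \<le> B"
      unfolding bounded_iff ball_simps real_norm_def by blast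
    show ?thesis
      using B by (intro exI[of _ "max B 0"]) (auto simp: max_def abs_le_iff intro: order_trans)
  qed
  obtain D where D: "0 \<le> D" "\<forall>x\<in>?K. sqrt (det (G x)) \<le> D"
    using bdd[OF continuous_on_real_sqrt[OF one.continuous_det_G]] by blast
  obtain B where B: "0 \<le> B" "\<forall>x\<in>?K. F (Rm_norm_coord G x) \<le> B"
    using bdd continuous_on_subset[OF F subset_UNIV] by blast
  define A where "A = B * D * (2 * R + 1) ^ (CARD('n) - 1)"
  \<comment> \<open>The summand 1 guards against division by zero when \<open>A\<close>
    vanishes.\<close>
  define \<delta> where "\<delta> = min 1 (\<epsilon> / (A + 1))"
  have A: "0 \<le> A" using D B R by (simp add: A_def)
  then have d: "0 < \<delta>" "\<delta> \<le> 1" "\<delta> \<le> \<epsilon> / (A + 1)" using \<epsilon> by (auto simp: \<delta>_def)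
  interpret circle_quotient G e \<delta> \<kappa> by (rule loc) (rule d)
  have "A * \<delta> \<le> A * (\<epsilon> / (A + 1))" using A d by (intro mult_left_mono) auto
  also have "\<dots> \<le> \<epsilon>" using A \<epsilon> by (simp add: field_simps)
  finally have "ennreal (A * \<delta>) \<le> ennreal \<epsilon>" by (rule ennreal_leI)
  moreover have "(\<integral>\<^sup>+q\<in>geo_ball M (proj 0) 1. ennreal (F (Rm_norm M q)) \<partial>riem_volume M) \<le> ennreal (A * \<delta>)"
    unfolding A_def by (rule ball_integral_bound[OF d(2) R_def]) (use B D in auto)
  moreover have "\<exists>t. Rm_norm M (proj 0) = Rm_norm_coord G (axis e t)"
  proof -
    have "\<exists>c. c \<in> rm_atlas M \<and> q \<in> fst c" for q
      using common_strip[of q q] by (auto simp: atlas_M)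
    from someI_ex[OF this, of "proj 0"] obtain a where a:
      "(SOME c. c \<in> rm_atlas M \<and> proj 0 \<in> fst c) = chart a" "proj 0 \<in> proj ` strip a"
      by (auto simp: atlas_M)
    then obtain x where x: "x \<in> strip a" "proj 0 = proj x" by auto
    then obtain k where k: "x = sh k" using proj_eq_iff[of 0 x] by auto
    have "sh k = axis e (of_int k * \<delta>)" by (simp add: vec_eq_iff sh_nth axis_def)
    moreover have "Rm_norm M (proj 0) = Rm_norm_coord G x"
      unfolding Rm_norm_def Let_def a(1) metric_M using x by simp
    ultimately show ?thesis using k by auto
  qed
  ultimately show ?thesis using d(1) order_trans by blast
qed

text \<open>Common end of both parts: \<open>P\<close> is the class of metrics, here decided by the
  metric components alone, and \<open>F\<close> the power of the curvature in the integral. The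
  assumed estimate is applied with r = 1, and the supremum is tested at the centre.\<close>

lemma collapsing_contradiction:
  fixes G :: "real^'n::finite \<Rightarrow> real^'n^'n" and F :: "real \<Rightarrow> real"
  assumes loc: "\<And>\<delta>. 0 < \<delta> \<Longrightarrow> circle_quotient G e \<delta> \<kappa>"
    and F: "continuous_on UNIV (\<lambda>x. F (Rm_norm_coord G x))"
    and big: "\<And>t. C < Rm_norm_coord G (axis e t)" and "0 < \<epsilon>" "0 < C"
    and P: "\<And>M :: (pt, 'n) riem. rm_metric M = (\<lambda>_. G) \<Longrightarrow> P M"
    and reg: "\<forall>M :: (pt, 'n) riem. complete_riemannian M \<and> P M \<longrightarrow>
      (\<forall>p\<in>points M. \<forall>r::real. 0 < r \<and> r \<le> 1 \<longrightarrow>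
        (\<integral>\<^sup>+q\<in>geo_ball M p r. ennreal (F (Rm_norm M q)) \<partial>riem_volume M) \<le> ennreal \<epsilon> \<longrightarrow>
        (SUP q\<in>geo_ball M p (r/2). ennreal (Rm_norm M q)) \<le> ennreal (C / r\<^sup>2))"
  shows False
proof -
  from exists_collapsed_quotient[OF loc F \<open>0 < \<epsilon>\<close>] obtain \<delta> p t where \<delta>: "0 < \<delta>"
    and small: "(\<integral>\<^sup>+q\<in>geo_ball (circle_quotient.M G e \<delta>) p 1.
      ennreal (F (Rm_norm (circle_quotient.M G e \<delta>) q)) \<partial>riem_volume (circle_quotient.M G e \<delta>)) \<le> ennreal \<epsilon>"
    and Rm: "Rm_norm (circle_quotient.M G e \<delta>) p = Rm_norm_coord G (axis e t)"
    by blast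
  interpret circle_quotient G e \<delta> \<kappa> by (rule loc[OF \<delta>])
  interpret ms: Metric_space UNIV "geo_dist M" by (rule Metric_space_M)
  have "P M" by (rule P) (simp add: M_def)
  then have "(SUP q\<in>geo_ball M p (1/2). ennreal (Rm_norm M q)) \<le> ennreal (C / 1\<^sup>2)"
    using reg[rule_format, of M p 1] complete_M small by simp
  moreover have "p \<in> geo_ball M p (1/2)" by (simp add: geo_ball_def)
  ultimately have "ennreal (Rm_norm M p) \<le> ennreal C"
    by (simp add: SUP_le_iff)
  then have "Rm_norm M p \<le> C" using \<open>0 < C\<close> by (simp add: ennreal_le_iff)
  then show False using big[of t] Rm by simp
qed

section \<open>Curvature computations\<close>

text \<open>For symmetric matrices, transposing the right-inverse identity yields the left-inverse
  identity.\<close>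

lemma ginv_eqI:
  fixes G :: "'n::finite metric_field"
  assumes sym: "\<And>i j. G x $ i $ j = G x $ j $ i" and symB: "\<And>i j. B i j = B j i"
    and inv: "\<And>i j. (\<Sum>k\<in>UNIV. G x $ i $ k * B k j) = (if i = j then 1 else 0)"
  shows "ginv G i j x = B i j"
proof -
  let ?B = "(\<chi> i j. B i j) :: real^'n^'n"
  have 1: "G x ** ?B = mat 1"
    by (simp add: matrix_matrix_mult_def mat_def vec_eq_iff inv)
  have "(\<Sum>k\<in>UNIV. B i k * G x $ k $ j) = (if i = j then 1 else 0)" for i j
    using inv[of j i] by (simp add: sym[of _ j] symB[of i] mult.commute eq_commute)
  then have 2: "?B ** G x = mat 1"
    by (simp add: matrix_matrix_mult_def mat_def vec_eq_iff)
  have "\<exists>A. G x ** A = mat 1 \<and> A ** G x = mat 1" using 1 2 by blast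
  from someI_ex[OF this] have "G x ** matrix_inv (G x) = mat 1"
    unfolding matrix_inv_def by blast
  then have "?B ** (G x ** matrix_inv (G x)) = ?B" by simp
  then have "matrix_inv (G x) = ?B" by (simp add: matrix_mul_assoc 2)
  then show ?thesis by (simp add: ginv_def)
qed

text \<open>Where the metric matrix is the identity, the norm is the Euclidean norm of the
  components, so a single component suffices as a lower bound.\<close>

lemma Rm_norm_coord_ge:
  fixes G :: "'n::finite metric_field"
  assumes "\<And>i j. ginv G i j x = (if i = j then 1 else 0)"
  shows "\<bar>Rm G [i, j, k, l] x\<bar> \<le> Rm_norm_coord G x"
proof -
  define T where "T i j k l = Rm G [i, j, k, l] x" for i j k l
  have "Rm_norm_coord G x = sqrt (\<Sum>i\<in>UNIV. \<Sum>j\<in>UNIV. \<Sum>k\<in>UNIV. \<Sum>l\<in>UNIV. (T i j k l)\<^sup>2)"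
  proof -
    define D where "D i j = (if i = j then 1 else 0 :: real)" for i j :: 'n
    have D: "(\<Sum>m\<in>UNIV. D i m * g m) = g i" for i g
      by (simp add: D_def mult_delta_left)
    \<comment> \<open>Nesting the sums lets each Kronecker delta collapse its own index in
      turn.\<close>
    have "(\<Sum>a\<in>UNIV. \<Sum>b\<in>UNIV. \<Sum>c\<in>UNIV. \<Sum>d\<in>UNIV. D i a * D j b * D k c * D l d * T i j k l * T a b c d)
        = (\<Sum>a\<in>UNIV. D i a * (\<Sum>b\<in>UNIV. D j b * (\<Sum>c\<in>UNIV. D k c * (\<Sum>d\<in>UNIV. D l d * (T i j k l * T a b c d)))))"
      for i j k l
      by (simp only: sum_distrib_left mult.assoc)
    then have "(\<Sum>a\<in>UNIV. \<Sum>b\<in>UNIV. \<Sum>c\<in>UNIV. \<Sum>d\<in>UNIV. D i a * D j b * D k c * D l d * T i j k l * T a b c d)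
        = (T i j k l)\<^sup>2" for i j k l
      by (simp only: D power2_eq_square)
    then show ?thesis
      unfolding Rm_norm_coord_def assms T_def[symmetric] D_def[symmetric] by simp
  qed
  moreover have "(T i j k l)\<^sup>2 \<le> (\<Sum>i\<in>UNIV. \<Sum>j\<in>UNIV. \<Sum>k\<in>UNIV. \<Sum>l\<in>UNIV. (T i j k l)\<^sup>2)"
  proof -
    have "(T i j k l)\<^sup>2 \<le> (\<Sum>l\<in>UNIV. (T i j k l)\<^sup>2)"
      by (rule member_le_sum) auto
    also have "\<dots> \<le> (\<Sum>k\<in>UNIV. \<Sum>l\<in>UNIV. (T i j k l)\<^sup>2)"
      by (rule member_le_sum) (auto intro!: sum_nonneg)
    also have "\<dots> \<le> (\<Sum>j\<in>UNIV. \<Sum>k\<in>UNIV. \<Sum>l\<in>UNIV. (T i j k l)\<^sup>2)"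
      by (rule member_le_sum) (auto intro!: sum_nonneg)
    also have "\<dots> \<le> (\<Sum>i\<in>UNIV. \<Sum>j\<in>UNIV. \<Sum>k\<in>UNIV. \<Sum>l\<in>UNIV. (T i j k l)\<^sup>2)"
      by (rule member_le_sum) (auto intro!: sum_nonneg)
    finally show ?thesis .
  qed
  ultimately show ?thesis
    using real_sqrt_le_mono by (metis T_def real_sqrt_abs)
qed

subsection \<open>Hyperbolic space times a line\<close>

text \<open>The hyperboloid of curvature \<open>-k\<close>, projected orthogonally onto its space-like coordinates.\<close>

locale hyperbolic =
  fixes e :: "'n::finite" and k :: real
  assumes k: "0 < k"
begin

definition P :: "'n \<Rightarrow> 'n \<Rightarrow> real" where
  "P i j = (if i = j \<and> i \<noteq> e then 1 else 0)"

definition y :: "'n \<Rightarrow> real^'n \<Rightarrow> real" where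
  "y i x = (if i = e then 0 else x $ i)"

definition f :: "real^'n \<Rightarrow> real" where
  "f x = 1 + k * (\<Sum>i\<in>UNIV. (y i x)\<^sup>2)"

definition a :: "real^'n \<Rightarrow> real" where
  "a x = k / f x"

text \<open>The metric of the hyperbolic factor alone, that is \<open>G\<close> without the square
  of the differential of the flat coordinate.\<close>

definition q :: "'n \<Rightarrow> 'n \<Rightarrow> real^'n \<Rightarrow> real" where
  "q i j x = P i j - a x * y i x * y j x"

definition G :: "'n metric_field" where
  "G x = (\<chi> i j. (if i = j then 1 else 0) - a x * y i x * y j x)"

lemma f_ge_1: "1 \<le> f x"
  using k by (simp add: f_def sum_nonneg)

lemma f_neq_0 [simp]: "f x \<noteq> 0"
  using f_ge_1[of x] by linarith

lemma a_f: "a x * f x = k"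
  by (simp add: a_def)

lemma sum_y: "k * (\<Sum>i\<in>UNIV. (y i x)\<^sup>2) = f x - 1"
  by (simp add: f_def)

lemma P_e [simp]: "P e j = 0" "P i e = 0"
  by (auto simp: P_def)

lemma y_e [simp]: "y e x = 0"
  by (simp add: y_def)

lemma P_sym: "P i j = P j i"
  by (auto simp: P_def)

lemma q_sym: "q i j x = q j i x"
  by (simp add: q_def P_sym[of i j] mult_ac)

lemma sum_P [simp]: "(\<Sum>m\<in>UNIV. P i m * g m) = (if i = e then 0 else g i)"
  by (simp add: P_def mult_delta_left if_distrib[of "\<lambda>t. t * _"] cong: if_cong)

lemma y_deriv [derivative_intros]:
  "(y i has_derivative (\<lambda>v. if i = e then 0 else v $ i)) (at x)"
  unfolding y_def[abs_def] by (cases "i = e") (auto intro!: derivative_eq_intros)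

lemma smooth_y [intro]: "smooth (y i)"
  unfolding y_def[abs_def] by (cases "i = e") auto

lemma smooth_f [intro]: "smooth f"
  unfolding f_def[abs_def] by (intro smooth_add smooth_mult smooth_sum smooth_power2 smooth_const smooth_y)

lemma smooth_a [intro]: "smooth a"
  unfolding a_def[abs_def] by (intro smooth_divide smooth_const smooth_f) simp

lemma pd_y: "partial_deriv i (y j) x = P i j"
  by (subst partial_deriv_eqI[OF y_deriv]) (auto simp: P_def axis_def)

lemma pd_a: "partial_deriv i a x = - 2 * (a x)\<^sup>2 * y i x"
proof -
  have "(f has_derivative (\<lambda>v. k * (\<Sum>j\<in>UNIV. 2 * (y j x * (if j = e then 0 else v $ j))))) (at x)"
    unfolding f_def[abs_def] by (auto intro!: derivative_eq_intros simp: mult_ac)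
  from has_derivative_divide'[OF has_derivative_const[of k] this]
  have "(a has_derivative (\<lambda>v. - (k * (k * (\<Sum>j\<in>UNIV. 2 * (y j x * (if j = e then 0 else v $ j))))) / (f x * f x))) (at x)"
    unfolding a_def[abs_def] by simp
  from partial_deriv_eqI[OF this, of i]
  have "partial_deriv i a x = - (k * (k * (\<Sum>j\<in>UNIV. 2 * (y j x * P i j)))) / (f x * f x)"
  proof -
    have "(if j = e then 0 else axis i 1 $ j) = P i j" for j
      by (simp add: P_def axis_def)
    then show ?thesis using \<open>partial_deriv i a x = _\<close> by simp
  qed
  also have "(\<Sum>j\<in>UNIV. 2 * (y j x * P i j)) = 2 * y i x"
    using sum_P[of i "\<lambda>j. 2 * y j x"] by (auto simp: mult_ac)
  finally show ?thesis by (simp add: a_def[of x] power2_eq_square field_simps)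
qed

lemma pd_prod:
  "partial_deriv i (\<lambda>x. a x * y j x * y l x) x
    = a x * (P i j * y l x + y j x * P i l) - 2 * (a x)\<^sup>2 * y i x * y j x * y l x"
proof -
  have "partial_deriv i (\<lambda>x. a x * y j x * y l x) x
      = (partial_deriv i a x * y j x + a x * partial_deriv i (y j) x) * y l x + a x * y j x * partial_deriv i (y l) x"
    by (subst partial_deriv_mult partial_deriv_mult; (intro smooth_differentiable smooth_mult smooth_a smooth_y)?)+
       simp
  then show ?thesis by (simp add: pd_a pd_y algebra_simps)
qed

lemma partial_deriv_const_diff:
  fixes g :: "real^'n \<Rightarrow> real"
  assumes "smooth g"
  shows "partial_deriv i (\<lambda>x. c - g x) x = - partial_deriv i g x"
proof -
  from smooth_differentiable[OF assms] obtain D where D: "(g has_derivative D) (at x)"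
    unfolding differentiable_def by blast
  then have "((\<lambda>x. c - g x) has_derivative (\<lambda>v. - D v)) (at x)"
    by (auto intro!: derivative_eq_intros)
  from partial_deriv_eqI[OF this] partial_deriv_eqI[OF D] show ?thesis by simp
qed

lemma smooth_prod3 [intro]: "smooth (\<lambda>x. a x * y j x * y l x)"
  by (intro smooth_mult smooth_a smooth_y)

lemma pd_G: "partial_deriv i (\<lambda>x. G x $ j $ l) x
    = 2 * (a x)\<^sup>2 * y i x * y j x * y l x - a x * (P i j * y l x + y j x * P i l)"
  by (simp add: G_def partial_deriv_const_diff smooth_prod3 pd_prod)

lemma pd_q: "partial_deriv i (q j l) x
    = 2 * (a x)\<^sup>2 * y i x * y j x * y l x - a x * (P i j * y l x + y j x * P i l)"
  unfolding q_def[abs_def] by (simp add: partial_deriv_const_diff smooth_prod3 pd_prod)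

lemma ginv_G: "ginv G i j x = (if i = j then 1 else 0) + k * y i x * y j x"
proof (rule ginv_eqI)
  fix i j
  have "(\<Sum>m\<in>UNIV. G x $ i $ m * ((if m = j then 1 else 0) + k * y m x * y j x))
      = (\<Sum>m\<in>UNIV. (if i = m then 1 else 0) * ((if m = j then 1 else 0) + k * y m x * y j x))
        - (\<Sum>m\<in>UNIV. a x * y i x * y m x * (if m = j then 1 else 0))
        - (\<Sum>m\<in>UNIV. a x * y i x * y j x * (k * (y m x)\<^sup>2))"
    by (simp add: G_def algebra_simps power2_eq_square flip: sum.distrib sum_subtractf)
  also have "\<dots> = (if i = j then 1 else 0) + k * y i x * y j x - a x * y i x * y j x - a x * y i x * y j x * (f x - 1)"
    by (simp add: mult_delta_left mult_delta_right sum_y flip: sum_distrib_left)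
  also have "\<dots> = (if i = j then 1 else 0)"
  proof -
    \<comment> \<open>The relation \<open>a_f\<close> enters a polynomial identity in plain
      variables, so that the denominator \<open>f x\<close> never has to be cleared.\<close>
    have "A * F = K \<Longrightarrow> K * u * v - A * u * v - A * u * v * (F - 1) = 0" for A F K u v :: real
      by (auto simp: algebra_simps)
    from this[OF a_f[of x], of "y i x" "y j x"] show ?thesis by linarith
  qed
  finally show "(\<Sum>m\<in>UNIV. G x $ i $ m * ((if m = j then 1 else 0) + k * y m x * y j x))
      = (if i = j then 1 else 0)" .
qed (auto simp: G_def)

text \<open>Up to sign, the Christoffel symbols with upper index \<open>l\<close> are the Hessian of
  the coordinate \<open>y l\<close>. A linear coordinate restricted to the hyperboloid has Hessian
  \<open>k * y l\<close> times the metric, by the Gauss formula.\<close>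

lemma christoffel_G: "christoffel G l i j x = - k * y l x * q i j x"
proof -
  have "christoffel G l i j x = (\<Sum>m\<in>UNIV. ((if l = m then 1 else 0) + k * y l x * y m x) * (- a x * y m x * q i j x))"
    unfolding christoffel_def pd_G ginv_G sum_distrib_left
  proof (intro sum.cong refl)
    fix m
    show "1 / 2 * (((if l = m then 1 else 0) + k * y l x * y m x) *
        (2 * (a x)\<^sup>2 * y i x * y j x * y m x - a x * (P i j * y m x + y j x * P i m) +
         (2 * (a x)\<^sup>2 * y j x * y i x * y m x - a x * (P j i * y m x + y i x * P j m)) -
         (2 * (a x)\<^sup>2 * y m x * y i x * y j x - a x * (P m i * y j x + y i x * P m j))))
      = ((if l = m then 1 else 0) + k * y l x * y m x) * (- a x * y m x * q i j x)"
      by (simp add: q_def P_sym[of j i] P_sym[of m i] P_sym[of m j] power2_eq_square algebra_simps)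
  qed
  also have "\<dots> = - a x * q i j x * ((\<Sum>m\<in>UNIV. (if l = m then 1 else 0) * y m x) + y l x * (k * (\<Sum>m\<in>UNIV. (y m x)\<^sup>2)))"
    by (simp add: sum_distrib_left sum.distrib[symmetric] algebra_simps power2_eq_square)
  also have "\<dots> = - (a x * f x) * y l x * q i j x"
    unfolding sum_y by (simp add: mult_delta_left mult_delta_right algebra_simps)
  finally show ?thesis by (simp add: a_f)
qed

lemma sum_y_q: "(\<Sum>m\<in>UNIV. y m x * q i m x) * k = a x * y i x"
proof -
  have "(\<Sum>m\<in>UNIV. y m x * q i m x) * k = (\<Sum>m\<in>UNIV. P i m * (k * y m x)) - a x * y i x * (k * (\<Sum>m\<in>UNIV. (y m x)\<^sup>2))"
    by (simp add: q_def sum_distrib_left sum_distrib_right algebra_simps power2_eq_square flip: sum_subtractf)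
  also have "\<dots> = k * y i x - a x * y i x * (f x - 1)"
    unfolding sum_y sum_P by auto
  also have "\<dots> = a x * y i x" 
  proof -
    have "A * F = K \<Longrightarrow> K * u - A * u * (F - 1) = A * u" for A F K u :: real
      by (auto simp: algebra_simps)
    from this[OF a_f] show ?thesis .
  qed
  finally show ?thesis .
qed

lemma smooth_q [intro]: "smooth (q i j)"
  unfolding q_def[abs_def] by (intro smooth_diff smooth_const smooth_prod3)

lemma pd_christoffel: "partial_deriv i (christoffel G l j m) x
    = - k * (P i l * q j m x + y l x * partial_deriv i (q j m) x)"
proof -
  have "partial_deriv i (\<lambda>x. - k * (y l x * q j m x)) x
      = partial_deriv i (\<lambda>x. - k) x * (y l x * q j m x) + - k * partial_deriv i (\<lambda>x. y l x * q j m x) x"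
    by (intro partial_deriv_mult smooth_differentiable smooth_mult smooth_y smooth_q smooth_const)
  also have "partial_deriv i (\<lambda>x. - k) x = 0"
    using partial_deriv_eqI[OF has_derivative_const] .
  also have "partial_deriv i (\<lambda>x. y l x * q j m x) x = P i l * q j m x + y l x * partial_deriv i (q j m) x"
    by (subst partial_deriv_mult) (auto intro: smooth_differentiable simp: pd_y)
  finally show ?thesis
    by (simp add: christoffel_G[abs_def] mult.assoc)
qed

text \<open>The form of constant curvature -k, with \<open>P\<close> as identity of the hyperbolic
  factor. The products of Christoffel symbols reduce by \<open>sum_y_q\<close>, the contraction of
  \<open>q\<close> with the position vector.\<close>

lemma riem_up_G: "riem_up G i j m l x = - k * (P l i * q j m x - P l j * q i m x)"
proof -
  have "(\<Sum>n\<in>UNIV. christoffel G n j m x * christoffel G l i n x - christoffel G n i m x * christoffel G l j n x)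
      = k * y l x * (q j m x * ((\<Sum>n\<in>UNIV. y n x * q i n x) * k) - q i m x * ((\<Sum>n\<in>UNIV. y n x * q j n x) * k))"
    by (simp add: christoffel_G sum_distrib_left sum_distrib_right algebra_simps flip: sum_subtractf)
  then show ?thesis
    unfolding riem_up_def pd_christoffel pd_q sum_y_q
    by (simp add: q_def P_sym[of i j] P_sym[of l i] P_sym[of l j] power2_eq_square algebra_simps)
qed

lemma Ric_G: "Ric G [j, m] x = - k * ((\<Sum>i\<in>UNIV. P i i) - 1) * q j m x"
proof -
  have "Ric G [j, m] x = (\<Sum>i\<in>UNIV. - k * (P i i * q j m x - P j i * q i m x))"
    unfolding Ric_def by (intro sum.cong refl) (simp add: riem_up_G P_sym[of j])
  also have "\<dots> = - k * ((\<Sum>i\<in>UNIV. P i i) * q j m x - (\<Sum>i\<in>UNIV. P j i * q i m x))"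
    by (simp only: sum_subtractf[symmetric] sum_distrib_left sum_distrib_right)
  also have "(\<Sum>i\<in>UNIV. P j i * q i m x) = q j m x"
    by (auto simp: q_def)
  finally show ?thesis by (simp add: algebra_simps)
qed

text \<open>\<open>Ric\<close> is a constant multiple of \<open>q\<close>, the metric of one factor
  of a product, and such a tensor is parallel.\<close>

lemma cov_deriv_Ric: "cov_deriv G (Ric G) [b, i, j] x = 0"
proof -
  define c where "c = - k * ((\<Sum>i\<in>UNIV. P i i) - 1)"
  have R: "Ric G [j, m] = (\<lambda>x. c * q j m x)" for j m
    by (auto simp: c_def Ric_G)
  have "partial_deriv b (\<lambda>x. c * q i j x) x = partial_deriv b (\<lambda>x. c) x * q i j x + c * partial_deriv b (q i j) x"
    by (intro partial_deriv_mult smooth_differentiable smooth_q smooth_const)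
  also have "partial_deriv b (\<lambda>x. c) x = 0"
    using partial_deriv_eqI[OF has_derivative_const] .
  finally have pd: "partial_deriv b (\<lambda>x. c * q i j x) x = c * partial_deriv b (q i j) x" by simp
  have 1: "(\<Sum>m\<in>UNIV. christoffel G m b i x * (c * q m j x)) = - c * q b i x * ((\<Sum>m\<in>UNIV. y m x * q j m x) * k)"
    by (simp add: christoffel_G q_sym[of _ j] sum_distrib_left sum_distrib_right algebra_simps)
  have 2: "(\<Sum>m\<in>UNIV. christoffel G m b j x * (c * q i m x)) = - c * q b j x * ((\<Sum>m\<in>UNIV. y m x * q i m x) * k)"
    by (simp add: christoffel_G sum_distrib_left sum_distrib_right algebra_simps)
  have "cov_deriv G (Ric G) [b, i, j] x = c * partial_deriv b (q i j) x
      - ((\<Sum>m\<in>UNIV. christoffel G m b i x * (c * q m j x)) + (\<Sum>m\<in>UNIV. christoffel G m b j x * (c * q i m x)))"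
    by (simp add: cov_deriv_def R pd numeral_2_eq_2)
  also have "\<dots> = 0"
    unfolding 1 2 pd_q sum_y_q by (simp add: q_def power2_eq_square algebra_simps)
  finally show ?thesis .
qed

lemma rough_laplacian_Ric: "rough_laplacian G (Ric G) [i, j] x = 0"
proof -
  \<comment> \<open>The second covariant derivative also involves components with replaced indices,
    hence the claim for every index list of length 3.\<close>
  have 0: "cov_deriv G (Ric G) js = (\<lambda>x. 0)" if "length js = 3" for js
    using that cov_deriv_Ric by (auto simp: length_Suc_conv numeral_3_eq_3)
  have "partial_deriv i (\<lambda>x::real^'n. 0::real) x = 0" for i x
    using partial_deriv_eqI[OF has_derivative_const] .
  then have "cov_deriv G (cov_deriv G (Ric G)) (c # b # [i, j]) x = 0" for c b
    by (simp add: cov_deriv_def[of G "cov_deriv G (Ric G)"] 0)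
  then show ?thesis by (simp add: rough_laplacian_def)
qed

lemma smooth_G_nth: "smooth (\<lambda>x. G x $ i $ j)"
proof -
  have "(\<lambda>x. G x $ i $ j) = (\<lambda>x. (if i = j then 1 else 0) - a x * y i x * y j x)"
    by (simp add: G_def)
  then show ?thesis using smooth_diff[OF smooth_const smooth_prod3] by simp
qed

lemma smooth_ginv: "smooth (ginv G i j)"
  unfolding ginv_G[abs_def] by (intro smooth_add smooth_mult smooth_const smooth_y)

text \<open>The quadratic form is |v|^2 - a (v . x')^2. Cauchy-Schwarz bounds the loss, and
  multiplication by \<open>f\<close> together with \<open>a * f = k\<close> turns this into the
  required bound.\<close>

lemma circle_quotient_G: "0 < \<delta> \<Longrightarrow> circle_quotient G e \<delta> (sqrt k)"
proof
  show "smooth G" by (intro smooth_vecI smooth_G_nth)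
  show "transpose (G x) = G x" for x by (simp add: transpose_def G_def vec_eq_iff mult_ac)
  have y: "y i (x + t *\<^sub>R axis e 1) = y i x" for i x t by (simp add: y_def axis_def)
  show "G (x + t *\<^sub>R axis e 1) = G x" for x t by (simp add: G_def a_def f_def y)
  fix v x :: "real^'n"
  let ?d = "x - (x $ e) *\<^sub>R axis e 1"
  have dy: "?d $ i = y i x" for i by (simp add: y_def axis_def)
  have nd: "(norm ?d)\<^sup>2 = (\<Sum>i\<in>UNIV. (y i x)\<^sup>2)"
    unfolding power2_norm_eq_inner inner_vec_def dy by (simp add: power2_eq_square)
  then have f: "1 + (sqrt k)\<^sup>2 * (norm ?d)\<^sup>2 = f x" using k by (simp add: f_def)
  have "v \<bullet> (G x *v v) = (\<Sum>i\<in>UNIV. \<Sum>j\<in>UNIV. (if i = j then v $ i * v $ j else 0))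
      - a x * (\<Sum>i\<in>UNIV. \<Sum>j\<in>UNIV. (v $ i * y i x) * (v $ j * y j x))"
  proof -
    have "v $ i * (G x $ i $ j * v $ j)
        = (if i = j then v $ i * v $ j else 0) - a x * ((v $ i * y i x) * (v $ j * y j x))" for i j
      by (simp add: G_def algebra_simps)
    then show ?thesis
      unfolding matrix_quadratic_form by (simp only: sum_subtractf sum_distrib_left)
  qed
  also have "\<dots> = (norm v)\<^sup>2 - a x * (v \<bullet> ?d)\<^sup>2"
    unfolding power2_norm_eq_inner inner_vec_def dy power2_eq_square[of "sum _ _"] sum_product by simp
  finally have quad: "v \<bullet> (G x *v v) = (norm v)\<^sup>2 - a x * (v \<bullet> ?d)\<^sup>2" .
  have "(v \<bullet> ?d)\<^sup>2 \<le> (norm v)\<^sup>2 * (norm ?d)\<^sup>2"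
    using Cauchy_Schwarz_ineq[of v ?d] by (simp add: power2_norm_eq_inner)
  then have "k * (v \<bullet> ?d)\<^sup>2 \<le> k * ((norm v)\<^sup>2 * (norm ?d)\<^sup>2)"
    using k by (intro mult_left_mono) auto
  also have "\<dots> = (f x - 1) * (norm v)\<^sup>2" unfolding nd by (simp add: sum_y[symmetric])
  finally have "(norm v)\<^sup>2 \<le> f x * (norm v)\<^sup>2 - k * (v \<bullet> ?d)\<^sup>2" by (simp add: algebra_simps)
  also have "\<dots> = f x * (v \<bullet> (G x *v v))"
  proof -
    have "A * F = K \<Longrightarrow> F * u - K * v = F * (u - A * v)" for A F K u v :: real
      by (auto simp: algebra_simps)
    from this[OF a_f] show ?thesis unfolding quad .
  qed
  finally show "(norm v)\<^sup>2 \<le> (1 + (sqrt k)\<^sup>2 * (norm ?d)\<^sup>2) * (v \<bullet> (G x *v v))"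
    unfolding f .
qed (use k in auto)

lemma Rm_norm_G:
  assumes "i \<noteq> j" "i \<noteq> e" "j \<noteq> e"
  shows "k \<le> Rm_norm_coord G (axis e t)"
proof -
  let ?x = "axis e t :: real^'n"
  have y: "y i ?x = 0" for i by (simp add: y_def axis_def)
  have q: "q i j ?x = P i j" for i j by (simp add: q_def y)
  have "Rm G [i, j, j, i] ?x = (\<Sum>m\<in>UNIV. (if i = m then 1 else 0) * riem_up G i j j m ?x)"
    unfolding Rm_def by (simp add: G_def y)
  also have "\<dots> = riem_up G i j j i ?x" by (simp add: mult_delta_left)
  also have "\<dots> = - k"
    using assms by (simp add: riem_up_G q P_def)
  finally show ?thesis
    using Rm_norm_coord_ge[of G ?x i j j i] k by (simp add: ginv_G y)
qed

end

lemma pd_const [simp]: "partial_deriv i (\<lambda>x. c) x = 0"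
  using partial_deriv_eqI[OF has_derivative_const] .

lemma pd_add: "smooth f \<Longrightarrow> smooth g \<Longrightarrow>
    partial_deriv i (\<lambda>x. f x + g x) x = partial_deriv i f x + partial_deriv i g x"
  by (intro partial_deriv_add smooth_differentiable)

lemma pd_mult: "smooth f \<Longrightarrow> smooth g \<Longrightarrow>
    partial_deriv i (\<lambda>x. f x * g x :: real) x = partial_deriv i f x * g x + f x * partial_deriv i g x"
  by (intro partial_deriv_mult smooth_differentiable)

lemma pd_diff: "smooth f \<Longrightarrow> smooth g \<Longrightarrow>
    partial_deriv i (\<lambda>x. f x - g x :: real) x = partial_deriv i f x - partial_deriv i g x"
  using pd_add[OF _ smooth_mult[OF smooth_const[of "-1"]], of f g i x] pd_mult[OF smooth_const[of "-1"], of g i x]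
  by simp

lemmas pd_simps = pd_add pd_mult pd_diff
lemmas smooth_simps = smooth_add smooth_mult smooth_diff

subsection \<open>The Taub-NUT metric\<close>

text \<open>The Ricci tensor of Taub-NUT is a combination of the tensors \<open>P\<close>,
  \<open>y y\<close> and \<open>u u\<close>; these are its three coefficients. Eliminating
  \<open>s\<close> leaves rational identities in \<open>r\<close> and \<open>c\<close>. The
  abbreviations \<open>a\<close>, \<open>b\<close>, \<open>d\<close>, \<open>g\<close> are the
  coefficients of the Christoffel symbols.\<close>

lemma Ric_coefficients:
  fixes c r s :: real
  assumes "r * (1 + c * s) = 1" "c \<noteq> 0"
  defines "a \<equiv> c * r" and "b \<equiv> c * c * (r * r)" and "d \<equiv> c * c * (r * r * r)" and "g \<equiv> c * r + c * (r * r)"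
  shows "(2 * (c * c * r ^ 2) * s - 2 * a + 2 * g) - (4 * a - b * s - g)
      + (4 * a - b * s - g) * (- a * s) - (- 2 * a * a * s) = 0"
    and "(2 * b - 4 * (c * c * r ^ 2)) - (4 * (c * c * c * r ^ 3) * s - 8 * (c * c * r ^ 2) - 2 * b
        + (2 * (c * c * r ^ 2) + 4 * (c * c * r ^ 3))) + (4 * a - b * s - g) * (2 * a)
      - (2 * a * a - (a - b * s - g) * (b * s + g) + a * (4 * a - b * s - g)) = 0"
    and "(6 * (c * c * c * r ^ 4) * s - 2 * b - 6 * d - 2 * (2 * (c * c * r ^ 2) + 4 * (c * c * r ^ 3)))
      + (4 * a - b * s - g) * (2 * g - d * s)
      - ((2 * g - d * s) * (a - b * s) + 2 * a * b * s + (a - b * s - g) * (g - d * s)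
        + a * g - g * (b * s - 2 * a - d * s + 5 * g)) = 0"
proof -
  have r: "r \<noteq> 0" using assms(1) by auto
  have s: "s = (1 / r - 1) / c" using assms(1,2) r by (simp add: field_simps)
  show "(2 * (c * c * r ^ 2) * s - 2 * a + 2 * g) - (4 * a - b * s - g)
      + (4 * a - b * s - g) * (- a * s) - (- 2 * a * a * s) = 0"
    unfolding s a_def b_def d_def g_def using r assms(2) by (simp add: field_simps) (simp add: algebra_simps power2_eq_square power3_eq_cube power4_eq_xxxx)?
  show "(2 * b - 4 * (c * c * r ^ 2)) - (4 * (c * c * c * r ^ 3) * s - 8 * (c * c * r ^ 2) - 2 * b
        + (2 * (c * c * r ^ 2) + 4 * (c * c * r ^ 3))) + (4 * a - b * s - g) * (2 * a)
      - (2 * a * a - (a - b * s - g) * (b * s + g) + a * (4 * a - b * s - g)) = 0"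
    unfolding s a_def b_def d_def g_def using r assms(2) by (simp add: field_simps) (simp add: algebra_simps power2_eq_square power3_eq_cube power4_eq_xxxx)?
  show "(6 * (c * c * c * r ^ 4) * s - 2 * b - 6 * d - 2 * (2 * (c * c * r ^ 2) + 4 * (c * c * r ^ 3)))
      + (4 * a - b * s - g) * (2 * g - d * s)
      - ((2 * g - d * s) * (a - b * s) + 2 * a * b * s + (a - b * s - g) * (g - d * s)
        + a * g - g * (b * s - 2 * a - d * s + 5 * g)) = 0"
    unfolding s a_def b_def d_def g_def using r assms(2) by (simp add: field_simps) (simp add: algebra_simps power2_eq_square power3_eq_cube power4_eq_xxxx)?
qed

text \<open>The complex structure on the four Taub-NUT coordinates sends the basis vector of \<open>\<tau> i\<close> to
  \<open>\<sigma> i\<close> times that of \<open>i\<close>; \<open>\<sigma>\<close> vanishes on the flat coordinates.\<close>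

locale taub_nut =
  fixes \<sigma> :: "'n::finite \<Rightarrow> real" and \<tau> :: "'n \<Rightarrow> 'n" and e :: 'n and c :: real
  assumes \<tau>\<tau> [simp]: "\<tau> (\<tau> i) = i" and \<sigma>\<tau> [simp]: "\<sigma> (\<tau> i) = - \<sigma> i"
    and \<sigma>_cases: "\<sigma> i = 0 \<or> \<sigma> i = 1 \<or> \<sigma> i = -1"
    and \<sigma>_e [simp]: "\<sigma> e = 0" and sum_\<sigma>: "(\<Sum>i\<in>UNIV. (\<sigma> i)\<^sup>2) = 4" and c: "0 < c"
begin

definition P :: "'n \<Rightarrow> 'n \<Rightarrow> real" where
  "P i j = (if i = j then (\<sigma> i)\<^sup>2 else 0)"

definition J :: "'n \<Rightarrow> 'n \<Rightarrow> real" where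
  "J i j = (if j = \<tau> i then \<sigma> i else 0)"

definition y :: "'n \<Rightarrow> real^'n \<Rightarrow> real" where
  "y i x = (\<sigma> i)\<^sup>2 * x $ i"

definition u :: "'n \<Rightarrow> real^'n \<Rightarrow> real" where
  "u i x = \<sigma> i * x $ \<tau> i"

definition s :: "real^'n \<Rightarrow> real" where
  "s x = (\<Sum>i\<in>UNIV. y i x * y i x)"

definition r :: "real^'n \<Rightarrow> real" where
  "r x = inverse (1 + c * s x)"

definition h :: "real^'n \<Rightarrow> real" where
  "h x = c + c * r x"

text \<open>The Gibbons-Hawking metric with potential a constant plus \<open>1 / \<rho>\<close>, in Cartesian coordinates
  around the nut, where \<open>\<rho>\<close> is proportional to \<open>s x\<close> and \<open>u\<close> is the one-form dual to the circle action.\<close>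

definition G :: "'n metric_field" where
  "G x = (\<chi> i j. (if i = j then 1 else 0) + c * s x * P i j - h x * (u i x * u j x))"

text \<open>\<open>ca\<close>, \<open>cb\<close>, \<open>cd\<close> and \<open>cg\<close> are the
  coefficients \<open>a\<close>, \<open>b\<close>, \<open>d\<close>, \<open>g\<close> of the ansatz
  \<open>Gam\<close> for the Christoffel symbols.\<close>

definition ca where "ca x = c * r x"
definition cb where "cb x = c * c * (r x * r x)"
definition cd where "cd x = c * c * (r x * r x * r x)"
definition cg where "cg x = c * r x + c * (r x * r x)"

lemma s_nonneg: "0 \<le> s x"
  by (simp add: s_def sum_nonneg)

lemma f_pos: "0 < 1 + c * s x"
  using s_nonneg[of x] c by (simp add: add_pos_nonneg)

lemma r_pos: "0 < r x"
  using f_pos by (simp add: r_def)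

lemma r_f: "r x * (1 + c * s x) = 1"
  using f_pos[of x] by (simp add: r_def)

lemma P_sym: "P i j = P j i"
  by (simp add: P_def)

lemma P_diag: "P i i = (\<sigma> i)\<^sup>2"
  by (simp add: P_def)

lemma \<sigma>_fixpoint: "\<tau> i = i \<Longrightarrow> \<sigma> i = 0"
proof -
  assume fp: "\<tau> i = i"
  have "\<sigma> (\<tau> i) = - \<sigma> i" by (rule \<sigma>\<tau>)
  then show "\<sigma> i = 0" unfolding fp by simp
qed

lemma J_diag [simp]: "J i i = 0"
  using \<sigma>_fixpoint[of i] by (auto simp: J_def)

lemma sum_P: "(\<Sum>m\<in>UNIV. P i m * g m) = (\<sigma> i)\<^sup>2 * g i"
  by (simp add: P_def mult_delta_left)

lemma sum_P': "(\<Sum>m\<in>UNIV. P m i * g m) = (\<sigma> i)\<^sup>2 * g i"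
  using sum_P by (simp add: P_sym[of _ i])

lemma sum_J: "(\<Sum>m\<in>UNIV. J i m * g m) = \<sigma> i * g (\<tau> i)"
  by (simp add: J_def mult_delta_left)

lemma sum_J': "(\<Sum>m\<in>UNIV. J m i * g m) = - \<sigma> i * g (\<tau> i)"
proof -
  have "J m i = (if m = \<tau> i then - \<sigma> i else 0)" for m
    by (auto simp: J_def)
  then show ?thesis by (simp add: mult_delta_left)
qed

lemma vec_simps [simp]:
  "(\<sigma> i)\<^sup>2 * y i x = y i x" "(\<sigma> i)\<^sup>2 * u i x = u i x"
  "\<sigma> i * y (\<tau> i) x = u i x" "\<sigma> i * u (\<tau> i) x = - y i x"
  using \<sigma>_cases[of i] by (auto simp: y_def u_def)

lemma mat_simps [simp]: "(\<sigma> i)\<^sup>2 * P i j = P i j" "\<sigma> i * J (\<tau> i) j = - P i j"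
  using \<sigma>_cases[of i] by (auto simp: P_def J_def)

lemma bij_\<tau>: "bij \<tau>"
  by (metis \<tau>\<tau> bijI' )

lemma sum_\<tau>: "(\<Sum>i\<in>UNIV. g (\<tau> i)) = (\<Sum>i\<in>UNIV. g i)"
  using bij_\<tau> by (rule sum.reindex_bij_betw)

lemma sum_yy: "(\<Sum>m\<in>UNIV. y m x * y m x) = s x"
  by (simp add: s_def)

lemma sum_uu: "(\<Sum>m\<in>UNIV. u m x * u m x) = s x"
proof -
  have "u m x * u m x = y (\<tau> m) x * y (\<tau> m) x" for m
    using \<sigma>_cases[of m] by (auto simp: y_def u_def)
  then show ?thesis
    using sum_\<tau>[of "\<lambda>m. y m x * y m x"] by (simp add: s_def)
qed

text \<open>The complex structure is skew: reindexing by \<open>\<tau>\<close> changes the sign of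
  every term.\<close>

lemma sum_yu: "(\<Sum>m\<in>UNIV. y m x * u m x) = 0"
proof -
  have "y (\<tau> m) x * u (\<tau> m) x = - (y m x * u m x)" for m
    using \<sigma>_cases[of m] by (auto simp: y_def u_def)
  then show ?thesis
    using sum_\<tau>[of "\<lambda>m. y m x * u m x"] by (simp add: sum_negf)
qed

lemma sum_uy: "(\<Sum>m\<in>UNIV. u m x * y m x) = 0"
  using sum_yu by (simp add: mult.commute)

lemmas dots = sum_yy sum_uu sum_yu sum_uy

text \<open>Later index sums are expanded into multiples of these elementary contractions and
  evaluated by rewriting, which is why their summands are first brought into a fixed shape.\<close>

lemmas contractions = sum_P sum_P' sum_J sum_J' dots sum_\<sigma> vec_simps mat_simps

lemma smooth_y [simp]: "smooth (y i)"
  unfolding y_def[abs_def] by (intro smooth_mult smooth_const smooth_nth_proj)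

lemma smooth_u [simp]: "smooth (u i)"
  unfolding u_def[abs_def] by (intro smooth_mult smooth_const smooth_nth_proj)

lemma smooth_s [simp]: "smooth s"
  unfolding s_def[abs_def] by (intro smooth_sum smooth_mult smooth_y)

lemma smooth_r [simp]: "smooth r"
  unfolding r_def[abs_def]
  by (intro smooth_inverse smooth_add smooth_mult smooth_const smooth_s) (use f_pos in \<open>simp add: less_imp_neq[symmetric]\<close>)

lemma smooth_h [simp]: "smooth h"
  unfolding h_def[abs_def] by (simp add: smooth_simps)

lemma smooth_coeffs [simp]: "smooth ca" "smooth cb" "smooth cd" "smooth cg"
  unfolding ca_def[abs_def] cb_def[abs_def] cd_def[abs_def] cg_def[abs_def]
  by (simp_all add: smooth_simps)

lemma pd_nth: "partial_deriv i (\<lambda>x::real^'n. x $ j) x = (if i = j then 1 else 0)"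
proof -
  have "((\<lambda>x::real^'n. x $ j) has_derivative (\<lambda>v. v $ j)) (at x)"
    by (auto intro!: derivative_eq_intros)
  from partial_deriv_eqI[OF this] show ?thesis by (auto simp: axis_def)
qed

lemma pd_y [simp]: "partial_deriv i (y j) x = P i j"
  unfolding y_def[abs_def] by (auto simp: pd_mult pd_nth P_def)

lemma pd_u [simp]: "partial_deriv i (u j) x = J j i"
  unfolding u_def[abs_def] by (auto simp: pd_mult pd_nth J_def)

lemma pd_sum:
  "(\<And>k. k \<in> K \<Longrightarrow> smooth (f k)) \<Longrightarrow>
    partial_deriv i (\<lambda>x. \<Sum>k\<in>K. f k x :: real) x = (\<Sum>k\<in>K. partial_deriv i (f k) x)"
  by (induction K rule: infinite_finite_induct) (auto simp: pd_add smooth_sum)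

lemma pd_s [simp]: "partial_deriv i s x = 2 * y i x"
proof -
  have "partial_deriv i s x = 2 * (\<Sum>k\<in>UNIV. P i k * y k x)"
    unfolding s_def[abs_def] by (simp add: pd_sum pd_mult smooth_mult sum_distrib_left mult_ac)
  then show ?thesis by (simp add: contractions)
qed

lemma pd_r [simp]: "partial_deriv i r x = - (2 * c * (r x * r x) * y i x)"
proof -
  have "partial_deriv i (\<lambda>x. 1 + c * s x) x = 2 * c * y i x"
    by (simp add: pd_simps smooth_simps)
  moreover have "partial_deriv i (\<lambda>x. inverse (1 + c * s x)) x
      = - (partial_deriv i (\<lambda>x. 1 + c * s x) x * (inverse (1 + c * s x) * inverse (1 + c * s x)))"
    by (intro partial_deriv_inverse smooth_differentiable smooth_add smooth_mult smooth_const smooth_s)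
       (use f_pos[of x] in linarith)
  ultimately show ?thesis
    by (simp add: r_def[abs_def])
qed

lemma pd_coeffs:
  "partial_deriv i ca x = - 2 * (c * c * r x ^ 2) * y i x"
  "partial_deriv i cb x = - 4 * (c * c * c * r x ^ 3) * y i x"
  "partial_deriv i cd x = - 6 * (c * c * c * r x ^ 4) * y i x"
  "partial_deriv i cg x = - (2 * (c * c * r x ^ 2) + 4 * (c * c * r x ^ 3)) * y i x"
  "partial_deriv i h x = - 2 * (c * c * r x ^ 2) * y i x"
  unfolding ca_def[abs_def] cb_def[abs_def] cd_def[abs_def] cg_def[abs_def] h_def[abs_def]
  by (simp_all add: pd_simps smooth_simps power2_eq_square power3_eq_cube power4_eq_xxxx algebra_simps)

section \<open>Christoffel symbols of the Taub-NUT metric\<close>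

lemma pd_G: "partial_deriv k (\<lambda>x. G x $ i $ j) x =
    2 * c * y k x * P i j + 2 * (c * c * r x ^ 2) * y k x * (u i x * u j x)
    - h x * (J i k * u j x + u i x * J j k)"
proof -
  have "(\<lambda>x. G x $ i $ j) = (\<lambda>x. (if i = j then 1 else 0) + c * s x * P i j - h x * (u i x * u j x))"
    by (simp add: G_def)
  then show ?thesis
    by (simp add: pd_simps smooth_simps pd_coeffs algebra_simps)
qed

lemma rf: "c * (r x * s x) = 1 - r x"
  using r_f[of x] by (simp add: algebra_simps)

text \<open>On the four Taub-NUT coordinates, away from the nut, \<open>G\<close> has eigenvalue
  \<open>r x\<close> along \<open>u\<close> and \<open>1 / r x\<close> on the orthogonal complement
  of \<open>u\<close>. Inversion interchanges the two values.\<close>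

lemma ginv_G: "ginv G i j x = (if i = j then 1 else 0) + (r x - 1) * P i j + h x * (u i x * u j x)"
proof (rule ginv_eqI)
  fix i j
  let ?B = "\<lambda>m. (if m = j then 1 else 0) + (r x - 1) * P m j + h x * (u m x * u j x)"
  have "G x $ i $ m * ?B m = (if m = i then ?B m else 0) + c * s x * (P i m * ?B m)
      - h x * u i x * (if m = j then u m x else 0) - h x * u i x * (r x - 1) * (P m j * u m x)
      - h x * u i x * h x * u j x * (u m x * u m x)" for m
    by (simp add: G_def algebra_simps)
  then have "(\<Sum>m\<in>UNIV. G x $ i $ m * ?B m) = ?B i + c * s x * ((\<sigma> i)\<^sup>2 * ?B i)
      - h x * u i x * u j x - h x * u i x * (r x - 1) * u j x
      - h x * u i x * h x * u j x * s x"
    by (simp only: sum.distrib sum_subtractf sum_distrib_left[symmetric] contractions sum.delta finite UNIV_I if_True)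
  also have "(\<sigma> i)\<^sup>2 * ?B i = r x * P i j + h x * (u i x * u j x)"
  proof -
    have "(\<sigma> i)\<^sup>2 * (if i = j then 1 else 0) = P i j" by (simp add: P_def)
    then have "(\<sigma> i)\<^sup>2 * ?B i = P i j + (r x - 1) * ((\<sigma> i)\<^sup>2 * P i j) + h x * (((\<sigma> i)\<^sup>2 * u i x) * u j x)"
      by (simp only: distrib_left mult_ac)
    then show ?thesis by (simp only: vec_simps mat_simps) (simp add: algebra_simps)
  qed
  also have "?B i + c * s x * (r x * P i j + h x * (u i x * u j x)) - h x * u i x * u j x
      - h x * u i x * (r x - 1) * u j x - h x * u i x * h x * u j x * s x
    = (if i = j then 1 else 0) + (r x * (1 + c * s x) - 1) * P i j
      + h x * (u i x * u j x) * (1 - r x + c * s x - h x * s x)"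
    by (simp add: algebra_simps)
  also have "1 - r x + c * s x - h x * s x = 0"
    using rf[of x] by (simp add: h_def algebra_simps)
  finally show "(\<Sum>m\<in>UNIV. G x $ i $ m * ?B m) = (if i = j then 1 else 0)"
    by (simp add: r_f)
qed (auto simp: G_def P_sym)

text \<open>With \<open>a\<close>, \<open>b\<close>, \<open>d\<close>, \<open>g\<close> as free
  numbers the contractions of Christoffel symbols are polynomial identities, separate from the
  dependence of the coefficients on \<open>r\<close>.\<close>

definition Gam :: "real \<Rightarrow> real \<Rightarrow> real \<Rightarrow> real \<Rightarrow> real^'n \<Rightarrow> 'n \<Rightarrow> 'n \<Rightarrow> 'n \<Rightarrow> real" where
  "Gam a b d g x l i j = a * (y i x * P l j + y j x * P l i - y l x * P i j)
     - b * (u l x * (y i x * u j x + y j x * u i x)) - d * (y l x * (u i x * u j x))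
     - g * (u j x * J l i + u i x * J l j)"

lemma christoffel_G: "christoffel G l i j x = Gam (ca x) (cb x) (cd x) (cg x) x l i j"
proof -
  \<comment> \<open>Christoffel symbols of the first kind, with the index \<open>m\<close>
    lowered.\<close>
  define L where "L m = c * (y i x * P m j + y j x * P m i - y m x * P i j)
      + c * c * r x ^ 2 * (u m x * (y i x * u j x + y j x * u i x) - y m x * (u i x * u j x))
      - h x * (u j x * J m i + u i x * J m j)" for m
  have Jskew: "J m n = - J n m" for m n by (auto simp: J_def)
  have "christoffel G l i j x = (\<Sum>m\<in>UNIV. ginv G l m x * L m)"
    unfolding christoffel_def pd_G sum_distrib_left
  proof (intro sum.cong refl)
    fix m
    show "1 / 2 * (ginv G l m x *
        (2 * c * y i x * P j m + 2 * (c * c * r x ^ 2) * y i x * (u j x * u m x) - h x * (J j i * u m x + u j x * J m i) +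
         (2 * c * y j x * P i m + 2 * (c * c * r x ^ 2) * y j x * (u i x * u m x) - h x * (J i j * u m x + u i x * J m j)) -
         (2 * c * y m x * P i j + 2 * (c * c * r x ^ 2) * y m x * (u i x * u j x) - h x * (J i m * u j x + u i x * J j m))))
      = ginv G l m x * L m"
      unfolding L_def Jskew[of j i] Jskew[of i m] Jskew[of j m] P_sym[of j m] P_sym[of i m]
      by (simp add: algebra_simps)
  qed
  also have "\<dots> = (\<Sum>m\<in>UNIV. (if m = l then L m else 0) + (r x - 1) * (P l m * L m) + h x * u l x * (u m x * L m))"
    by (intro sum.cong refl) (simp add: ginv_G algebra_simps)
  also have "\<dots> = L l + (r x - 1) * ((\<sigma> l)\<^sup>2 * L l) + h x * u l x * (\<Sum>m\<in>UNIV. u m x * L m)"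
    by (simp only: sum.distrib sum_distrib_left[symmetric] contractions sum.delta finite UNIV_I if_True)
  also have "(\<sigma> l)\<^sup>2 * L l = L l"
    using \<sigma>_cases[of l] by (auto simp: L_def y_def u_def P_def J_def)
  also have "(\<Sum>m\<in>UNIV. u m x * L m) = (y i x * u j x + y j x * u i x) * (c + c * c * r x ^ 2 * s x - h x)"
  proof -
    have "u m x * L m = c * y i x * (P m j * u m x) + c * y j x * (P m i * u m x) - c * P i j * (u m x * y m x)
        + c * c * r x ^ 2 * (y i x * u j x + y j x * u i x) * (u m x * u m x)
        - c * c * r x ^ 2 * (u i x * u j x) * (u m x * y m x)
        - h x * u j x * (J m i * u m x) - h x * u i x * (J m j * u m x)" for m
      by (simp add: L_def algebra_simps)
    then show ?thesis
      by (simp only: sum.distrib sum_subtractf sum_distrib_left[symmetric] contractions)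
         (simp add: algebra_simps)
  qed
  also have "c + c * c * r x ^ 2 * s x - h x = - (c * r x ^ 2)"
  proof -
    have "c * c * r x ^ 2 * s x = c * r x * (c * (r x * s x))"
      by (simp add: power2_eq_square)
    then show ?thesis unfolding rf by (simp add: h_def power2_eq_square algebra_simps)
  qed
  finally show ?thesis
    by (simp add: L_def Gam_def ca_def cb_def cd_def cg_def h_def power2_eq_square algebra_simps)
qed

lemma pd_christoffel:
  "partial_deriv n (christoffel G l i j) x =
    - 2 * (c * c * r x ^ 2) * y n x * (y i x * P l j + y j x * P l i - y l x * P i j)
    + ca x * (P n i * P l j + P n j * P l i - P n l * P i j)
    + 4 * (c * c * c * r x ^ 3) * y n x * (u l x * (y i x * u j x + y j x * u i x))
    - cb x * (J l n * (y i x * u j x + y j x * u i x)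
        + u l x * (P n i * u j x + y i x * J j n + P n j * u i x + y j x * J i n))
    + 6 * (c * c * c * r x ^ 4) * y n x * (y l x * (u i x * u j x))
    - cd x * (P n l * (u i x * u j x) + y l x * (J i n * u j x + u i x * J j n))
    + (2 * (c * c * r x ^ 2) + 4 * (c * c * r x ^ 3)) * y n x * (u j x * J l i + u i x * J l j)
    - cg x * (J j n * J l i + J i n * J l j)"
  unfolding christoffel_G[abs_def] Gam_def[abs_def]
  by (simp add: pd_simps smooth_simps pd_coeffs) (simp add: algebra_simps)

section \<open>Contractions of the Christoffel symbols and the Ricci tensor\<close>

lemma Gam_sum_left:
  "(\<Sum>i\<in>UNIV. v i * Gam a b d g x i m j) =
    a * y m x * ((\<sigma> j)\<^sup>2 * v j) + a * y j x * ((\<sigma> m)\<^sup>2 * v m)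
    - (a * P m j + d * (u m x * u j x)) * (\<Sum>i\<in>UNIV. y i x * v i)
    - b * (y m x * u j x + y j x * u m x) * (\<Sum>i\<in>UNIV. u i x * v i)
    + g * u j x * (\<sigma> m * v (\<tau> m)) + g * u m x * (\<sigma> j * v (\<tau> j))"
proof -
  have "v i * Gam a b d g x i m j = a * y m x * (P i j * v i) + a * y j x * (P i m * v i)
      - (a * P m j + d * (u m x * u j x)) * (y i x * v i)
      - b * (y m x * u j x + y j x * u m x) * (u i x * v i)
      - g * u j x * (J i m * v i) - g * u m x * (J i j * v i)" for i
    by (simp add: Gam_def algebra_simps)
  then show ?thesis
    by (simp only: sum.distrib sum_subtractf sum_distrib_left[symmetric] contractions)
qed

lemma Gam_sum_left_y:
  "(\<Sum>i\<in>UNIV. y i x * Gam a b d g x i m j)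
    = 2 * a * (y j x * y m x) + (2 * g - d * s x) * (u j x * u m x) - a * s x * P m j"
  unfolding Gam_sum_left vec_simps dots by (simp add: algebra_simps)

lemma Gam_sum_left_u:
  "(\<Sum>i\<in>UNIV. u i x * Gam a b d g x i m j) = (a - b * s x - g) * (u j x * y m x + y j x * u m x)"
  unfolding Gam_sum_left vec_simps dots by (simp add: algebra_simps)

lemma Gam_sum_right:
  "(\<Sum>i\<in>UNIV. Gam a b d g x m i k * v i) =
    (a * P m k - b * (u k x * u m x)) * (\<Sum>i\<in>UNIV. y i x * v i)
    - (b * (y k x * u m x) + d * (u k x * y m x) + g * J m k) * (\<Sum>i\<in>UNIV. u i x * v i)
    - a * y m x * ((\<sigma> k)\<^sup>2 * v k) + a * y k x * ((\<sigma> m)\<^sup>2 * v m) - g * u k x * (\<sigma> m * v (\<tau> m))"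
proof -
  have "Gam a b d g x m i k * v i = (a * P m k - b * (u k x * u m x)) * (y i x * v i)
      - (b * (y k x * u m x) + d * (u k x * y m x) + g * J m k) * (u i x * v i)
      - a * y m x * (P i k * v i) + a * y k x * (P m i * v i) - g * u k x * (J m i * v i)" for i
    by (simp add: Gam_def algebra_simps)
  then show ?thesis
    by (simp only: sum.distrib sum_subtractf sum_distrib_left[symmetric] contractions)
qed

lemma Gam_\<sigma>: "(\<sigma> m)\<^sup>2 * Gam a b d g x m i j = Gam a b d g x m i j"
proof -
  have "(\<sigma> m)\<^sup>2 * J m i = J m i" for i using \<sigma>_cases[of m] by (auto simp: J_def)
  moreover have "(\<sigma> m)\<^sup>2 * Gam a b d g x m i j = a * (y i x * ((\<sigma> m)\<^sup>2 * P m j) + y j x * ((\<sigma> m)\<^sup>2 * P m i) - ((\<sigma> m)\<^sup>2 * y m x) * P i j)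
     - b * (((\<sigma> m)\<^sup>2 * u m x) * (y i x * u j x + y j x * u i x)) - d * (((\<sigma> m)\<^sup>2 * y m x) * (u i x * u j x))
     - g * (u j x * ((\<sigma> m)\<^sup>2 * J m i) + u i x * ((\<sigma> m)\<^sup>2 * J m j))"
    by (simp add: Gam_def algebra_simps)
  ultimately show ?thesis by (simp only: vec_simps mat_simps Gam_def)
qed

text \<open>For the Taub-NUT coefficients this is the differential of ln sqrt det G = ln(1 + c s).
  The 4 is the trace of \<open>P\<close>.\<close>

lemma Gam_trace: "(\<Sum>m\<in>UNIV. Gam a b d g x m m j) = (4 * a - b * s x - g) * y j x"
proof -
  have "Gam a b d g x m m j = a * y j x * (\<sigma> m)\<^sup>2
      - b * u j x * (y m x * u m x) - b * y j x * (u m x * u m x) - d * u j x * (y m x * u m x)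
      - g * (J m j * u m x)" for m
    by (simp add: Gam_def P_diag algebra_simps)
  then show ?thesis
    by (simp only: sum.distrib sum_subtractf sum_distrib_left[symmetric] contractions) (simp add: algebra_simps)
qed

text \<open>The trace against the complex structure, produced by the last term of
  \<open>Gam_sum_right\<close> when \<open>v\<close> is itself a Christoffel symbol. Four of the
  five \<open>g\<close> come from the sum of \<open>(\<sigma> m)\<^sup>2\<close>.\<close>

lemma Gam_twisted_trace:
  "(\<Sum>m\<in>UNIV. \<sigma> m * Gam a b d g x (\<tau> m) m j) = (b * s x - 2 * a - d * s x + 5 * g) * u j x"
proof -
  have "\<sigma> m * Gam a b d g x (\<tau> m) m j = a * (J m j * y m x) - a * (P m j * u m x)
      + b * u j x * (y m x * y m x) + b * y j x * (y m x * u m x) - d * u j x * (u m x * u m x)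
      + g * u j x * (\<sigma> m)\<^sup>2 + g * (P m j * u m x)" for m
  proof -
    have 1: "\<sigma> m * P (\<tau> m) j * y m x = J m j * y m x"
      using \<sigma>_cases[of m] by (auto simp: P_def J_def)
    have 2: "\<sigma> m * P (\<tau> m) m = 0"
      using \<sigma>_fixpoint[of m] by (auto simp: P_def)
    have 3: "\<sigma> m * J (\<tau> m) m = - (\<sigma> m)\<^sup>2" by (simp add: P_diag)
    have "\<sigma> m * Gam a b d g x (\<tau> m) m j = a * (\<sigma> m * P (\<tau> m) j * y m x + y j x * (\<sigma> m * P (\<tau> m) m) - (\<sigma> m * y (\<tau> m) x) * P m j)
       - b * ((\<sigma> m * u (\<tau> m) x) * (y m x * u j x + y j x * u m x)) - d * ((\<sigma> m * y (\<tau> m) x) * (u m x * u j x))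
       - g * (u j x * (\<sigma> m * J (\<tau> m) m) + u m x * (\<sigma> m * J (\<tau> m) j))"
      by (simp add: Gam_def algebra_simps del: vec_simps mat_simps)
    then show ?thesis
      unfolding 1 2 3 vec_simps mat_simps by (simp add: P_diag algebra_simps)
  qed
  then show ?thesis
    by (simp only: sum.distrib sum_subtractf sum_distrib_left[symmetric] contractions) (simp add: algebra_simps)
qed

text \<open>The inner sum is \<open>Gam_sum_right\<close> applied to a column of \<open>Gam\<close>;
  the outer sum then needs only elementary contractions, one more use of
  \<open>Gam_sum_right\<close> and the two traces.\<close>

lemma Gam_Gam:
  "(\<Sum>m\<in>UNIV. \<Sum>i\<in>UNIV. Gam a b d g x m i k * Gam a b d g x i j m) =
    P j k * (- 2 * a * a * s x)
    + y j x * y k x * (2 * a * a - (a - b * s x - g) * (b * s x + g) + a * (4 * a - b * s x - g))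
    + u j x * u k x * ((2 * g - d * s x) * (a - b * s x) + 2 * a * b * s x + (a - b * s x - g) * (g - d * s x)
        + a * g - g * (b * s x - 2 * a - d * s x + 5 * g))"
proof -
  define K where "K = a - b * s x - g"
  have sym: "Gam a b d g x i j m = Gam a b d g x i m j" for i j m
    by (simp add: Gam_def P_sym[of j m] algebra_simps)
  have "(\<Sum>i\<in>UNIV. Gam a b d g x m i k * Gam a b d g x i j m) =
      2 * a * a * y j x * (P m k * y m x) + a * (2 * g - d * s x) * u j x * (P m k * u m x)
      - a * a * s x * (P m k * P m j)
      - 2 * a * b * u k x * y j x * (u m x * y m x) - b * (2 * g - d * s x) * u k x * u j x * (u m x * u m x)
      + a * b * s x * u k x * (P m j * u m x)
      - b * y k x * K * u j x * (u m x * y m x) - b * y k x * K * y j x * (u m x * u m x)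
      - d * u k x * K * u j x * (y m x * y m x) - d * u k x * K * y j x * (y m x * u m x)
      - g * K * u j x * (J m k * y m x) - g * K * y j x * (J m k * u m x)
      - a * (Gam a b d g x k m j * y m x) + a * y k x * Gam a b d g x m m j
      - g * u k x * (\<sigma> m * Gam a b d g x (\<tau> m) m j)" for m
    unfolding sym[of _ j] Gam_sum_right Gam_sum_left_y Gam_sum_left_u Gam_\<sigma> K_def[symmetric]
    by (simp add: algebra_simps)
  then have "(\<Sum>m\<in>UNIV. \<Sum>i\<in>UNIV. Gam a b d g x m i k * Gam a b d g x i j m) =
      2 * a * a * y j x * y k x + a * (2 * g - d * s x) * u j x * u k x
      - a * a * s x * P k j - b * (2 * g - d * s x) * u k x * u j x * s x
      + a * b * s x * u k x * u j x - b * y k x * K * y j x * s x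
      - d * u k x * K * u j x * s x
      - g * K * u j x * (- u k x) - g * K * y j x * y k x
      - a * ((a * P k j - b * (u j x * u k x)) * s x - a * y k x * y j x + a * y j x * y k x - g * u j x * u k x)
      + a * y k x * ((4 * a - b * s x - g) * y j x)
      - g * u k x * ((b * s x - 2 * a - d * s x + 5 * g) * u j x)"
    by (simp only: sum.distrib sum_subtractf sum_distrib_left[symmetric] contractions
        Gam_sum_right Gam_trace Gam_twisted_trace) simp
  then show ?thesis
    by (simp add: K_def P_sym[of k j] algebra_simps)
qed

lemma div_christoffel:
  "(\<Sum>i\<in>UNIV. partial_deriv i (christoffel G i j k) x) =
    P j k * (2 * (c * c * r x ^ 2) * s x - 2 * ca x + 2 * cg x)
    + y j x * y k x * (2 * cb x - 4 * (c * c * r x ^ 2))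
    + u j x * u k x * (6 * (c * c * c * r x ^ 4) * s x - 2 * cb x - 6 * cd x
        - 2 * (2 * (c * c * r x ^ 2) + 4 * (c * c * r x ^ 3)))"
proof -
  have "partial_deriv i (christoffel G i j k) x =
    - 2 * (c * c * r x ^ 2) * y j x * (P i k * y i x) - 2 * (c * c * r x ^ 2) * y k x * (P i j * y i x)
    + 2 * (c * c * r x ^ 2) * P j k * (y i x * y i x)
    + 2 * ca x * (P i j * P i k) - ca x * P j k * (\<sigma> i)\<^sup>2
    + 4 * (c * c * c * r x ^ 3) * (y j x * u k x + y k x * u j x) * (y i x * u i x)
    - cb x * u k x * (P i j * u i x) - cb x * u j x * (P i k * u i x)
    - cb x * y j x * (J k i * u i x) - cb x * y k x * (J j i * u i x)
    + 6 * (c * c * c * r x ^ 4) * (u j x * u k x) * (y i x * y i x)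
    - cd x * (u j x * u k x) * (\<sigma> i)\<^sup>2 - cd x * u k x * (J j i * y i x) - cd x * u j x * (J k i * y i x)
    + (2 * (c * c * r x ^ 2) + 4 * (c * c * r x ^ 3)) * u k x * (J i j * y i x)
    + (2 * (c * c * r x ^ 2) + 4 * (c * c * r x ^ 3)) * u j x * (J i k * y i x)
    - cg x * (J k i * J i j) - cg x * (J j i * J i k)" for i
    unfolding pd_christoffel by (simp add: P_diag algebra_simps)
  then show ?thesis
    by (simp only: sum.distrib sum_subtractf sum_distrib_left[symmetric] contractions)
       (simp add: P_sym[of k j] algebra_simps)
qed

lemma pd_trace_christoffel:
  "(\<Sum>i\<in>UNIV. partial_deriv j (christoffel G i i k) x) =
    P j k * (4 * ca x - cb x * s x - cg x)
    + y j x * y k x * (4 * (c * c * c * r x ^ 3) * s x - 8 * (c * c * r x ^ 2) - 2 * cb x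
        + (2 * (c * c * r x ^ 2) + 4 * (c * c * r x ^ 3)))"
proof -
  have "partial_deriv j (christoffel G i i k) x =
    - 2 * (c * c * r x ^ 2) * y j x * y k x * (\<sigma> i)\<^sup>2
    + ca x * P j k * (\<sigma> i)\<^sup>2
    + ca x * (P i j * P i k) - ca x * (P i j * P i k)
    + 4 * (c * c * c * r x ^ 3) * y j x * u k x * (y i x * u i x) + 4 * (c * c * c * r x ^ 3) * y j x * y k x * (u i x * u i x)
    - cb x * u k x * (J i j * y i x) - cb x * y k x * (J i j * u i x)
    - cb x * u k x * (P i j * u i x) - cb x * J k j * (y i x * u i x)
    - cb x * P j k * (u i x * u i x) - cb x * y k x * (J i j * u i x)
    + 6 * (c * c * c * r x ^ 4) * y j x * u k x * (y i x * u i x)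
    - cd x * u k x * (P i j * u i x) - cd x * u k x * (J i j * y i x) - cd x * J k j * (y i x * u i x)
    + (2 * (c * c * r x ^ 2) + 4 * (c * c * r x ^ 3)) * y j x * (J i k * u i x)
    - cg x * (J i j * J i k)" for i
    unfolding pd_christoffel by (simp add: P_diag P_sym[of j i] algebra_simps)
  then show ?thesis
    by (simp only: sum.distrib sum_subtractf sum_distrib_left[symmetric] contractions)
       (simp add: P_sym[of k j] algebra_simps)
qed

lemma Ric_G: "Ric G [j, k] x = 0"
proof -
  let ?\<Gamma> = "Gam (ca x) (cb x) (cd x) (cg x) x"
  let ?t = "4 * ca x - cb x * s x - cg x"
  have sym: "?\<Gamma> i j m = ?\<Gamma> i m j" for i j m
    by (simp add: Gam_def P_sym[of j m] algebra_simps)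
  have "(\<Sum>i\<in>UNIV. \<Sum>m\<in>UNIV. ?\<Gamma> m j k * ?\<Gamma> i i m) = (\<Sum>m\<in>UNIV. ?\<Gamma> m j k * (\<Sum>i\<in>UNIV. ?\<Gamma> i i m))"
    by (subst sum.swap) (simp add: sum_distrib_left)
  also have "\<dots> = ?t * (\<Sum>m\<in>UNIV. y m x * ?\<Gamma> m j k)"
    unfolding Gam_trace sum_distrib_left by (simp add: mult_ac)
  finally have 1: "(\<Sum>i\<in>UNIV. \<Sum>m\<in>UNIV. ?\<Gamma> m j k * ?\<Gamma> i i m) = ?t *
      (2 * ca x * (y k x * y j x) + (2 * cg x - cd x * s x) * (u k x * u j x) - ca x * s x * P j k)"
    unfolding Gam_sum_left_y .
  have 2: "(\<Sum>i\<in>UNIV. \<Sum>m\<in>UNIV. ?\<Gamma> m i k * ?\<Gamma> i j m) = (\<Sum>m\<in>UNIV. \<Sum>i\<in>UNIV. ?\<Gamma> m i k * ?\<Gamma> i j m)"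
    by (rule sum.swap)
  have "Ric G [j, k] x = (\<Sum>i\<in>UNIV. partial_deriv i (christoffel G i j k) x)
      - (\<Sum>i\<in>UNIV. partial_deriv j (christoffel G i i k) x)
      + (\<Sum>i\<in>UNIV. \<Sum>m\<in>UNIV. ?\<Gamma> m j k * ?\<Gamma> i i m)
      - (\<Sum>i\<in>UNIV. \<Sum>m\<in>UNIV. ?\<Gamma> m i k * ?\<Gamma> i j m)"
    unfolding Ric_def riem_up_def christoffel_G
    by (simp add: sum.distrib sum_subtractf flip: christoffel_G)
  \<comment> \<open>The terms are grouped so that the three brackets are literally the left-hand
    sides of \<open>Ric_coefficients\<close>.\<close>
  then have "Ric G [j, k] x =
      P j k * ((2 * (c * c * r x ^ 2) * s x - 2 * ca x + 2 * cg x) - ?t + ?t * (- ca x * s x) - (- 2 * ca x * ca x * s x))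
      + y j x * y k x * ((2 * cb x - 4 * (c * c * r x ^ 2)) - (4 * (c * c * c * r x ^ 3) * s x - 8 * (c * c * r x ^ 2) - 2 * cb x
        + (2 * (c * c * r x ^ 2) + 4 * (c * c * r x ^ 3))) + ?t * (2 * ca x)
        - (2 * ca x * ca x - (ca x - cb x * s x - cg x) * (cb x * s x + cg x) + ca x * ?t))
      + u j x * u k x * ((6 * (c * c * c * r x ^ 4) * s x - 2 * cb x - 6 * cd x - 2 * (2 * (c * c * r x ^ 2) + 4 * (c * c * r x ^ 3)))
        + ?t * (2 * cg x - cd x * s x)
        - ((2 * cg x - cd x * s x) * (ca x - cb x * s x) + 2 * ca x * cb x * s x + (ca x - cb x * s x - cg x) * (cg x - cd x * s x)
        + ca x * cg x - cg x * (cb x * s x - 2 * ca x - cd x * s x + 5 * cg x)))"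
    unfolding div_christoffel pd_trace_christoffel 1 2 Gam_Gam by (simp add: algebra_simps)
  also have "\<dots> = 0"
    unfolding ca_def cb_def cd_def cg_def
    using Ric_coefficients[OF r_f[of x]] c by simp
  finally show ?thesis .
qed


section \<open>Lower bound of the Taub-NUT metric and its curvature at the nut\<close>

lemma smooth_G_nth: "smooth (\<lambda>x. G x $ i $ j)"
proof -
  have "(\<lambda>x. G x $ i $ j) = (\<lambda>x. (if i = j then 1 else 0) + c * s x * P i j - h x * (u i x * u j x))"
    by (simp add: G_def)
  then show ?thesis by (simp add: smooth_simps)
qed

lemma smooth_ginv: "smooth (ginv G i j)"
  unfolding ginv_G[abs_def] by (simp add: smooth_simps)

text \<open>The smallest eigenvalue is \<open>r\<close>, attained along \<open>u\<close>. With
  \<open>p\<close> the squared norm of the Taub-NUT part of \<open>v\<close> and \<open>w\<close>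
  its product with \<open>u\<close>, Cauchy-Schwarz gives \<open>w\<^sup>2 \<le> s x * p\<close>,
  and \<open>h s = c s + 1 - r\<close> leaves at least |v|^2 - (1 - r) p.\<close>

lemma G_lower_bound: "(norm v)\<^sup>2 \<le> (1 + c * s x) * (v \<bullet> (G x *v v))"
proof -
  define p where "p = (\<Sum>i\<in>UNIV. (\<sigma> i * v $ i)\<^sup>2)"
  define w where "w = (\<Sum>i\<in>UNIV. u i x * v $ i)"
  have "v $ i * (G x $ i $ j * v $ j) = (if i = j then v $ i * v $ j else 0)
      + c * s x * (P i j * (v $ i * v $ j)) - h x * ((u i x * v $ i) * (u j x * v $ j))" for i j
    by (simp add: G_def algebra_simps)
  then have "v \<bullet> (G x *v v) = (\<Sum>i\<in>UNIV. \<Sum>j\<in>UNIV. if i = j then v $ i * v $ j else 0)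
      + c * s x * (\<Sum>i\<in>UNIV. \<Sum>j\<in>UNIV. P i j * (v $ i * v $ j))
      - h x * (\<Sum>i\<in>UNIV. \<Sum>j\<in>UNIV. (u i x * v $ i) * (u j x * v $ j))"
    unfolding matrix_quadratic_form by (simp only: sum.distrib sum_subtractf sum_distrib_left)
  also have "(\<Sum>i\<in>UNIV. \<Sum>j\<in>UNIV. P i j * (v $ i * v $ j)) = p"
    unfolding sum_P p_def by (simp add: power2_eq_square mult_ac)
  also have "(\<Sum>i\<in>UNIV. \<Sum>j\<in>UNIV. (u i x * v $ i) * (u j x * v $ j)) = w\<^sup>2"
    by (simp add: w_def power2_eq_square sum_product)
  also have "(\<Sum>i\<in>UNIV. \<Sum>j\<in>UNIV. if i = j then v $ i * v $ j else 0) = (norm v)\<^sup>2"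
    by (simp add: power2_norm_eq_inner inner_vec_def)
  finally have quad: "v \<bullet> (G x *v v) = (norm v)\<^sup>2 + c * s x * p - h x * w\<^sup>2" .
  have "w = (\<chi> i. u i x) \<bullet> (\<chi> i. \<sigma> i * \<sigma> i * v $ i)"
    unfolding w_def inner_vec_def
  proof (intro sum.cong refl)
    show "u i x * v $ i = (\<chi> i. u i x) $ i \<bullet> (\<chi> i. \<sigma> i * \<sigma> i * v $ i) $ i" for i
      using \<sigma>_cases[of i] by (auto simp: u_def)
  qed
  then have "w\<^sup>2 \<le> ((\<chi> i. u i x) \<bullet> (\<chi> i. u i x)) * ((\<chi> i. \<sigma> i * \<sigma> i * v $ i) \<bullet> (\<chi> i. \<sigma> i * \<sigma> i * v $ i))"
    using Cauchy_Schwarz_ineq by metis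
  also have "(\<chi> i. u i x) \<bullet> (\<chi> i. u i x) = s x"
    by (simp add: inner_vec_def sum_uu)
  also have "(\<chi> i. \<sigma> i * \<sigma> i * v $ i) \<bullet> (\<chi> i. \<sigma> i * \<sigma> i * v $ i) = p"
    unfolding inner_vec_def p_def
  proof (intro sum.cong refl)
    show "(\<chi> i. \<sigma> i * \<sigma> i * v $ i) $ i \<bullet> (\<chi> i. \<sigma> i * \<sigma> i * v $ i) $ i = (\<sigma> i * v $ i)\<^sup>2" for i
      using \<sigma>_cases[of i] by (auto simp: power2_eq_square)
  qed
  finally have w: "w\<^sup>2 \<le> s x * p" .
  have h: "0 \<le> h x" "h x * s x = c * s x + (1 - r x)"
    using c r_pos[of x] rf[of x] by (auto simp: h_def algebra_simps)
  have "p \<le> (norm v)\<^sup>2"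
    unfolding p_def power2_norm_eq_inner inner_vec_def
  proof (rule sum_mono)
    show "(\<sigma> i * v $ i)\<^sup>2 \<le> v $ i \<bullet> v $ i" for i
      using \<sigma>_cases[of i] by (auto simp: power2_eq_square)
  qed
  moreover have "r x \<le> 1"
    using s_nonneg[of x] c by (simp add: r_def inverse_le_1_iff)
  ultimately have "(1 - r x) * p \<le> (1 - r x) * (norm v)\<^sup>2"
    by (intro mult_left_mono) auto
  moreover have "h x * w\<^sup>2 \<le> (c * s x + (1 - r x)) * p"
    using mult_left_mono[OF w h(1)] h(2) by (simp add: mult.assoc[symmetric])
  ultimately have "r x * (norm v)\<^sup>2 \<le> v \<bullet> (G x *v v)"
    unfolding quad by (simp add: algebra_simps)
  then have "(1 + c * s x) * (r x * (norm v)\<^sup>2) \<le> (1 + c * s x) * (v \<bullet> (G x *v v))"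
    using f_pos[of x] by (intro mult_left_mono) auto
  moreover have "(1 + c * s x) * (r x * (norm v)\<^sup>2) = (r x * (1 + c * s x)) * (norm v)\<^sup>2"
    by (simp only: mult_ac)
  ultimately show ?thesis by (simp only: r_f mult_1)
qed

lemma \<tau>_e: "\<tau> i = e \<Longrightarrow> \<sigma> i = 0"
  using \<sigma>\<tau>[of i] by simp

lemma circle_quotient_G: "0 < \<delta> \<Longrightarrow> circle_quotient G e \<delta> (sqrt c)"
proof
  show "smooth G" by (intro smooth_vecI smooth_G_nth)
  show "transpose (G x) = G x" for x by (simp add: transpose_def G_def vec_eq_iff P_sym mult_ac eq_commute)
  have y: "y i (x + t *\<^sub>R axis e 1) = y i x" for i x t
    by (simp add: y_def axis_def)
  have u: "u i (x + t *\<^sub>R axis e 1) = u i x" for i x t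
    using \<tau>_e[of i] by (auto simp: u_def axis_def)
  show "G (x + t *\<^sub>R axis e 1) = G x" for x t
    by (simp add: G_def h_def r_def s_def y u)
  fix v x :: "real^'n"
  let ?d = "x - (x $ e) *\<^sub>R axis e 1"
  have "s x \<le> (norm ?d)\<^sup>2"
    unfolding s_def power2_norm_eq_inner inner_vec_def
  proof (rule sum_mono)
    show "y i x * y i x \<le> ?d $ i \<bullet> ?d $ i" for i
      using \<sigma>_cases[of i] by (auto simp: y_def axis_def)
  qed
  then have "1 + c * s x \<le> 1 + (sqrt c)\<^sup>2 * (norm ?d)\<^sup>2"
    using c by (simp add: mult_left_mono)
  moreover have "0 \<le> v \<bullet> (G x *v v)"
    using G_lower_bound[of v x] f_pos[of x]
    by (meson order_trans zero_le_mult_iff zero_le_power2 not_le order.strict_implies_order)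
  ultimately have "(1 + c * s x) * (v \<bullet> (G x *v v)) \<le> (1 + (sqrt c)\<^sup>2 * (norm ?d)\<^sup>2) * (v \<bullet> (G x *v v))"
    by (rule mult_right_mono)
  with G_lower_bound[of v x]
  show "(norm v)\<^sup>2 \<le> (1 + (sqrt c)\<^sup>2 * (norm ?d)\<^sup>2) * (v \<bullet> (G x *v v))"
    by (rule order_trans)
qed (use c in auto)

text \<open>The axis consists of nuts, where the metric matrix is the identity. The component is
  taken on the plane of a direction and its image under the complex structure. The parameter
  \<open>c\<close> has the dimension of curvature, so large \<open>c\<close> means small
  scale.\<close>

lemma Rm_norm_G: "4 * c \<le> Rm_norm_coord G (axis e t)"
proof -
  let ?x = "axis e t :: real^'n"
  obtain i where i: "\<sigma> i \<noteq> 0"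
    using sum_\<sigma> by (metis power_zero_numeral sum.neutral zero_neq_numeral)
  define j where "j = \<tau> i"
  have y: "y i ?x = 0" for i by (auto simp: y_def axis_def)
  have u: "u i ?x = 0" for i using \<tau>_e[of i] by (auto simp: u_def axis_def)
  have r: "r ?x = 1" by (simp add: r_def s_def y)
  have ij: "j \<noteq> i" using \<sigma>_fixpoint[of i] i by (auto simp: j_def)
  have vals: "P i i = 1" "P j j = 1" "P i j = 0" "P j i = 0" "J i j * J j i = -1" "J i j * J i j = 1"
    using \<sigma>_cases[of i] i ij by (auto simp: P_def J_def j_def)
  have "riem_up G i j j i ?x = 4 * c"
    unfolding riem_up_def pd_christoffel christoffel_G Gam_def
    using vals by (simp add: y u ca_def cg_def r algebra_simps)
  moreover have "Rm G [i, j, j, i] ?x = (\<Sum>m\<in>UNIV. (if i = m then 1 else 0) * riem_up G i j j m ?x)"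
    unfolding Rm_def by (simp add: G_def u s_def y)
  ultimately have "Rm G [i, j, j, i] ?x = 4 * c" by (simp add: mult_delta_left)
  then show ?thesis
    using Rm_norm_coord_ge[of G ?x i j j i] c by (simp add: ginv_G u r)
qed

end

text \<open>Two pairs of indices exchanged by \<open>\<tau>\<close> carry the complex structure, and
  a fifth index is the circle direction; this is where the dimension bound enters.\<close>

lemma exists_taub_nut:
  assumes "5 \<le> CARD('n::finite)" "0 < c"
  shows "\<exists>(\<sigma> :: 'n \<Rightarrow> real) \<tau> e. taub_nut \<sigma> \<tau> e c"
proof -
  obtain A :: "'n set" where A: "card A = 5"
    using obtain_subset_with_card_n[OF assms(1)] by blast
  obtain xs where xs: "set xs = A" "distinct xs"
    using finite_distinct_list[of A] by auto
  then have "distinct xs" "length xs = 5"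
    using A distinct_card[of xs] by simp_all
  moreover from this obtain a\<^sub>1 a\<^sub>2 a\<^sub>3 a\<^sub>4 e where "xs = [a\<^sub>1, a\<^sub>2, a\<^sub>3, a\<^sub>4, e]"
    by (auto simp: numeral_eq_Suc length_Suc_conv)
  ultimately have d: "distinct [a\<^sub>1, a\<^sub>2, a\<^sub>3, a\<^sub>4, e]" by simp
  define \<sigma> :: "'n \<Rightarrow> real" where
    "\<sigma> i = (if i = a\<^sub>1 \<or> i = a\<^sub>3 then -1 else if i = a\<^sub>2 \<or> i = a\<^sub>4 then 1 else 0)" for i
  define \<tau> where "\<tau> i = (if i = a\<^sub>1 then a\<^sub>2 else if i = a\<^sub>2 then a\<^sub>1 else if i = a\<^sub>3 then a\<^sub>4
    else if i = a\<^sub>4 then a\<^sub>3 else i)" for i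
  have "(\<Sum>i\<in>UNIV. (\<sigma> i)\<^sup>2) = (\<Sum>i\<in>{a\<^sub>1, a\<^sub>2, a\<^sub>3, a\<^sub>4}. (\<sigma> i)\<^sup>2)"
    by (rule sum.mono_neutral_right) (auto simp: \<sigma>_def)
  also have "\<dots> = 4" using d by (auto simp: \<sigma>_def)
  finally have "taub_nut \<sigma> \<tau> e c"
    using d assms(2) by unfold_locales (auto simp: \<sigma>_def \<tau>_def)
  then show ?thesis by blast
qed

text \<open>\<open>ln\<close> takes the same value at \<open>t\<close> and \<open>-t\<close>, hence
  so does \<open>powr\<close>. This supplies a nonnegative base for the continuity of
  powers.\<close>

lemma powr_abs: "\<bar>t\<bar> powr p = t powr p" for t p :: real
  by (cases "t < 0") (auto simp: powr_def ln_minus)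

theorem theorem1p6:
  shows "(\<exists>\<alpha> \<beta>. \<not> (\<exists>\<epsilon>>0. \<exists>C>0. \<forall>M :: (pt, 4) riem.
           complete_riemannian M \<and> critical_metric \<alpha> \<beta> M \<longrightarrow>
           (\<forall>p\<in>points M. \<forall>r::real. 0 < r \<and> r \<le> 1 \<longrightarrow>
              (\<integral>\<^sup>+q\<in>geo_ball M p r. ennreal (Rm_norm M q ^ 2) \<partial>riem_volume M) \<le> ennreal \<epsilon> \<longrightarrow>
              (SUP q\<in>geo_ball M p (r/2). ennreal (Rm_norm M q)) \<le> ennreal (C / r^2))))
    \<and> (CARD('n::finite) \<ge> 5 \<longrightarrow>
         \<not> (\<exists>\<epsilon>>0. \<exists>C>0. \<forall>M :: (pt, 'n) riem. \<forall>lam::real.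
           complete_riemannian M \<and> einstein_metric lam M \<and> \<bar>lam\<bar> \<le> real CARD('n) - 1 \<longrightarrow>
           (\<forall>p\<in>points M. \<forall>r::real. 0 < r \<and> r \<le> 1 \<longrightarrow>
              (\<integral>\<^sup>+q\<in>geo_ball M p r. ennreal (Rm_norm M q powr (real CARD('n) / 2)) \<partial>riem_volume M)
                \<le> ennreal \<epsilon> \<longrightarrow>
              (SUP q\<in>geo_ball M p (r/2). ennreal (Rm_norm M q)) \<le> ennreal (C / r^2))))"
\<comment> \<open>Zero is the witness for both coefficient systems, so a metric is critical when the
  rough Laplacian of its Ricci tensor vanishes.\<close>
proof (intro conjI impI exI[of _ "\<lambda>_. 0"] notI; elim exE conjE)
  fix \<epsilon> C :: real
  assume "0 < \<epsilon>" "0 < C" and reg: "\<forall>M :: (pt, 4) riem.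
    complete_riemannian M \<and> critical_metric (\<lambda>_. 0) (\<lambda>_. 0) M \<longrightarrow>
    (\<forall>p\<in>points M. \<forall>r::real. 0 < r \<and> r \<le> 1 \<longrightarrow>
      (\<integral>\<^sup>+q\<in>geo_ball M p r. ennreal (Rm_norm M q ^ 2) \<partial>riem_volume M) \<le> ennreal \<epsilon> \<longrightarrow>
      (SUP q\<in>geo_ball M p (r/2). ennreal (Rm_norm M q)) \<le> ennreal (C / r^2))"
  \<comment> \<open>Index 0 is the circle direction and the curvature is -2C; the plane of indices 1
    and 2 then shows that the norm exceeds \<open>C\<close>.\<close>
  interpret hyperbolic "0 :: 4" "2 * C" by unfold_locales (use \<open>0 < C\<close> in simp)
  show False
  proof (rule collapsing_contradiction[OF circle_quotient_G _ _ \<open>0 < \<epsilon>\<close> \<open>0 < C\<close> _ reg])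
    show "continuous_on UNIV (\<lambda>x. (Rm_norm_coord G x)\<^sup>2)"
      by (intro continuous_intros continuous_Rm_norm_coord smooth_G_nth smooth_ginv)
    show "C < Rm_norm_coord G (axis 0 t)" for t
      using Rm_norm_G[of 1 2 t] \<open>0 < C\<close> by simp
    show "critical_metric (\<lambda>_. 0) (\<lambda>_. 0) M" if "rm_metric M = (\<lambda>_. G)" for M :: "(pt, 4) riem"
      by (simp add: critical_metric_def that rough_laplacian_Ric Rm_star_Ric_def)
  qed
next
  fix \<epsilon> C :: real
  assume card: "5 \<le> CARD('n)" and "0 < \<epsilon>" "0 < C"
    and reg: "\<forall>M :: (pt, 'n) riem. \<forall>lam::real.
      complete_riemannian M \<and> einstein_metric lam M \<and> \<bar>lam\<bar> \<le> real CARD('n) - 1 \<longrightarrow>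
      (\<forall>p\<in>points M. \<forall>r::real. 0 < r \<and> r \<le> 1 \<longrightarrow>
        (\<integral>\<^sup>+q\<in>geo_ball M p r. ennreal (Rm_norm M q powr (real CARD('n) / 2)) \<partial>riem_volume M)
          \<le> ennreal \<epsilon> \<longrightarrow>
        (SUP q\<in>geo_ball M p (r/2). ennreal (Rm_norm M q)) \<le> ennreal (C / r^2))"
  obtain \<sigma> \<tau> and e :: 'n where "taub_nut \<sigma> \<tau> e C"
    using exists_taub_nut[OF card \<open>0 < C\<close>] by blast
  then interpret taub_nut \<sigma> \<tau> e C .
  \<comment> \<open>Specialization to Einstein constant 0, in the shape expected by
    \<open>collapsing_contradiction\<close>. With \<open>c = C\<close> the curvature at the nut is
    at least 4C.\<close>
  have reg0: "\<forall>M :: (pt, 'n) riem. complete_riemannian M \<and> einstein_metric 0 M \<longrightarrow>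
      (\<forall>p\<in>points M. \<forall>r::real. 0 < r \<and> r \<le> 1 \<longrightarrow>
        (\<integral>\<^sup>+q\<in>geo_ball M p r. ennreal (Rm_norm M q powr (real CARD('n) / 2)) \<partial>riem_volume M)
          \<le> ennreal \<epsilon> \<longrightarrow>
        (SUP q\<in>geo_ball M p (r/2). ennreal (Rm_norm M q)) \<le> ennreal (C / r^2))"
  proof (intro allI impI)
    fix M :: "(pt, 'n) riem"
    assume "complete_riemannian M \<and> einstein_metric 0 M"
    then have "complete_riemannian M \<and> einstein_metric 0 M \<and> \<bar>0::real\<bar> \<le> real CARD('n) - 1"
      using card by simp
    from reg[THEN spec, THEN spec, THEN mp, OF this]
    show "\<forall>p\<in>points M. \<forall>r::real. 0 < r \<and> r \<le> 1 \<longrightarrow>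
        (\<integral>\<^sup>+q\<in>geo_ball M p r. ennreal (Rm_norm M q powr (real CARD('n) / 2)) \<partial>riem_volume M)
          \<le> ennreal \<epsilon> \<longrightarrow>
        (SUP q\<in>geo_ball M p (r/2). ennreal (Rm_norm M q)) \<le> ennreal (C / r^2)" .
  qed
  show False
  proof (rule collapsing_contradiction[OF circle_quotient_G _ _ \<open>0 < \<epsilon>\<close> \<open>0 < C\<close> _ reg0])
    have "continuous_on UNIV (\<lambda>x. \<bar>Rm_norm_coord G x\<bar> powr (real CARD('n) / 2))"
      by (intro continuous_on_powr' continuous_intros continuous_Rm_norm_coord smooth_G_nth smooth_ginv) auto
    then show "continuous_on UNIV (\<lambda>x. Rm_norm_coord G x powr (real CARD('n) / 2))"
      by (simp add: powr_abs)
    show "C < Rm_norm_coord G (axis e t)" for t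
      using Rm_norm_G[of t] \<open>0 < C\<close> by simp
    show "einstein_metric 0 M" if "rm_metric M = (\<lambda>_. G)" for M :: "(pt, 'n) riem"
      by (simp add: einstein_metric_def that Ric_G)
  qed
qed

end
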